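(* Let $p$ be a prime number and let $k$ be an arbitrary field with $\operatorname{char} k\neq p$. If $n\geq 3$ is an integer, then the universal division algebra $UD(k,p^n)$ over $k$ of degree $p^n$ is a noncrossed product.
   Context: Crossed products: let $D$ be a division algebra which is finite dimensional over its center $F$. $D$ is called a crossed product if it contains a maximal subfield which is Galois over $F$. $D$ is called a noncrossed product if it does not contain any maximal subfield that is a Galois extension of $F$. Universal division algebra $UD(k,d)$, for a field $k$ and an integer $d\geq 1$: let $X=\{x_{ij}^{(r)} \mid 1\leq i,j\leq d,\ r\geq 2\}$ be a set of independent commuting variables (here $r$ runs over all integers $\geq 2$), let $k[X]$ be the polynomial ring in all the $x_{ij}^{(r)}$ over $k$, and let $k(X)$ be its fraction field. For each $r$, the generic $d\times d$ matrix is $\xi^{(r)}=[x_{ij}^{(r)}]\in M_d(k[X])\subseteq M_d(k(X))$. The generic matrix algebra $B_d$ over $k$ of degree $d$ is the (unital) $k$-subalgebra of $M_d(k(X))$ generated by all the matrices $\xi^{(r)}$. It is well known that $B_d$ is a domain, so its center $R$ is an integral domain; let $L_d$ be the fraction field of $R$. Then $UD(k,d)=B_d\otimes_R L_d$. It is known that $UD(k,d)$ is a division algebra of degree $d$, i.e. of dimension $d^2$ over its center. *)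

theory Defs
  imports
    "HOL-Algebra.Algebra"
    "HOL-Library.Poly_Mapping"
    "HOL-Library.Product_Lexorder"
    "HOL-Computational_Algebra.Primes"
    "HOL-Computational_Algebra.Fraction_Field"
    "Jordan_Normal_Form.Matrix"
begin

section \<open>Division algebras and noncrossed products\<close>

definition ring_center :: "('a, 'm) ring_scheme \<Rightarrow> 'a set" where
  "ring_center A = {z \<in> carrier A. \<forall>a \<in> carrier A. z \<otimes>\<^bsub>A\<^esub> a = a \<otimes>\<^bsub>A\<^esub> z}"

text \<open>The equation for the units also forces \<open>\<one> \<noteq> \<zero>\<close>.\<close>

definition skew_field :: "('a, 'm) ring_scheme \<Rightarrow> bool" where
  "skew_field D \<longleftrightarrow> ring D \<and> Units D = carrier D - {\<zero>\<^bsub>D\<^esub>}"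

text \<open>A division algebra is always regarded as an algebra over its center.\<close>

definition fin_dim_division_algebra :: "('a, 'm) ring_scheme \<Rightarrow> bool" where
  "fin_dim_division_algebra D \<longleftrightarrow>
     skew_field D \<and> ring.finite_dimension D (ring_center D) (carrier D)"

definition maximal_subfield :: "'a set \<Rightarrow> ('a, 'm) ring_scheme \<Rightarrow> bool" where
  "maximal_subfield K D \<longleftrightarrow>
     subfield K D \<and> (\<forall>L. subfield L D \<and> K \<subseteq> L \<longrightarrow> L = K)"

text \<open>The \<open>F\<close>-automorphisms of a subfield \<open>K\<close> of \<open>D\<close>; they are considered as functions on the whole
  type, and their values outside \<open>K\<close> are irrelevant.\<close>

definition field_auts :: "('a, 'm) ring_scheme \<Rightarrow> 'a set \<Rightarrow> 'a set \<Rightarrow> ('a \<Rightarrow> 'a) set" where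
  "field_auts D F K =
     {\<sigma> \<in> ring_iso (D\<lparr>carrier := K\<rparr>) (D\<lparr>carrier := K\<rparr>). \<forall>x \<in> F. \<sigma> x = x}"

text \<open>\<open>K/F\<close> is a (finite) Galois extension: the fixed field of its automorphism group is \<open>F\<close>.
  Subfields of a finite-dimensional division algebra are always of finite degree over its center.\<close>

definition galois_extension :: "('a, 'm) ring_scheme \<Rightarrow> 'a set \<Rightarrow> 'a set \<Rightarrow> bool" where
  "galois_extension D F K \<longleftrightarrow>
     subfield F D \<and> subfield K D \<and> F \<subseteq> K \<and> ring.finite_dimension D F K \<and>
     {x \<in> K. \<forall>\<sigma> \<in> field_auts D F K. \<sigma> x = x} = F"

definition noncrossed_product :: "('a, 'm) ring_scheme \<Rightarrow> bool" where
  "noncrossed_product D \<longleftrightarrow>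
     fin_dim_division_algebra D \<and>
     \<not> (\<exists>K. maximal_subfield K D \<and> galois_extension D (ring_center D) K)"


section \<open>The fraction field of an integral domain\<close>

definition frac_rel :: "('a, 'm) ring_scheme \<Rightarrow> (('a \<times> 'a) \<times> ('a \<times> 'a)) set" where
  "frac_rel R = {((a, s), (b, t)).
     a \<in> carrier R \<and> s \<in> carrier R - {\<zero>\<^bsub>R\<^esub>} \<and> b \<in> carrier R \<and> t \<in> carrier R - {\<zero>\<^bsub>R\<^esub>} \<and>
     a \<otimes>\<^bsub>R\<^esub> t = b \<otimes>\<^bsub>R\<^esub> s}"

definition frac_class :: "('a, 'm) ring_scheme \<Rightarrow> 'a \<Rightarrow> 'a \<Rightarrow> ('a \<times> 'a) set" where
  "frac_class R a s = frac_rel R `` {(a, s)}"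

definition fraction_field :: "('a, 'm) ring_scheme \<Rightarrow> ('a \<times> 'a) set ring" where
  "fraction_field R =
     \<lparr>carrier = (carrier R \<times> (carrier R - {\<zero>\<^bsub>R\<^esub>})) // frac_rel R,
      monoid.mult = (\<lambda>U V. \<Union>(a, s) \<in> U. \<Union>(b, t) \<in> V. frac_class R (a \<otimes>\<^bsub>R\<^esub> b) (s \<otimes>\<^bsub>R\<^esub> t)),
      monoid.one = frac_class R \<one>\<^bsub>R\<^esub> \<one>\<^bsub>R\<^esub>,
      ring.zero = frac_class R \<zero>\<^bsub>R\<^esub> \<one>\<^bsub>R\<^esub>,
      ring.add = (\<lambda>U V. \<Union>(a, s) \<in> U. \<Union>(b, t) \<in> V.
               frac_class R (a \<otimes>\<^bsub>R\<^esub> t \<oplus>\<^bsub>R\<^esub> b \<otimes>\<^bsub>R\<^esub> s) (s \<otimes>\<^bsub>R\<^esub> t))\<rparr>"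


section \<open>Tensor products of algebras\<close>

text \<open>The free abelian group on \<open>A \<times> B\<close>, made into a ring by extending
  \<open>(a, b) (a', b') = (a a', b b')\<close> biadditively.\<close>

definition free_pair_ring ::
  "('a, 'm) ring_scheme \<Rightarrow> ('b, 'n) ring_scheme \<Rightarrow> ('a \<times> 'b \<Rightarrow>\<^sub>0 int) ring" where
  "free_pair_ring A B =
     \<lparr>carrier = carrier (free_Abelian_group (carrier A \<times> carrier B)),
      monoid.mult = (\<lambda>f g. frag_extend (\<lambda>(a, b). frag_extend (\<lambda>(a', b').
                       frag_of (a \<otimes>\<^bsub>A\<^esub> a', b \<otimes>\<^bsub>B\<^esub> b')) g) f),
      monoid.one = frag_of (\<one>\<^bsub>A\<^esub>, \<one>\<^bsub>B\<^esub>),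
      ring.zero = 0,
      ring.add = (+)\<rparr>"

text \<open>The \<open>R\<close>-algebra structures on \<open>A\<close> and \<open>B\<close> are given by ring homomorphisms \<open>\<phi>\<close> and \<open>\<psi>\<close> from \<open>R\<close>
  into their centers.\<close>

definition tensor_relations ::
  "('r, 'k) ring_scheme \<Rightarrow> ('a, 'm) ring_scheme \<Rightarrow> ('r \<Rightarrow> 'a) \<Rightarrow>
   ('b, 'n) ring_scheme \<Rightarrow> ('r \<Rightarrow> 'b) \<Rightarrow> ('a \<times> 'b \<Rightarrow>\<^sub>0 int) set" where
  "tensor_relations R A \<phi> B \<psi> =
     {frag_of (a \<oplus>\<^bsub>A\<^esub> a', b) - frag_of (a, b) - frag_of (a', b) | a a' b.
        a \<in> carrier A \<and> a' \<in> carrier A \<and> b \<in> carrier B} \<union>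
     {frag_of (a, b \<oplus>\<^bsub>B\<^esub> b') - frag_of (a, b) - frag_of (a, b') | a b b'.
        a \<in> carrier A \<and> b \<in> carrier B \<and> b' \<in> carrier B} \<union>
     {frag_of (a \<otimes>\<^bsub>A\<^esub> \<phi> r, b) - frag_of (a, \<psi> r \<otimes>\<^bsub>B\<^esub> b) | a b r.
        a \<in> carrier A \<and> b \<in> carrier B \<and> r \<in> carrier R}"

text \<open>Since \<open>\<phi>\<close> and \<open>\<psi>\<close> have central images, the additive subgroup generated by the relations is
  an ideal, so that the quotient group \<open>A \<otimes>\<^sub>R B\<close> inherits the multiplication.\<close>

definition tensor_algebra ::
  "('r, 'k) ring_scheme \<Rightarrow> ('a, 'm) ring_scheme \<Rightarrow> ('r \<Rightarrow> 'a) \<Rightarrow>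
   ('b, 'n) ring_scheme \<Rightarrow> ('r \<Rightarrow> 'b) \<Rightarrow> ('a \<times> 'b \<Rightarrow>\<^sub>0 int) set ring" where
  "tensor_algebra R A \<phi> B \<psi> =
     free_pair_ring A B Quot
       generate (free_Abelian_group (carrier A \<times> carrier B)) (tensor_relations R A \<phi> B \<psi>)"


section \<open>Generic matrices and the universal division algebra\<close>

text \<open>Polynomials in commuting variables indexed by triples \<open>(i, j, r)\<close>: the keys of the outer finite
  map are the monomials, those of the inner one the variables. The lexicographic order on the index
  type serves only to obtain the \<open>idom\<close> instance. Matrix indices start at \<open>0\<close>, so the variables
  of the set \<open>X\<close> for degree \<open>d\<close> are those with \<open>i, j < d\<close> and \<open>r \<ge> 2\<close>. The remaining variables of
  this type merely enlarge the ambient field \<open>k(X)\<close>; they do not occur in the algebra generated by the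
  generic matrices of degree \<open>d\<close>.\<close>

type_synonym 'k generic_poly = "((nat \<times> nat \<times> nat) \<Rightarrow>\<^sub>0 nat) \<Rightarrow>\<^sub>0 'k"
type_synonym 'k generic_fun = "'k generic_poly fract"

definition gen_const :: "'k::field \<Rightarrow> 'k generic_fun" where
  "gen_const c = Fract (Poly_Mapping.single 0 c) 1"

definition gen_var :: "nat \<Rightarrow> nat \<Rightarrow> nat \<Rightarrow> 'k::field generic_fun" where
  "gen_var i j r = Fract (Poly_Mapping.single (Poly_Mapping.single (i, j, r) 1) 1) 1"

definition generic_matrix :: "nat \<Rightarrow> nat \<Rightarrow> 'k::field generic_fun mat" where
  "generic_matrix d r = mat d d (\<lambda>(i, j). gen_var i j r)"

abbreviation generic_mat_ring :: "'k::field itself \<Rightarrow> nat \<Rightarrow> 'k generic_fun mat ring" where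
  "generic_mat_ring k d \<equiv> ring_mat TYPE('k generic_fun) d ()"

text \<open>The unital \<open>k\<close>-subalgebra generated by the generic matrices is the subring generated by them
  together with the scalar matrices with entries in \<open>k\<close>.\<close>

definition generic_matrix_algebra :: "'k::field itself \<Rightarrow> nat \<Rightarrow> 'k generic_fun mat ring" where
  "generic_matrix_algebra k d = (generic_mat_ring k d)
     \<lparr>carrier := generate_ring (generic_mat_ring k d)
        (range (\<lambda>c. gen_const c \<cdot>\<^sub>m 1\<^sub>m d) \<union> generic_matrix d ` {2..})\<rparr>"

definition generic_center :: "'k::field itself \<Rightarrow> nat \<Rightarrow> 'k generic_fun mat ring" where
  "generic_center k d = (generic_matrix_algebra k d)
     \<lparr>carrier := ring_center (generic_matrix_algebra k d)\<rparr>"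

definition universal_division_algebra ::
  "'k::field itself \<Rightarrow> nat \<Rightarrow>
   ('k generic_fun mat \<times> ('k generic_fun mat \<times> 'k generic_fun mat) set \<Rightarrow>\<^sub>0 int) set ring" where
  "universal_division_algebra k d =
     (let R = generic_center k d
      in tensor_algebra R (generic_matrix_algebra k d) (\<lambda>r. r)
           (fraction_field R) (\<lambda>r. frac_class R r \<one>\<^bsub>R\<^esub>))"

end

theory Submission
  imports Defs "HOL-Algebra.Algebraic_Closure_Type" "Jordan_Normal_Form.Determinant"
begin

text \<open>Let \<open>d = p\<^sup>n\<close>. A Galois maximal subfield with group \<open>G\<close> gives, after central denominators are cleared, nonzero
  elements \<open>u\<^sub>g\<close> (\<open>g \<in> G\<close>) of the generic matrix algebra \<open>B\<close> which permute the conjugates of a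
  generating family of the subfield, and \<open>G\<close> has \<open>p\<close>-power order at least \<open>d\<close>. For all \<open>N\<close>, \<open>m\<close> with \<open>N\<^sup>m = d\<close>, the
  algebra \<open>B\<close> embeds into the coordinate ring of a quantum torus in \<open>2m\<close> variables at a primitive \<open>N\<close>-th root of
  unity. There leading terms are multiplicative, and monomials with exponents congruent modulo \<open>N\<close> induce the
  same conjugation. Hence if the leading exponents of two words in the \<open>u\<^sub>g\<close> are congruent modulo \<open>N\<close>, conjugation by
  their quotient fixes leading terms; having finite order invertible in the field, it is trivial, and the words are
  equal in \<open>G\<close>. For \<open>N = p\<close> this makes \<open>G\<close> elementary abelian. For \<open>N = p\<^sup>n\<close> the leading exponents lie in
  \<open>(\<int>/p\<^sup>n)\<^sup>2\<close>, so any three elements of \<open>G\<close> satisfy a relation with an exponent prime to \<open>p\<close>, and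
  \<open>p\<^sup>n \<le> |G| \<le> p\<^sup>2\<close>, a contradiction for \<open>n \<ge> 3\<close>.\<close>

section \<open>Square matrices with entries in a semiring\<close>

text \<open>The field \<open>k\<close> is arbitrary, so the roots of unity that a torus needs are
  taken in the algebraic closure of \<open>k(X)\<close>. To embed \<open>B\<close>, each generic
  matrix is lifted to a twisted polynomial whose value at \<open>t = 1\<close> is that generic
  matrix again; hence the lifted entries satisfy no relation that the variables do not satisfy, and
  the lift is injective. Leading terms then do the work of a valuation. Conjugation by a quotient is
  encoded by pairs of multiplicative identities, so that no inverses are needed in the torus and all
  comparisons stay within finite words of \<open>B\<close>. The bound on \<open>|G|\<close> from
  below comes from \<open>[K : F] |G| = d^2\<close> together with \<open>[K : F] \<le> |G|\<close>.
  The algebra \<open>UD(k, d)\<close> itself is modelled by those matrices over \<open>k(X)\<close>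
  which some nonzero scalar matrix in \<open>B\<close> carries into \<open>B\<close>. That this is a
  division ring of dimension \<open>d^2\<close> over its center is derived from two facts:
  \<open>B\<close> is a domain, again by leading terms, and \<open>d^2\<close> generic matrices form
  a basis of all matrices. The trace form then produces enough scalar matrices in \<open>B\<close>
  to serve as denominators.\<close>

typedef 'a fm = "UNIV :: (nat \<Rightarrow> nat \<Rightarrow> 'a) set" morphisms ent Mk ..

lemma ent_Mk [simp]: "ent (Mk f) = f"
  by (simp add: Mk_inverse)

lemma fm_eqI: "(\<And>i j. ent A i j = ent B i j) \<Longrightarrow> A = B"
  by (metis ent_inverse ext)

lemma fm_eq_iff: "A = B \<longleftrightarrow> (\<forall>i j. ent A i j = ent B i j)"
  by (metis fm_eqI)

instantiation fm :: (comm_monoid_add) comm_monoid_add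
begin
definition "0 = Mk (\<lambda>i j. 0)"
definition "A + B = Mk (\<lambda>i j. ent A i j + ent B i j)"
instance by standard (simp_all add: fm_eq_iff zero_fm_def plus_fm_def ac_simps)
end

instantiation fm :: (ab_group_add) ab_group_add
begin
definition "- A = Mk (\<lambda>i j. - ent A i j)"
definition "A - B = Mk (\<lambda>i j. ent A i j - ent B i j)"
instance by standard (simp_all add: fm_eq_iff zero_fm_def plus_fm_def uminus_fm_def minus_fm_def)
end

lemma ent_zero [simp]: "ent 0 i j = 0"
  by (simp add: zero_fm_def)

lemma ent_add [simp]: "ent (A + B) i j = ent A i j + ent B i j"
  by (simp add: plus_fm_def)

lemma ent_uminus [simp]: "ent (- A) i j = - ent A i j"
  by (simp add: uminus_fm_def)

lemma ent_diff [simp]: "ent (A - B) i j = ent A i j - ent B i j"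
  by (simp add: minus_fm_def)

lemma ent_sum [simp]: "ent (\<Sum>x\<in>S. f x) i j = (\<Sum>x\<in>S. ent (f x) i j)"
  by (induction S rule: infinite_finite_induct) auto

text \<open>The size \<open>d\<close> is a parameter and not part of the type: matrices of size
  \<open>d\<close> are those supported in the upper left corner. Addition and finite sums are then
  total operations of a type class, and \<open>mm d\<close> cuts off everything outside the
  corner.\<close>

definition fmats :: "nat \<Rightarrow> 'a::zero fm set" where
  "fmats d = {A. \<forall>i j. \<not> (i < d \<and> j < d) \<longrightarrow> ent A i j = 0}"

definition mm :: "nat \<Rightarrow> 'a::semiring_0 fm \<Rightarrow> 'a fm \<Rightarrow> 'a fm" where
  "mm d A B = Mk (\<lambda>i j. if i < d \<and> j < d then \<Sum>k<d. ent A i k * ent B k j else 0)"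

definition scal :: "nat \<Rightarrow> 'a::zero \<Rightarrow> 'a fm" where
  "scal d c = Mk (\<lambda>i j. if i < d \<and> i = j then c else 0)"

definition smul :: "'a::times \<Rightarrow> 'a fm \<Rightarrow> 'a fm" where
  "smul c A = Mk (\<lambda>i j. c * ent A i j)"

definition tr :: "nat \<Rightarrow> 'a::comm_monoid_add fm \<Rightarrow> 'a" where
  "tr d A = (\<Sum>i<d. ent A i i)"

lemma ent_mm: "ent (mm d A B) i j = (if i < d \<and> j < d then \<Sum>k<d. ent A i k * ent B k j else 0)"
  by (simp add: mm_def)

lemma ent_scal: "ent (scal d c) i j = (if i < d \<and> i = j then c else 0)"
  by (simp add: scal_def)

lemma ent_smul [simp]: "ent (smul c A) i j = c * ent A i j"
  by (simp add: smul_def)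

lemma fmatsD: "A \<in> fmats d \<Longrightarrow> \<not> (i < d \<and> j < d) \<Longrightarrow> ent A i j = 0"
  by (auto simp: fmats_def)

lemma fmats_eqI:
  assumes "A \<in> fmats d" "B \<in> fmats d" "\<And>i j. i < d \<Longrightarrow> j < d \<Longrightarrow> ent A i j = ent B i j"
  shows "A = B"
proof (rule fm_eqI)
  fix i j show "ent A i j = ent B i j"
    using assms fmatsD[of A d i j] fmatsD[of B d i j] by (cases "i < d \<and> j < d") auto
qed

lemma mm_fmats [simp]: "mm d A B \<in> fmats d"
  by (auto simp: ent_mm fmats_def)

lemma scal_fmats [simp]: "scal d c \<in> fmats d"
  by (auto simp: ent_scal fmats_def)

lemma zero_fmats [simp]: "0 \<in> fmats d"
  by (auto simp: fmats_def)

lemma add_fmats [simp]: "A \<in> fmats d \<Longrightarrow> B \<in> fmats d \<Longrightarrow> A + B \<in> fmats d"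
  by (auto simp: fmats_def)

lemma uminus_fmats [simp]: "A \<in> fmats d \<Longrightarrow> - A \<in> fmats d"
  by (auto simp: fmats_def)

lemma smul_fmats [simp]: "A \<in> fmats d \<Longrightarrow> smul c A \<in> fmats d" for c :: "'a::mult_zero"
  by (auto simp: fmats_def)

lemma sum_fmats [simp]: "(\<And>x. x \<in> S \<Longrightarrow> f x \<in> fmats d) \<Longrightarrow> (\<Sum>x\<in>S. f x) \<in> fmats d"
  by (auto simp: fmats_def)

lemma mm_assoc: "mm d (mm d A B) C = mm d A (mm d B C)"
proof (rule fmats_eqI[of _ d])
  fix i j assume "i < d" "j < d"
  then have "ent (mm d (mm d A B) C) i j = (\<Sum>k<d. \<Sum>l<d. ent A i l * ent B l k * ent C k j)"
    by (simp add: ent_mm sum_distrib_right)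
  also have "\<dots> = (\<Sum>l<d. \<Sum>k<d. ent A i l * ent B l k * ent C k j)"
    by (rule sum.swap)
  also have "\<dots> = ent (mm d A (mm d B C)) i j"
    using \<open>i < d\<close> \<open>j < d\<close> by (simp add: ent_mm sum_distrib_left mult.assoc)
  finally show "ent (mm d (mm d A B) C) i j = ent (mm d A (mm d B C)) i j" .
qed auto

lemma mm_add_left: "mm d (A + B) C = mm d A C + mm d B C"
  by (rule fm_eqI) (simp add: ent_mm distrib_right sum.distrib)

lemma mm_add_right: "mm d A (B + C) = mm d A B + mm d A C"
  by (rule fm_eqI) (simp add: ent_mm distrib_left sum.distrib)

lemma mm_zero_left [simp]: "mm d 0 C = 0"
  by (rule fm_eqI) (simp add: ent_mm)

lemma mm_zero_right [simp]: "mm d C 0 = 0"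
  by (rule fm_eqI) (simp add: ent_mm)

lemma mm_uminus_left: "mm d (- A) C = - mm d A C" for A :: "'a::ring fm"
  by (rule fm_eqI) (simp add: ent_mm sum_negf)

lemma mm_diff_left: "mm d (A - B) C = mm d A C - mm d B C" for A :: "'a::ring fm"
  by (rule fm_eqI) (simp add: ent_mm left_diff_distrib sum_subtractf)

lemma mm_diff_right: "mm d A (B - C) = mm d A B - mm d A C" for A :: "'a::ring fm"
  by (rule fm_eqI) (simp add: ent_mm right_diff_distrib sum_subtractf)

lemma mm_sum_left: "mm d (\<Sum>x\<in>S. f x) C = (\<Sum>x\<in>S. mm d (f x) C)"
  by (induction S rule: infinite_finite_induct) (simp_all add: mm_add_left)

lemma mm_sum_right: "mm d C (\<Sum>x\<in>S. f x) = (\<Sum>x\<in>S. mm d C (f x))"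
  by (induction S rule: infinite_finite_induct) (simp_all add: mm_add_right)

lemma mm_scal_left [simp]: "A \<in> fmats d \<Longrightarrow> mm d (scal d c) A = smul c A"
  by (rule fmats_eqI[of _ d])
     (simp_all add: ent_mm ent_scal if_distrib[of "\<lambda>x. x * _"] sum.delta' cong: if_cong)

lemma mm_scal_right [simp]: "A \<in> fmats d \<Longrightarrow> mm d A (scal d c) = smul c A" for c :: "'a::comm_semiring_0"
  by (rule fmats_eqI[of _ d])
     (simp_all add: ent_mm ent_scal mult.commute if_distrib[of "\<lambda>x. _ * x"] cong: if_cong)

lemma smul_one [simp]: "smul (1::'a::monoid_mult) A = A"
  by (rule fm_eqI) simp

lemma smul_zero_right [simp]: "smul (c::'a::semiring_0) 0 = 0"
  by (rule fm_eqI) simp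

lemma smul_zero_left [simp]: "smul (0::'a::semiring_0) A = 0"
  by (rule fm_eqI) simp

lemma smul_smul [simp]: "smul a (smul b A) = smul (a * b) A" for a :: "'a::semigroup_mult"
  by (rule fm_eqI) (simp add: mult.assoc)

lemma smul_add: "smul c (A + B) = smul c A + smul c B" for c :: "'a::semiring_0"
  by (rule fm_eqI) (simp add: distrib_left)

lemma smul_add_left: "smul (a + b) A = smul a A + smul b A" for a :: "'a::semiring_0"
  by (rule fm_eqI) (simp add: distrib_right)

lemma smul_sum: "smul c (\<Sum>x\<in>S. f x) = (\<Sum>x\<in>S. smul c (f x))" for c :: "'a::semiring_0"
  by (rule fm_eqI) (simp add: sum_distrib_left)

lemma mm_smul_left: "mm d (smul c A) B = smul c (mm d A B)"
  by (rule fm_eqI) (simp add: ent_mm sum_distrib_left mult.assoc)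

lemma mm_smul_right: "mm d A (smul c B) = smul c (mm d A B)" for c :: "'a::comm_semiring_0"
  by (rule fm_eqI) (simp add: ent_mm sum_distrib_left mult.left_commute)

lemma smul_eq_0_iff: "smul c A = 0 \<longleftrightarrow> c = 0 \<or> A = 0" for c :: "'a::semiring_no_zero_divisors"
  by (auto simp: fm_eq_iff)

lemma smul_scal [simp]: "smul c (scal d a) = scal d (c * a)" for c :: "'a::mult_zero"
  by (auto simp: fm_eq_iff ent_scal)

lemma scal_0 [simp]: "scal d 0 = 0"
  by (rule fm_eqI) (simp add: ent_scal)

lemma scal_add: "scal d (a + b) = scal d a + scal d b" for a :: "'a::comm_monoid_add"
  by (rule fm_eqI) (simp add: ent_scal)

lemma scal_uminus: "scal d (- a) = - scal d a" for a :: "'a::ab_group_add"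
  by (rule fm_eqI) (simp add: ent_scal)

lemma scal_inject: "d > 0 \<Longrightarrow> scal d a = scal d b \<longleftrightarrow> a = b"
  by (auto simp: ent_scal fm_eq_iff)

lemma mm_one [simp]:
  "A \<in> fmats d \<Longrightarrow> mm d (scal d 1) A = A" "A \<in> fmats d \<Longrightarrow> mm d A (scal d 1) = A"
  for A :: "'a::comm_semiring_1 fm"
  by simp_all

section \<open>Additive extension and evaluation of polynomials\<close>

text \<open>\<open>F m\<close> is the additive action on the coefficient of the key
  \<open>m\<close>. Evaluation of polynomials, the representation \<open>rep\<close>, the twisted
  product and the evaluation of formal tensors are all of this form.\<close>

definition pm_ext :: "('x \<Rightarrow> 'c \<Rightarrow> 'b) \<Rightarrow> ('x \<Rightarrow>\<^sub>0 'c::zero) \<Rightarrow> 'b::comm_monoid_add" where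
  "pm_ext F p = (\<Sum>m\<in>Poly_Mapping.keys p. F m (Poly_Mapping.lookup p m))"

lemma pm_ext_zero [simp]: "pm_ext F 0 = 0"
  by (simp add: pm_ext_def)

lemma pm_ext_single [simp]: "(\<And>m. F m 0 = 0) \<Longrightarrow> pm_ext F (Poly_Mapping.single m c) = F m c"
  by (cases "c = 0") (auto simp: pm_ext_def)

lemma pm_ext_superset:
  assumes "\<And>m. F m 0 = 0" "finite S" "Poly_Mapping.keys p \<subseteq> S"
  shows "pm_ext F p = (\<Sum>m\<in>S. F m (Poly_Mapping.lookup p m))"
  unfolding pm_ext_def using assms
  by (intro sum.mono_neutral_left) (auto simp: in_keys_iff)

lemma pm_ext_add:
  assumes "\<And>m. F m 0 = 0" "\<And>m a b. F m (a + b) = F m a + F m b"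
  shows "pm_ext F (p + q) = pm_ext F p + pm_ext F q"
proof -
  define S where "S = Poly_Mapping.keys p \<union> Poly_Mapping.keys q \<union> Poly_Mapping.keys (p + q)"
  have S: "finite S" by (simp add: S_def)
  have "pm_ext F r = (\<Sum>m\<in>S. F m (Poly_Mapping.lookup r m))" if "Poly_Mapping.keys r \<subseteq> S" for r
    using that assms(1) S by (intro pm_ext_superset) auto
  from this[of "p + q"] this[of p] this[of q]
  have "pm_ext F r = (\<Sum>m\<in>S. F m (Poly_Mapping.lookup r m))" if "r \<in> {p + q, p, q}" for r
    using that by (auto simp: S_def)
  then show ?thesis
    by (simp add: lookup_add assms(2) sum.distrib)
qed

text \<open>Additive statements reduce to single terms. Only closure under addition is asked for;
  the zero map enters as a single term with coefficient 0.\<close>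

lemma pm_induct [case_names single add]:
  assumes "\<And>m c. P (Poly_Mapping.single m c)" "\<And>p q. P p \<Longrightarrow> P q \<Longrightarrow> P (p + q)"
  shows "P (p :: 'x \<Rightarrow>\<^sub>0 'c::comm_monoid_add)"
proof -
  have expand: "p = pm_ext Poly_Mapping.single p"
  proof (rule poly_mapping_eqI)
    fix k
    have "Poly_Mapping.lookup (pm_ext Poly_Mapping.single p) k
        = (\<Sum>m\<in>Poly_Mapping.keys p. Poly_Mapping.lookup p m when m = k)"
      by (simp add: pm_ext_def lookup_sum lookup_single)
    also have "\<dots> = Poly_Mapping.lookup p k"
      by (cases "k \<in> Poly_Mapping.keys p") (auto simp: when_def in_keys_iff)
    finally show "Poly_Mapping.lookup p k = Poly_Mapping.lookup (pm_ext Poly_Mapping.single p) k" ..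
  qed
  have zero: "P 0"
    using assms(1)[of undefined 0] by simp
  have "P (\<Sum>m\<in>S. Poly_Mapping.single m (f m))" for S and f :: "'x \<Rightarrow> 'c"
    by (induction S rule: infinite_finite_induct) (auto intro: assms zero)
  then show ?thesis
    by (subst expand) (simp add: pm_ext_def)
qed

definition mon_ev :: "('x \<Rightarrow> 'b::comm_semiring_1) \<Rightarrow> ('x \<Rightarrow>\<^sub>0 nat) \<Rightarrow> 'b" where
  "mon_ev f m = (\<Prod>x\<in>Poly_Mapping.keys m. f x ^ Poly_Mapping.lookup m x)"

definition poly_ev :: "('c \<Rightarrow> 'b) \<Rightarrow> ('x \<Rightarrow> 'b) \<Rightarrow> (('x \<Rightarrow>\<^sub>0 nat) \<Rightarrow>\<^sub>0 'c::zero) \<Rightarrow> 'b::comm_semiring_1" where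
  "poly_ev \<phi> f = pm_ext (\<lambda>m c. \<phi> c * mon_ev f m)"

lemma mon_ev_superset:
  assumes "finite S" "Poly_Mapping.keys m \<subseteq> S"
  shows "mon_ev f m = (\<Prod>x\<in>S. f x ^ Poly_Mapping.lookup m x)"
  unfolding mon_ev_def using assms
  by (intro prod.mono_neutral_left) (auto simp: in_keys_iff)

lemma mon_ev_add: "mon_ev f (m + n) = mon_ev f m * mon_ev f n"
proof -
  define S where "S = Poly_Mapping.keys m \<union> Poly_Mapping.keys n \<union> Poly_Mapping.keys (m + n)"
  have "mon_ev f r = (\<Prod>x\<in>S. f x ^ Poly_Mapping.lookup r x)" if "Poly_Mapping.keys r \<subseteq> S" for r
    using that by (intro mon_ev_superset) (auto simp: S_def)
  from this[of "m + n"] this[of m] this[of n]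
  have "mon_ev f r = (\<Prod>x\<in>S. f x ^ Poly_Mapping.lookup r x)" if "r \<in> {m + n, m, n}" for r
    using that by (auto simp: S_def)
  then show ?thesis
    by (simp add: lookup_add power_add prod.distrib)
qed

lemma mon_ev_zero [simp]: "mon_ev f 0 = 1"
  by (simp add: mon_ev_def)

lemma mon_ev_single [simp]: "mon_ev f (Poly_Mapping.single x n) = f x ^ n"
  by (cases "n = 0") (auto simp: mon_ev_def)

locale semiring_hom_fun =
  fixes \<phi> :: "'c::comm_semiring_1 \<Rightarrow> 'b::comm_semiring_1"
  assumes hom_0 [simp]: "\<phi> 0 = 0" and hom_1 [simp]: "\<phi> 1 = 1"
    and hom_add: "\<phi> (a + b) = \<phi> a + \<phi> b" and hom_mult: "\<phi> (a * b) = \<phi> a * \<phi> b"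
begin

lemma hom_sum: "\<phi> (sum g S) = (\<Sum>x\<in>S. \<phi> (g x))"
  by (induction S rule: infinite_finite_induct) (auto simp: hom_add)

lemma hom_prod: "\<phi> (prod g S) = (\<Prod>x\<in>S. \<phi> (g x))"
  by (induction S rule: infinite_finite_induct) (auto simp: hom_mult)

lemma hom_power: "\<phi> (a ^ n) = \<phi> a ^ n"
  by (induction n) (auto simp: hom_mult)

lemma poly_ev_single: "poly_ev \<phi> f (Poly_Mapping.single m c) = \<phi> c * mon_ev f m"
  by (simp add: poly_ev_def)

lemma poly_ev_add: "poly_ev \<phi> f (p + q) = poly_ev \<phi> f p + poly_ev \<phi> f q"
  unfolding poly_ev_def by (rule pm_ext_add) (auto simp: hom_add distrib_right)

lemma poly_ev_mult: "poly_ev \<phi> f (p * q) = poly_ev \<phi> f p * poly_ev \<phi> f q"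
proof (induction p rule: pm_induct)
  case (single m c)
  show ?case
    by (induction q rule: pm_induct)
       (simp_all add: mult_single poly_ev_single mon_ev_add hom_mult mult_ac distrib_left distrib_right poly_ev_add)
next
  case (add p p')
  then show ?case by (simp add: distrib_right poly_ev_add)
qed

lemma semiring_hom_poly_ev: "semiring_hom_fun (poly_ev \<phi> f)"
proof
  show "poly_ev \<phi> f 0 = 0" by (simp add: poly_ev_def)
  show "poly_ev \<phi> f 1 = 1" using poly_ev_single[of f 0 1] by simp
qed (simp_all add: poly_ev_add poly_ev_mult)

end

text \<open>Composition with a homomorphism only changes the values of coefficients and variables;
  this will compute lifted polynomials at \<open>t = 1\<close>.\<close>

lemma poly_ev_hom:
  assumes "semiring_hom_fun \<phi>" "semiring_hom_fun \<psi>"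
  shows "\<psi> (poly_ev \<phi> f p) = poly_ev (\<lambda>c. \<psi> (\<phi> c)) (\<lambda>x. \<psi> (f x)) p"
proof -
  interpret \<psi>: semiring_hom_fun \<psi> by fact
  show ?thesis
    by (simp add: poly_ev_def pm_ext_def mon_ev_def \<psi>.hom_sum \<psi>.hom_mult \<psi>.hom_prod \<psi>.hom_power)
qed

lemma semiring_hom_fun_comp:
  "semiring_hom_fun \<phi> \<Longrightarrow> semiring_hom_fun \<psi> \<Longrightarrow> semiring_hom_fun (\<lambda>c. \<psi> (\<phi> c))"
  by (simp add: semiring_hom_fun_def)

section \<open>Twisted polynomials\<close>

text \<open>The sum of the coefficients is the value at the point where all variables are 1, hence
  multiplicative.\<close>

lemma pm_ext_ident_hom: "semiring_hom_fun (pm_ext (\<lambda>_ c. c) :: (('x::linorder \<Rightarrow>\<^sub>0 nat) \<Rightarrow>\<^sub>0 'e::comm_ring_1) \<Rightarrow> 'e)"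
proof -
  have id: "semiring_hom_fun (\<lambda>c::'e. c)" by standard simp_all
  have "pm_ext (\<lambda>_ c. c) = poly_ev (\<lambda>c::'e. c) (\<lambda>_::'x. 1)"
    by (auto simp: poly_ev_def mon_ev_def)
  then show ?thesis
    using semiring_hom_fun.semiring_hom_poly_ev[OF id, of "\<lambda>_::'x. 1"] by simp
qed

text \<open>For exponents the order of the type is linear and compatible with addition, which makes
  leading terms multiplicative. The value at 0 carries no meaning.\<close>

definition lead :: "('x::linorder \<Rightarrow>\<^sub>0 'e::zero) \<Rightarrow> 'x" where
  "lead f = Max (Poly_Mapping.keys f)"

lemma lead_in_keys: "f \<noteq> 0 \<Longrightarrow> lead f \<in> Poly_Mapping.keys f"
  unfolding lead_def by (intro Max_in) auto

lemma lookup_lead: "f \<noteq> 0 \<Longrightarrow> Poly_Mapping.lookup f (lead f) \<noteq> 0"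
  using lead_in_keys by (auto simp: in_keys_iff)

lemma le_lead: "a \<in> Poly_Mapping.keys f \<Longrightarrow> a \<le> lead f"
  unfolding lead_def by (intro Max_ge) auto

lemma lead_eqI:
  assumes "Poly_Mapping.lookup f a \<noteq> 0" "\<And>b. b > a \<Longrightarrow> Poly_Mapping.lookup f b = 0"
  shows "lead f = a"
  unfolding lead_def using assms by (intro Max_eqI) (auto simp: in_keys_iff not_less[symmetric])

type_synonym expo = "nat \<Rightarrow>\<^sub>0 nat"

text \<open>A family of monomial matrices \<open>M\<^sub>g\<close>, whose row \<open>i\<close> has its only nonzero entry \<open>chi g i\<close> in column
  \<open>act g i\<close>, with \<open>M\<^sub>g M\<^sub>h = q g h M\<^sub>g\<^sub>+\<^sub>h\<close>. The matrices \<open>rep f\<close> are the sums of \<open>c t\<^sup>g M\<^sub>g\<close>; they form a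
  twisted polynomial ring, in which leading terms are multiplicative.\<close>

locale monomial_rep =
  fixes d :: nat and act :: "expo \<Rightarrow> nat \<Rightarrow> nat" and chi :: "expo \<Rightarrow> nat \<Rightarrow> 'e::field"
    and q :: "expo \<Rightarrow> expo \<Rightarrow> 'e"
  assumes d_pos: "d > 0"
    and act_less: "i < d \<Longrightarrow> act g i < d"
    and act_add: "i < d \<Longrightarrow> act (g + h) i = act h (act g i)"
    and act_zero: "i < d \<Longrightarrow> act 0 i = i"
    and chi_nz: "chi g i \<noteq> 0" and chi_zero: "chi 0 i = 1"
    and q_nz: "q g h \<noteq> 0"
    and cocycle: "i < d \<Longrightarrow> chi g i * chi h (act g i) = q g h * chi (g + h) i"
begin

definition mono :: "expo \<Rightarrow> 'e \<Rightarrow> (expo \<Rightarrow>\<^sub>0 'e) fm" where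
  "mono g c = Mk (\<lambda>i j. if i < d \<and> j = act g i then Poly_Mapping.single g (c * chi g i) else 0)"

definition rep :: "(expo \<Rightarrow>\<^sub>0 'e) \<Rightarrow> (expo \<Rightarrow>\<^sub>0 'e) fm" where
  "rep = pm_ext mono"

definition tw :: "(expo \<Rightarrow>\<^sub>0 'e) \<Rightarrow> (expo \<Rightarrow>\<^sub>0 'e) \<Rightarrow> (expo \<Rightarrow>\<^sub>0 'e)" where
  "tw f = pm_ext (\<lambda>b y. pm_ext (\<lambda>a x. Poly_Mapping.single (a + b) (x * y * q a b)) f)"

lemma mono_fmats [simp]: "mono g c \<in> fmats d"
  by (auto simp: mono_def fmats_def act_less)

lemma mono_zero [simp]: "mono g 0 = 0"
  by (rule fm_eqI) (simp add: mono_def)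

lemma mono_add: "mono g (a + b) = mono g a + mono g b"
  by (rule fm_eqI) (simp add: mono_def distrib_right single_add)

text \<open>Row \<open>i\<close> of the first factor meets only row \<open>act g i\<close> of the
  second, whose entry stands in column \<open>act (g + h) i\<close>; \<open>cocycle\<close> compares
  the coefficients.\<close>

lemma mono_mult: "mm d (mono g c) (mono h e) = mono (g + h) (c * e * q g h)"
proof (rule fmats_eqI[of _ d])
  fix i j assume ij: "i < d" "j < d"
  have "ent (mm d (mono g c) (mono h e)) i j =
      (\<Sum>k<d. if k = act g i then Poly_Mapping.single g (c * chi g i) * ent (mono h e) k j else 0)"
    using ij by (simp add: ent_mm mono_def if_distrib[of "\<lambda>x. x * _"] cong: if_cong)
  also have "\<dots> = Poly_Mapping.single g (c * chi g i) * ent (mono h e) (act g i) j"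
    using ij act_less by simp
  also have "\<dots> = ent (mono (g + h) (c * e * q g h)) i j"
    using ij act_less[of i g] cocycle[of i g h]
    by (simp add: mono_def act_add mult_single mult_ac)
  finally show "ent (mm d (mono g c) (mono h e)) i j = ent (mono (g + h) (c * e * q g h)) i j" .
qed auto

lemma rep_single [simp]: "rep (Poly_Mapping.single g c) = mono g c"
  by (simp add: rep_def)

lemma rep_zero [simp]: "rep 0 = 0"
  by (simp add: rep_def)

lemma rep_add: "rep (f + g) = rep f + rep g"
  unfolding rep_def by (rule pm_ext_add) (auto simp: mono_add)

lemma rep_uminus: "rep (- f) = - rep f"
  using rep_add[of "- f" f] by (simp add: eq_neg_iff_add_eq_0)

lemma rep_diff: "rep (f - g) = rep f - rep g"
  using rep_add[of f "- g"] by (simp add: rep_uminus)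

lemma rep_sum: "rep (\<Sum>x\<in>S. f x) = (\<Sum>x\<in>S. rep (f x))"
  by (induction S rule: infinite_finite_induct) (simp_all add: rep_add)

lemma rep_fmats [simp]: "rep f \<in> fmats d"
  unfolding rep_def pm_ext_def by simp

lemma tw_single: "tw (Poly_Mapping.single a x) (Poly_Mapping.single b y) = Poly_Mapping.single (a + b) (x * y * q a b)"
  by (simp add: tw_def)

lemma tw_add_left: "tw (f + f') g = tw f g + tw f' g"
proof -
  have "pm_ext (\<lambda>a x. Poly_Mapping.single (a + b) (x * y * q a b)) (f + f') =
    pm_ext (\<lambda>a x. Poly_Mapping.single (a + b) (x * y * q a b)) f +
    pm_ext (\<lambda>a x. Poly_Mapping.single (a + b) (x * y * q a b)) f'" for b y
    by (rule pm_ext_add) (auto simp: distrib_right single_add)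
  then show ?thesis
    by (simp add: tw_def pm_ext_def sum.distrib)
qed

lemma tw_add_right: "tw f (g + g') = tw f g + tw f g'"
  unfolding tw_def
proof (rule pm_ext_add)
  fix b :: expo and y y' :: 'e
  show "pm_ext (\<lambda>a x. Poly_Mapping.single (a + b) (x * (y + y') * q a b)) f =
    pm_ext (\<lambda>a x. Poly_Mapping.single (a + b) (x * y * q a b)) f +
    pm_ext (\<lambda>a x. Poly_Mapping.single (a + b) (x * y' * q a b)) f"
    by (simp add: pm_ext_def sum.distrib[symmetric] distrib_left distrib_right single_add)
qed (simp add: pm_ext_def)

text \<open>Both sides are biadditive, so \<open>mono_mult\<close> suffices. Together with
  \<open>rep_inject\<close> this lets identities for \<open>tw\<close> be read off from
  matrices.\<close>

lemma rep_tw: "rep (tw f g) = mm d (rep f) (rep g)"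
proof (induction f rule: pm_induct)
  case (single a x)
  show ?case
    by (induction g rule: pm_induct)
       (simp_all add: tw_single mono_mult tw_add_right rep_add mm_add_right)
qed (simp add: tw_add_left rep_add mm_add_left)

lemma lookup_rep: "Poly_Mapping.lookup (ent (rep f) i j) g =
    (if i < d \<and> j = act g i then Poly_Mapping.lookup f g * chi g i else 0)"
proof (induction f rule: pm_induct)
  case (single m c)
  show ?case by (auto simp: mono_def lookup_single when_def)
qed (simp add: rep_add lookup_add distrib_right)

text \<open>Matrices for different \<open>g\<close> may have the same support, but the power
  \<open>t^g\<close> in the entries keeps them apart. Since \<open>chi\<close> has no zeros, row 0
  determines all coefficients.\<close>

lemma rep_inject: "rep f = rep g \<longleftrightarrow> f = g"
proof
  assume eq: "rep f = rep g"
  show "f = g"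
  proof (rule poly_mapping_eqI)
    fix a
    have "Poly_Mapping.lookup (ent (rep f) 0 (act a 0)) a = Poly_Mapping.lookup (ent (rep g) 0 (act a 0)) a"
      by (simp add: eq)
    then show "Poly_Mapping.lookup f a = Poly_Mapping.lookup g a"
      using d_pos chi_nz by (simp add: lookup_rep)
  qed
qed simp

lemma rep_eq_0_iff: "rep f = 0 \<longleftrightarrow> f = 0"
  using rep_inject[of f 0] by simp

lemma lookup_tw: "Poly_Mapping.lookup (tw f g) c =
    (\<Sum>b\<in>Poly_Mapping.keys g. \<Sum>a\<in>Poly_Mapping.keys f.
       if a + b = c then Poly_Mapping.lookup f a * Poly_Mapping.lookup g b * q a b else 0)"
  by (simp add: tw_def pm_ext_def lookup_sum lookup_single when_def)

text \<open>By strict monotonicity of addition, the leading exponents are the only pair with their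
  sum, so a single product survives there; it is nonzero because \<open>q\<close> has no
  zeros.\<close>

lemma tw_lead:
  assumes "f \<noteq> 0" "g \<noteq> 0"
  shows "Poly_Mapping.lookup (tw f g) (lead f + lead g) =
      Poly_Mapping.lookup f (lead f) * Poly_Mapping.lookup g (lead g) * q (lead f) (lead g)"
    and "tw f g \<noteq> 0" and "lead (tw f g) = lead f + lead g"
proof -
  have eq: "a = lead f \<and> b = lead g"
    if "a \<in> Poly_Mapping.keys f" "b \<in> Poly_Mapping.keys g" "a + b = lead f + lead g" for a b
  proof -
    have "a \<le> lead f" "b \<le> lead g" using that le_lead by auto
    then show ?thesis
      using that(3) by (metis add_less_le_mono add_left_cancel order_less_irrefl order_le_imp_less_or_eq)
  qed
  have "Poly_Mapping.lookup (tw f g) (lead f + lead g) =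
    (\<Sum>b\<in>Poly_Mapping.keys g. \<Sum>a\<in>Poly_Mapping.keys f.
       if b = lead g then (if a = lead f then Poly_Mapping.lookup f (lead f) * Poly_Mapping.lookup g (lead g) * q (lead f) (lead g) else 0) else 0)"
    unfolding lookup_tw using eq by (intro sum.cong refl) auto
  also have "\<dots> = (\<Sum>b\<in>Poly_Mapping.keys g. if b = lead g then Poly_Mapping.lookup f (lead f) * Poly_Mapping.lookup g (lead g) * q (lead f) (lead g) else 0)"
    using lead_in_keys[OF assms(1)] by (intro sum.cong refl) simp
  also have "\<dots> = Poly_Mapping.lookup f (lead f) * Poly_Mapping.lookup g (lead g) * q (lead f) (lead g)"
    using lead_in_keys[OF assms(2)] by simp
  finally show l: "Poly_Mapping.lookup (tw f g) (lead f + lead g) =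
      Poly_Mapping.lookup f (lead f) * Poly_Mapping.lookup g (lead g) * q (lead f) (lead g)" .
  have nz: "Poly_Mapping.lookup (tw f g) (lead f + lead g) \<noteq> 0"
    unfolding l using lookup_lead[OF assms(1)] lookup_lead[OF assms(2)] q_nz by simp
  then show "tw f g \<noteq> 0" by auto
  show "lead (tw f g) = lead f + lead g"
  proof (rule lead_eqI[OF nz])
    fix c assume c: "lead f + lead g < c"
    have "a + b \<noteq> c" if "a \<in> Poly_Mapping.keys f" "b \<in> Poly_Mapping.keys g" for a b
      using c le_lead[OF that(1)] le_lead[OF that(2)] by (metis add_mono not_less)
    then show "Poly_Mapping.lookup (tw f g) c = 0"
      unfolding lookup_tw by (intro sum.neutral ballI) simp
  qed
qed

lemma tw_eq_0_iff: "tw f g = 0 \<longleftrightarrow> f = 0 \<or> g = 0"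
proof -
  have "tw 0 g = 0" "tw f 0 = 0"
    using rep_tw[of 0 g] rep_tw[of f 0] by (simp_all add: rep_eq_0_iff)
  then show ?thesis using tw_lead(2) by blast
qed

text \<open>\<open>q a x / q x a\<close> is the factor by which the monomials with exponents
  \<open>a\<close> and \<open>x\<close> fail to commute. Similar exponents have the same factors;
  denominators are cleared.\<close>

definition similar :: "expo \<Rightarrow> expo \<Rightarrow> bool" where
  "similar a b \<longleftrightarrow> (\<forall>x. q a x * q x b = q b x * q x a)"

text \<open>Here \<open>y\<close> is the conjugate of \<open>x\<close> by \<open>w'\<close> and
  \<open>x'\<close> that of \<open>y\<close> by \<open>w\<close> in the opposite direction, so
  \<open>x'\<close> is the conjugate of \<open>x\<close> by the quotient of \<open>w\<close> and
  \<open>w'\<close>. In the leading terms the exponents cancel, and the two commutation factors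
  cancel by similarity.\<close>

lemma conjugation_preserves_lead:
  assumes nz: "w \<noteq> 0" "w' \<noteq> 0" "x \<noteq> 0" and sim: "similar (lead w) (lead w')"
    and eq: "tw x w' = tw w' y" "tw w y = tw x' w"
  shows "x' \<noteq> 0 \<and> lead x' = lead x \<and> Poly_Mapping.lookup x' (lead x') = Poly_Mapping.lookup x (lead x)"
proof -
  have y: "y \<noteq> 0" using eq(1) nz tw_eq_0_iff by metis
  have x': "x' \<noteq> 0" using eq(2) nz y tw_eq_0_iff by metis
  have ly: "lead y = lead x"
    using tw_lead(3)[OF nz(3,2)] tw_lead(3)[OF nz(2) y] eq(1) by (simp add: add.commute)
  have lx': "lead x' = lead x"
    using tw_lead(3)[OF nz(1) y] tw_lead(3)[OF x' nz(1)] eq(2) ly by (simp add: add.commute)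
  define \<xi> where "\<xi> = lead x"
  let ?lc = "\<lambda>f. Poly_Mapping.lookup f (lead f)"
  have 1: "?lc x * q \<xi> (lead w') = q (lead w') \<xi> * ?lc y"
    using tw_lead(1)[OF nz(3,2)] tw_lead(1)[OF nz(2) y] eq(1) lookup_lead[OF nz(2)]
    by (simp add: ly \<xi>_def add.commute mult_ac)
  have 2: "?lc y * q (lead w) \<xi> = q \<xi> (lead w) * ?lc x'"
    using tw_lead(1)[OF nz(1) y] tw_lead(1)[OF x' nz(1)] eq(2) lookup_lead[OF nz(1)]
    by (simp add: ly lx' \<xi>_def add.commute mult_ac)
  have s: "q (lead w) \<xi> * q \<xi> (lead w') = q (lead w') \<xi> * q \<xi> (lead w)"
    using sim by (simp add: similar_def)
  have "?lc x * (q (lead w) \<xi> * q \<xi> (lead w')) = ?lc x' * (q (lead w') \<xi> * q \<xi> (lead w))"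
    using 1 2 by (metis (no_types, opaque_lifting) mult.assoc mult.commute)
  then have "?lc x' = ?lc x"
    unfolding s using q_nz by simp
  then show ?thesis using x' lx' by simp
qed

text \<open>If conjugation by \<open>w w'\<inverse>\<close> preserves leading terms, then the differences \<open>z (i + 1) - z i\<close> of its iterates all
  have the same leading term, so their sum over a period cannot vanish unless they are zero.\<close>

lemma periodic_conjugation_trivial:
  assumes nz: "w \<noteq> 0" "w' \<noteq> 0" and sim: "similar (lead w) (lead w')"
    and eq: "\<And>i. tw (z i) w' = tw w' (z' i)" "\<And>i. tw w (z' i) = tw (z (Suc i)) w"
    and per: "z n = z 0" and n_nz: "of_nat n \<noteq> (0 :: 'e)"
  shows "z 1 = z 0"
proof (rule ccontr)
  assume neq: "z 1 \<noteq> z 0"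
  define D where "D i = z (Suc i) - z i" for i
  define E where "E i = z' (Suc i) - z' i" for i
  have tw_diff: "tw (f - f') g = tw f g - tw f' g" "tw g (f - f') = tw g f - tw g f'" for f f' g
    using rep_tw by (simp_all add: rep_inject[symmetric] rep_diff mm_diff_left mm_diff_right)
  have DE: "tw (D i) w' = tw w' (E i)" "tw w (E i) = tw (D (Suc i)) w" for i
    by (simp_all add: D_def E_def tw_diff eq)
  have D: "D i \<noteq> 0 \<and> lead (D i) = lead (D 0) \<and>
      Poly_Mapping.lookup (D i) (lead (D 0)) = Poly_Mapping.lookup (D 0) (lead (D 0))" for i
  proof (induction i)
    case 0
    then show ?case using neq by (simp add: D_def)
  next
    case (Suc i)
    then show ?case
      using conjugation_preserves_lead[OF nz _ sim DE, of i] by metis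
  qed
  have "(\<Sum>i<n. D i) = z n - z 0"
    by (induction n) (auto simp: D_def)
  then have "(\<Sum>i<n. Poly_Mapping.lookup (D i) (lead (D 0))) = 0"
    using per by (metis diff_self lookup_sum lookup_zero)
  moreover have "Poly_Mapping.lookup (D i) (lead (D 0)) = Poly_Mapping.lookup (D 0) (lead (D 0))" for i
    using D by blast
  ultimately have "of_nat n * Poly_Mapping.lookup (D 0) (lead (D 0)) = 0"
    by (metis (no_types, lifting) card_lessThan sum.cong sum_constant)
  then show False
    using n_nz D[of 0] lookup_lead[of "D 0"] by simp
qed

lemma rep_scal: "rep (Poly_Mapping.single 0 c) = scal d (Poly_Mapping.single 0 c)"
  by (rule fm_eqI) (auto simp: mono_def ent_scal act_zero chi_zero)

end

section \<open>Quantum tori\<close>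

text \<open>Row and column indices \<open>i < d\<close> are identified by \<open>h\<close> with the elements of \<open>(\<int>/N)\<^sup>m\<close>. The first \<open>m\<close> exponents
  act by characters, the other \<open>m\<close> by translations.\<close>

locale quantum_torus =
  fixes d N m :: nat and h :: "nat \<Rightarrow> nat \<Rightarrow> nat" and w :: "'e::field"
  assumes N_pos: "N > 0"
    and bij_h: "bij_betw h {..<d} (PiE {..<m} (\<lambda>_. {..<N}))"
    and w_pow: "w ^ N = 1" and w_prim: "w ^ e = 1 \<Longrightarrow> N dvd e"
    and N_nz: "of_nat N \<noteq> (0 :: 'e)"
begin

definition shift :: "expo \<Rightarrow> nat \<Rightarrow> nat \<Rightarrow> nat" where
  "shift g i = (\<lambda>k\<in>{..<m}. (h i k + Poly_Mapping.lookup g (m + k)) mod N)"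

definition act :: "expo \<Rightarrow> nat \<Rightarrow> nat" where
  "act g i = inv_into {..<d} h (shift g i)"

definition chi :: "expo \<Rightarrow> nat \<Rightarrow> 'e" where
  "chi g i = w ^ (\<Sum>k<m. Poly_Mapping.lookup g k * h i k)"

text \<open>The character of \<open>g'\<close> is evaluated at an index translated by
  \<open>g\<close>; the translation contributes this constant factor, while the rest joins the
  character of \<open>g + g'\<close>.\<close>

definition qq :: "expo \<Rightarrow> expo \<Rightarrow> 'e" where
  "qq g g' = w ^ (\<Sum>k<m. Poly_Mapping.lookup g' k * Poly_Mapping.lookup g (m + k))"

lemma d_eq: "d = N ^ m"
  using bij_betw_same_card[OF bij_h] by (simp add: card_PiE)

lemma w_nz: "w \<noteq> 0"
  using w_pow N_pos by (auto simp: zero_power)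

lemma w_cong: "a mod N = b mod N \<Longrightarrow> w ^ a = w ^ b"
proof -
  have "w ^ a = w ^ (a mod N)" for a
  proof -
    have "w ^ a = w ^ (N * (a div N) + a mod N)" by simp
    then show ?thesis unfolding power_add power_mult w_pow by simp
  qed
  then show "a mod N = b mod N \<Longrightarrow> w ^ a = w ^ b" by metis
qed

lemma shift_mem: "shift g i \<in> PiE {..<m} (\<lambda>_. {..<N})"
  using N_pos by (auto simp: shift_def)

lemma act_less: "act g i < d"
proof -
  have "shift g i \<in> h ` {..<d}"
    using shift_mem bij_h by (simp add: bij_betw_def)
  from inv_into_into[OF this] show ?thesis by (simp add: act_def)
qed

lemma h_act: "h (act g i) = shift g i"
  unfolding act_def using shift_mem bij_h by (intro f_inv_into_f) (auto simp: bij_betw_def)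

lemma h_eqD: "i < d \<Longrightarrow> j < d \<Longrightarrow> h i = h j \<Longrightarrow> i = j"
  using bij_h by (auto simp: bij_betw_def inj_on_def)

lemma h_mem: "i < d \<Longrightarrow> h i \<in> PiE {..<m} (\<lambda>_. {..<N})"
  using bij_h by (auto simp: bij_betw_def)

lemma act_eqI: "j < d \<Longrightarrow> (\<And>k. k < m \<Longrightarrow> h j k = (h i k + Poly_Mapping.lookup g (m + k)) mod N) \<Longrightarrow> act g i = j"
  using h_mem[of j]
  by (intro h_eqD act_less) (auto simp: h_act shift_def PiE_def extensional_def intro!: ext)

sublocale monomial_rep d act chi qq
proof
  show "d > 0" using N_pos by (simp add: d_eq)
  show "act g i < d" for g i by (rule act_less)
  show "act (g + g') i = act g' (act g i)" if "i < d" for g g' i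
    by (rule act_eqI) (auto simp: act_less h_act shift_def lookup_add mod_simps ac_simps)
  show "act 0 i = i" if "i < d" for i
    using h_mem[OF that] by (intro act_eqI that) (auto simp: PiE_def Pi_def)
  show "chi g i \<noteq> 0" "chi 0 i = 1" "qq g g' \<noteq> 0" for g g' i
    using w_nz by (auto simp: chi_def qq_def)
  show "chi g i * chi g' (act g i) = qq g g' * chi (g + g') i" if "i < d" for g g' i
  proof -
    have "chi g' (act g i) = (\<Prod>k<m. w ^ (Poly_Mapping.lookup g' k * ((h i k + Poly_Mapping.lookup g (m + k)) mod N)))"
      by (simp add: chi_def h_act shift_def power_sum)
    \<comment> \<open>The reduction modulo \<open>N\<close> in \<open>shift\<close> is invisible to
      powers of \<open>w\<close>.\<close>
    also have "\<dots> = (\<Prod>k<m. w ^ (Poly_Mapping.lookup g' k * (h i k + Poly_Mapping.lookup g (m + k))))"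
      by (intro prod.cong refl w_cong) (simp add: mod_simps)
    also have "\<dots> = w ^ (\<Sum>k<m. Poly_Mapping.lookup g' k * (h i k + Poly_Mapping.lookup g (m + k)))"
      by (simp add: power_sum)
    finally have *: "chi g' (act g i) = w ^ (\<Sum>k<m. Poly_Mapping.lookup g' k * (h i k + Poly_Mapping.lookup g (m + k)))" .
    have "chi g i * chi g' (act g i) = w ^ ((\<Sum>k<m. Poly_Mapping.lookup g k * h i k) +
        (\<Sum>k<m. Poly_Mapping.lookup g' k * (h i k + Poly_Mapping.lookup g (m + k))))"
      unfolding * by (simp add: chi_def power_add)
    also have "\<dots> = w ^ ((\<Sum>k<m. Poly_Mapping.lookup g' k * Poly_Mapping.lookup g (m + k)) +
        (\<Sum>k<m. Poly_Mapping.lookup (g + g') k * h i k))"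
      by (rule arg_cong[of _ _ "power w"]) (simp add: sum.distrib lookup_add distrib_left distrib_right)
    finally show ?thesis
      by (simp add: chi_def qq_def power_add)
  qed
qed

text \<open>\<open>w ^ N = 1\<close>, so \<open>qq\<close> sees exponents only modulo
  \<open>N\<close>, and variables beyond the first \<open>2 * m\<close> do not enter it.\<close>

lemma similarI:
  assumes "\<And>k. k < 2 * m \<Longrightarrow> Poly_Mapping.lookup a k mod N = Poly_Mapping.lookup b k mod N"
  shows "similar a b"
proof -
  have "qq a x = qq b x" for x
    unfolding qq_def power_sum using assms by (intro prod.cong refl w_cong mod_mult_cong) auto
  moreover have "qq x a = qq x b" for x
    unfolding qq_def power_sum using assms by (intro prod.cong refl w_cong mod_mult_cong) auto
  ultimately show ?thesis by (simp add: similar_def)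
qed

definition aug :: "(expo \<Rightarrow>\<^sub>0 'e) \<Rightarrow> 'e" where
  "aug = pm_ext (\<lambda>_ c. c)"

lemma aug_hom: "semiring_hom_fun aug"
  unfolding aug_def by (rule pm_ext_ident_hom)

text \<open>Orthogonality of the characters of a cyclic group of order \<open>N\<close>; primitivity
  of \<open>w\<close> keeps \<open>w ^ e\<close> away from 1 in the second case.\<close>

lemma geometric_w: "(\<Sum>g<N. (w ^ e) ^ g) = (if N dvd e then of_nat N else 0)"
proof (cases "N dvd e")
  case True
  then have "w ^ e = 1" using w_cong[of e 0] by auto
  then show ?thesis using True by simp
next
  case False
  then have "w ^ e \<noteq> 1" using w_prim by blast
  moreover have "(w ^ e) ^ N = 1"
  proof -
    have "(w ^ e) ^ N = (w ^ N) ^ e"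
      by (simp only: power_mult[symmetric] mult.commute)
    then show ?thesis by (simp add: w_pow)
  qed
  ultimately show ?thesis using False by (simp add: geometric_sum)
qed

lemma aug_rep_sum: "aug (ent (rep (\<Sum>x\<in>S. f x)) i j) = (\<Sum>x\<in>S. aug (ent (rep (f x)) i j))"
  by (simp add: rep_sum semiring_hom_fun.hom_sum[OF aug_hom])

lemma aug_rep_single: "aug (ent (rep (Poly_Mapping.single g c)) i j) = (if i < d \<and> j = act g i then c * chi g i else 0)"
  by (simp add: mono_def aug_def)

text \<open>At \<open>t = 1\<close> every matrix unit, and hence every matrix, is obtained: Fourier inversion.\<close>

lemma matrix_unit_rep:
  assumes a: "a < d" and b: "b < d"
  shows "\<exists>f. \<forall>i<d. \<forall>j<d. aug (ent (rep f) i j) = (if i = a \<and> j = b then c else 0)"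
proof -
  let ?P = "PiE {..<m} (\<lambda>_. {..<N})"
  \<comment> \<open>The first \<open>m\<close> exponents run through all characters. The others are
    the fixed translation from \<open>a\<close> to \<open>b\<close>, with \<open>N\<close> added to
    stay within the natural numbers.\<close>
  define \<gamma> :: "(nat \<Rightarrow> nat) \<Rightarrow> expo" where
    "\<gamma> g = (\<Sum>k<m. Poly_Mapping.single k (g k)) + (\<Sum>k<m. Poly_Mapping.single (m + k) (h b k + N - h a k))" for g
  have l1: "Poly_Mapping.lookup (\<gamma> g) k = g k" if "k < m" for g k
    using that by (simp add: \<gamma>_def lookup_add lookup_sum lookup_single when_def)
  have l2: "Poly_Mapping.lookup (\<gamma> g) (m + k) = h b k + N - h a k" if "k < m" for g k
    using that by (simp add: \<gamma>_def lookup_add lookup_sum lookup_single when_def)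
  \<comment> \<open>Fourier coefficients of the indicator function of row \<open>a\<close>, scaled
    by \<open>c\<close>: \<open>N - h a k\<close> stands for the negative of \<open>h a k\<close>,
    and \<open>d = N ^ m\<close> is invertible.\<close>
  define f where "f = (\<Sum>g\<in>?P. Poly_Mapping.single (\<gamma> g) (c / of_nat d * w ^ (\<Sum>k<m. g k * (N - h a k))))"
  have fin: "finite ?P" by (intro finite_PiE) auto
  have dnz: "of_nat d \<noteq> (0::'e)" using N_nz by (simp add: d_eq)
  have "aug (ent (rep f) i j) = (if i = a \<and> j = b then c else 0)" if i: "i < d" and j: "j < d" for i j
  proof -
    obtain g0 where g0: "g0 \<in> ?P" using shift_mem by blast
    define t where "t = act (\<gamma> g0) i"
    \<comment> \<open>All these monomials contain the same translation, so row \<open>i\<close>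
      always has its entry in the same column.\<close>
    have t: "act (\<gamma> g) i = t" for g
    proof -
      have "shift (\<gamma> g) i = shift (\<gamma> g0) i"
        unfolding shift_def by (rule restrict_ext) (simp add: l2)
      then show ?thesis by (simp add: t_def act_def)
    qed
    have "aug (ent (rep f) i j) = (\<Sum>g\<in>?P. if j = t then c / of_nat d * (w ^ (\<Sum>k<m. g k * (N - h a k)) * chi (\<gamma> g) i) else 0)"
      unfolding f_def aug_rep_sum aug_rep_single t using i by (intro sum.cong refl) (simp add: mult.assoc)
    also have "\<dots> = (if j = t then c / of_nat d * (\<Sum>g\<in>?P. w ^ (\<Sum>k<m. g k * (N - h a k)) * chi (\<gamma> g) i) else 0)"
      by (simp add: sum_distrib_left)
    also have "(\<Sum>g\<in>?P. w ^ (\<Sum>k<m. g k * (N - h a k)) * chi (\<gamma> g) i) =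
        (\<Sum>g\<in>?P. \<Prod>k<m. (w ^ (h i k + (N - h a k))) ^ g k)"
    proof (intro sum.cong refl)
      fix g
      have "w ^ (\<Sum>k<m. g k * (N - h a k)) * chi (\<gamma> g) i = w ^ (\<Sum>k<m. (h i k + (N - h a k)) * g k)"
        by (simp add: chi_def l1 power_add[symmetric] sum.distrib[symmetric] algebra_simps)
      then show "w ^ (\<Sum>k<m. g k * (N - h a k)) * chi (\<gamma> g) i = (\<Prod>k<m. (w ^ (h i k + (N - h a k))) ^ g k)"
        by (simp add: power_sum power_mult)
    qed
    \<comment> \<open>The sum over all characters factors into one geometric sum for each
      coordinate.\<close>
    also have "\<dots> = (\<Prod>k<m. \<Sum>x<N. (w ^ (h i k + (N - h a k))) ^ x)"
      by (intro prod_sum_PiE[symmetric]) auto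
    also have "\<dots> = (\<Prod>k<m. if N dvd h i k + (N - h a k) then of_nat N else 0)"
      by (simp add: geometric_w)
    also have "\<dots> = (if i = a then of_nat d else 0)"
    proof -
      have lt: "h i k < N" "h a k < N" if "k < m" for k
        using h_mem[OF i] h_mem[OF a] that by (auto simp: PiE_def Pi_def)
      have dvd: "N dvd h i k + (N - h a k) \<longleftrightarrow> h i k = h a k" if "k < m" for k
      proof
        assume "N dvd h i k + (N - h a k)"
        then obtain c where c: "h i k + (N - h a k) = N * c" by blast
        \<comment> \<open>The sum lies strictly between 0 and \<open>2 * N\<close>, so
          \<open>N\<close> divides it only by being equal to it.\<close>
        have "0 < N * c" "N * c < N * 2" using lt[OF that] c by linarith+
        then have "c = 1" using N_pos by auto
        then show "h i k = h a k" using c lt[OF that] by simp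
      qed (use lt[OF that] in simp)
      show ?thesis
      proof (cases "i = a")
        case True
        have "(\<Prod>k<m. if N dvd h i k + (N - h a k) then of_nat N else (0::'e)) = (\<Prod>k<m. of_nat N)"
          using True dvd by (intro prod.cong refl) auto
        then show ?thesis using True by (simp add: d_eq)
      next
        case False
        then have "h i \<noteq> h a" using h_eqD i a by blast
        then obtain k where "k < m" "h i k \<noteq> h a k"
          using h_mem[OF i] h_mem[OF a] by (metis PiE_ext lessThan_iff)
        then have "(\<Prod>k<m. if N dvd h i k + (N - h a k) then of_nat N else (0::'e)) = 0"
          using dvd by (intro prod_zero) auto
        then show ?thesis using False by simp
      qed
    qed
    finally have "aug (ent (rep f) i j) = (if j = t \<and> i = a then c else 0)"
      using dnz by simp
    moreover have "t = b" if "i = a"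
      unfolding t_def that
    proof (rule act_eqI[OF b])
      fix k assume k: "k < m"
      have "h a k < N" "h b k < N"
        using h_mem[OF a] h_mem[OF b] k by (auto simp: PiE_def Pi_def)
      then show "h b k = (h a k + Poly_Mapping.lookup (\<gamma> g0) (m + k)) mod N"
        using k by (simp add: l2)
    qed
    ultimately show ?thesis by auto
  qed
  then show ?thesis by blast
qed

lemma matrix_rep:
  "\<exists>f. \<forall>i<d. \<forall>j<d. aug (ent (rep f) i j) = z i j"
proof -
  have "\<forall>a\<in>{..<d}. \<forall>b\<in>{..<d}. \<exists>f.
    \<forall>i<d. \<forall>j<d. aug (ent (rep f) i j) = (if i = a \<and> j = b then z a b else 0)"
    using matrix_unit_rep by blast
  then obtain f where f: "\<And>a b. a < d \<Longrightarrow> b < d \<Longrightarrow> 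
    \<forall>i<d. \<forall>j<d. aug (ent (rep (f a b)) i j) = (if i = a \<and> j = b then z a b else 0)"
    by (metis lessThan_iff)
  define F where "F = (\<Sum>a<d. \<Sum>b<d. f a b)"
  have "aug (ent (rep F) i j) = z i j" if "i < d" "j < d" for i j
  proof -
    have "aug (ent (rep F) i j) = (\<Sum>a<d. \<Sum>b<d. if i = a \<and> j = b then z a b else 0)"
      unfolding F_def aug_rep_sum using f that by (intro sum.cong refl) auto
    also have "\<dots> = (\<Sum>a<d. if i = a then \<Sum>b<d. if j = b then z a b else 0 else 0)"
      by (intro sum.cong refl) auto
    finally show ?thesis using that by simp
  qed
  then show ?thesis by blast
qed

end

section \<open>Prime algebras of matrices and their central quotients\<close>

definition munit :: "nat \<Rightarrow> nat \<Rightarrow> 'a::zero_neq_one fm" where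
  "munit k l = Mk (\<lambda>i j. if i = k \<and> j = l then 1 else 0)"

lemma munit_fmats [simp]: "k < d \<Longrightarrow> l < d \<Longrightarrow> munit k l \<in> fmats d"
  by (auto simp: munit_def fmats_def)

lemma ent_munit: "ent (munit k l) i j = (if i = k \<and> j = l then 1 else 0)"
  by (simp add: munit_def)

lemma ent_mult_munit:
  fixes A :: "'a::comm_semiring_1 fm"
  assumes "k < d" "l < d" "i < d" "j < d"
  shows "ent (mm d (mm d A (munit k l)) C) i j = ent A i k * ent C l j"
proof -
  have "ent (mm d A (munit k l)) i j' = (if j' = l then ent A i k else 0)" if "j' < d" for j'
  proof -
    have "(\<Sum>r<d. ent A i r * ent (munit k l) r j') = (\<Sum>r<d. if r = k then (if j' = l then ent A i r else 0) else 0)"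
      by (rule sum.cong) (auto simp: ent_munit)
    then have "ent (mm d A (munit k l)) i j' = (\<Sum>r<d. if r = k then (if j' = l then ent A i r else 0) else 0)"
      using assms that by (simp add: ent_mm)
    then show ?thesis using assms by simp
  qed
  then have "(\<Sum>r<d. ent (mm d A (munit k l)) i r * ent C r j) = (\<Sum>r<d. if r = l then ent A i k * ent C r j else 0)"
    by (intro sum.cong) auto
  then have "ent (mm d (mm d A (munit k l)) C) i j = (\<Sum>r<d. if r = l then ent A i k * ent C r j else 0)"
    using assms by (simp add: ent_mm[of d "mm d A (munit k l)"])
  then show ?thesis using assms by simp
qed

lemma munit_expand:
  fixes A :: "'a::comm_semiring_1 fm"
  assumes "A \<in> fmats d"
  shows "A = (\<Sum>k<d. \<Sum>l<d. smul (ent A k l) (munit k l))"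
proof (rule fmats_eqI[OF assms])
  fix i j assume "i < d" "j < d"
  have "ent (\<Sum>k<d. \<Sum>l<d. smul (ent A k l) (munit k l)) i j
      = (\<Sum>k<d. \<Sum>l<d. if l = j then (if k = i then ent A k l else 0) else 0)"
    unfolding ent_sum by (intro sum.cong refl) (simp add: ent_munit)
  also have "\<dots> = (\<Sum>k<d. if k = i then \<Sum>l<d. if l = j then ent A k l else 0 else 0)"
    by (intro sum.cong refl) simp
  finally have "ent (\<Sum>k<d. \<Sum>l<d. smul (ent A k l) (munit k l)) i j
      = (\<Sum>k<d. if k = i then \<Sum>l<d. if l = j then ent A k l else 0 else 0)" .
  then show "ent A i j = ent (\<Sum>k<d. \<Sum>l<d. smul (ent A k l) (munit k l)) i j"
    using \<open>i < d\<close> \<open>j < d\<close> by (simp del: ent_sum)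
qed (auto intro!: sum_fmats smul_fmats munit_fmats)

text \<open>For the unit \<open>e = munit j 0\<close>, the entry \<open>(i, 0)\<close> of
  \<open>A e\<close> is \<open>ent A i j\<close>, while in \<open>e A\<close> it is
  \<open>ent A 0 0\<close> or 0.\<close>

lemma scalar_if_central:
  fixes A :: "'a::comm_ring_1 fm"
  assumes A: "A \<in> fmats d" and d: "d > 0"
    and comm: "\<And>k l. k < d \<Longrightarrow> l < d \<Longrightarrow> mm d A (munit k l) = mm d (munit k l) A"
  shows "A = scal d (ent A 0 0)"
proof (rule fmats_eqI[OF A])
  fix i j assume ij: "i < d" "j < d"
  have "ent (mm d (mm d A (munit j 0)) (scal d 1)) i 0 = ent A i j"
    using ent_mult_munit[of j d 0 i 0 A "scal d 1"] ij d by (simp add: ent_scal)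
  moreover have "ent (mm d (mm d (scal d 1) (munit j 0)) A) i 0 = (if i = j then ent A 0 0 else 0)"
    using ent_mult_munit[of j d 0 i 0 "scal d 1" A] ij d by (auto simp: ent_scal)
  moreover have "mm d (mm d A (munit j 0)) (scal d 1) = mm d (mm d (scal d 1) (munit j 0)) A"
    using comm[of j 0] ij d by simp
  ultimately show "ent A i j = ent (scal d (ent A 0 0)) i j"
    using ij by (simp add: ent_scal)
qed auto

text \<open>The list stands for the element \<open>\<Sum> b \<otimes> c\<close> of the tensor
  product of the matrix ring with its opposite, acting by two-sided multiplication.\<close>

definition app :: "nat \<Rightarrow> ('a::comm_ring_1 fm \<times> 'a fm) list \<Rightarrow> 'a fm \<Rightarrow> 'a fm" where
  "app d ts z = (\<Sum>(b, c)\<leftarrow>ts. mm d (mm d b z) c)"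

lemma app_Nil [simp]: "app d [] z = 0"
  by (simp add: app_def)

lemma app_Cons [simp]: "app d ((b, c) # ts) z = mm d (mm d b z) c + app d ts z"
  by (simp add: app_def)

lemma app_append [simp]: "app d (ts @ ts') z = app d ts z + app d ts' z"
  by (simp add: app_def)

lemma app_left: "app d (map (\<lambda>(b, c). (mm d p b, c)) ts) z = mm d p (app d ts z)"
  by (induction ts) (auto simp: mm_add_right mm_assoc)

lemma app_right: "app d (map (\<lambda>(b, c). (b, mm d c p)) ts) z = mm d (app d ts z) p"
  by (induction ts) (auto simp: mm_add_left mm_assoc)

lemma app_concat: "app d (concat (map f [0..<n])) z = (\<Sum>a<n. app d (f a) z)"
  by (induction n) auto

lemma app_fmats [simp]: "app d ts z \<in> fmats d"
  by (induction ts) auto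

lemma app_add: "app d ts (y + z) = app d ts y + app d ts z"
  by (induction ts) (auto simp: mm_add_left mm_add_right ac_simps)

lemma app_zero [simp]: "app d ts 0 = 0"
  by (induction ts) auto

lemma app_sum: "app d ts (\<Sum>x\<in>S. f x) = (\<Sum>x\<in>S. app d ts (f x))"
  by (induction S rule: infinite_finite_induct) (auto simp: app_add)

lemma app_smul: "app d ts (smul c z) = smul c (app d ts z)"
  by (induction ts) (auto simp: mm_smul_left mm_smul_right smul_add)

text \<open>Interchanging left and right factors gives the adjoint operator for the trace form,
  because entry \<open>(l, k)\<close> of a matrix is the trace of its product with
  \<open>munit k l\<close>.\<close>

lemma ent_app_swap:
  assumes "k < d" "l < d"
  shows "ent (app d (map prod.swap ts) y) l k = (\<Sum>n<d. \<Sum>m<d. ent y n m * ent (app d ts (munit k l)) m n)"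
proof (induction ts)
  case (Cons t ts)
  obtain b c where t: "t = (b, c)" by force
  have "ent (mm d (mm d c y) b) l k = (\<Sum>m<d. \<Sum>n<d. ent c l n * ent y n m * ent b m k)"
    using assms by (simp add: ent_mm sum_distrib_right)
  also have "\<dots> = (\<Sum>n<d. \<Sum>m<d. ent c l n * ent y n m * ent b m k)"
    by (rule sum.swap)
  also have "\<dots> = (\<Sum>n<d. \<Sum>m<d. ent y n m * ent (mm d (mm d b (munit k l)) c) m n)"
    using assms by (intro sum.cong refl) (simp add: ent_mult_munit mult_ac)
  finally show ?case
    using Cons by (simp add: t sum.distrib distrib_left)
qed simp

text \<open>The properties of the generic matrix algebra that give its ring of central quotients: it
  is a domain and contains a basis \<open>x\<close> of all matrices over the ambient field.\<close>

locale matrix_domain =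
  fixes d N :: nat and B :: "'f::field fm set" and x :: "nat \<Rightarrow> 'f fm"
  assumes d_pos: "d > 0" and B_fmats: "b \<in> B \<Longrightarrow> b \<in> fmats d"
    and B_one: "scal d 1 \<in> B"
    and B_add: "a \<in> B \<Longrightarrow> b \<in> B \<Longrightarrow> a + b \<in> B"
    and B_uminus: "a \<in> B \<Longrightarrow> - a \<in> B"
    and B_mult: "a \<in> B \<Longrightarrow> b \<in> B \<Longrightarrow> mm d a b \<in> B"
    and B_domain: "a \<in> B \<Longrightarrow> b \<in> B \<Longrightarrow> mm d a b = 0 \<Longrightarrow> a = 0 \<or> b = 0"
    and x_B: "n < N \<Longrightarrow> x n \<in> B"
    and x_span: "z \<in> fmats d \<Longrightarrow> \<exists>c. z = (\<Sum>n<N. smul (c n) (x n))"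
    and x_indep: "(\<Sum>n<N. smul (c n) (x n)) = 0 \<Longrightarrow> n < N \<Longrightarrow> c n = 0"
begin

lemma B_zero: "0 \<in> B"
  using B_add[OF B_one B_uminus[OF B_one]] by simp

lemma B_sum: "(\<And>a. a \<in> S \<Longrightarrow> f a \<in> B) \<Longrightarrow> (\<Sum>a\<in>S. f a) \<in> B"
  by (induction S rule: infinite_finite_induct) (auto simp: B_zero B_add)

lemma app_B: "set ts \<subseteq> B \<times> B \<Longrightarrow> z \<in> B \<Longrightarrow> app d ts z \<in> B"
  by (induction ts) (auto simp: B_zero B_add B_mult)

text \<open>The maps \<open>y \<mapsto> \<Sum> c\<^sub>a y x\<^sub>a\<close> separate the coefficients \<open>c\<^sub>a\<close>, even if \<open>y\<close> ranges only over \<open>B\<close>.\<close>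

lemma separate_coefficients:
  assumes c: "\<And>a. a < N \<Longrightarrow> c a \<in> fmats d"
    and zero: "\<And>y. y \<in> B \<Longrightarrow> (\<Sum>a<N. mm d (mm d (c a) y) (x a)) = 0"
    and a: "a < N"
  shows "c a = 0"
proof -
  have all: "(\<Sum>a<N. mm d (mm d (c a) y) (x a)) = 0" if y: "y \<in> fmats d" for y
  proof -
    obtain e where e: "y = (\<Sum>b<N. smul (e b) (x b))" using x_span[OF y] by blast
    have "(\<Sum>a<N. mm d (mm d (c a) y) (x a)) = (\<Sum>a<N. \<Sum>b<N. smul (e b) (mm d (mm d (c a) (x b)) (x a)))"
      by (simp add: e mm_sum_left mm_sum_right mm_smul_left mm_smul_right)
    also have "\<dots> = (\<Sum>b<N. smul (e b) (\<Sum>a<N. mm d (mm d (c a) (x b)) (x a)))"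
      by (subst sum.swap) (simp add: smul_sum)
    also have "\<dots> = 0" using zero x_B by simp
    finally show ?thesis .
  qed
  have "ent (c a) i k = 0" if ik: "i < d" "k < d" for i k
  proof -
    have "(\<Sum>a<N. smul (ent (c a) i k) (x a)) = 0"
    proof (rule fmats_eqI[of _ d])
      \<comment> \<open>With \<open>munit k l\<close> for \<open>y\<close>, the entry
        \<open>(i, j)\<close> of each summand is \<open>ent (c a) i k * ent (x a) l j\<close>.
        Letting \<open>l\<close> and \<open>j\<close> vary, this is a linear relation between the
        \<open>x a\<close>.\<close>
      fix l j assume lj: "l < d" "j < d"
      have "ent (\<Sum>a<N. mm d (mm d (c a) (munit k l)) (x a)) i j = 0"
        using all[of "munit k l"] ik lj by (simp del: ent_sum)
      then show "ent (\<Sum>a<N. smul (ent (c a) i k) (x a)) l j = ent 0 l j"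
        using ik lj by (simp add: ent_mult_munit)
    qed (auto intro!: sum_fmats smul_fmats intro: B_fmats[OF x_B])
    from x_indep[OF this a] show ?thesis .
  qed
  then show ?thesis
    using c[OF a] by (intro fmats_eqI[of _ d]) auto
qed

text \<open>Operators \<open>z \<mapsto> \<Sum> b z c\<close> with \<open>b, c \<in> B\<close> that realize, up to a common factor \<open>p\<close>, the dual basis. In the
  induction step, \<open>S\<close> kills the previous basis elements and \<open>s = S x\<^sub>n\<close>.\<close>

lemma dual_operators_step:
  assumes n: "n \<le> N"
  shows "\<exists>p ts. p \<in> B \<and> p \<noteq> 0 \<and> (\<forall>a<n. set (ts a) \<subseteq> B \<times> B \<and>
    (\<forall>b<n. app d (ts a) (x b) = (if a = b then p else 0)))"
  using n
proof (induction n)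
  case 0
  have "scal d 1 \<noteq> (0 :: 'f fm)" using scal_inject[OF d_pos, of 1 "0::'f"] by simp
  then show ?case using B_one by (intro exI[of _ "scal d 1"]) auto
next
  case (Suc n)
  from Suc.IH[OF Suc_leD[OF Suc.prems]]
  obtain p ts where p: "p \<in> B" "p \<noteq> 0" and *: "\<forall>a<n. set (ts a) \<subseteq> B \<times> B \<and>
      (\<forall>b<n. app d (ts a) (x b) = (if a = b then p else 0))"
    by (elim exE conjE)
  have ts: "\<And>a. a < n \<Longrightarrow> set (ts a) \<subseteq> B \<times> B"
    and dual: "\<And>a b. a < n \<Longrightarrow> b < n \<Longrightarrow> app d (ts a) (x b) = (if a = b then p else 0)"
    using * by blast+
  have n: "n < N" using Suc by simp
  define t where "t a = app d (ts a) (x n)" for a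
  have t_B: "t a \<in> B" if "a < n" for a
    using app_B[OF ts[OF that] x_B[OF n]] by (simp add: t_def)
  \<comment> \<open>On an earlier \<open>x b\<close> the operator \<open>ts b\<close> returns
    \<open>p\<close> and the others return 0, so the two terms cancel.\<close>
  define S where "S y z = mm d (mm d p y) z - (\<Sum>a<n. mm d (app d (ts a) z) (mm d y (x a)))" for y z
  \<comment> \<open>If \<open>S y (x n)\<close> vanished for all \<open>y\<close>, then
    \<open>p\<close> and the elements \<open>- t a\<close> would be the coefficients of a relation
    as in \<open>separate_coefficients\<close>, forcing \<open>p = 0\<close>.\<close>
  obtain y where y: "y \<in> B" "S y (x n) \<noteq> 0"
  proof (rule ccontr)
    assume neg: "\<not> thesis"
    define c where "c a = (if a = n then p else if a < n then - t a else 0)" for a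
    have "c n = 0"
    proof (rule separate_coefficients)
      show "c a \<in> fmats d" for a
        using p t_B B_fmats by (auto simp: c_def)
      fix y assume "y \<in> B"
      then have "S y (x n) = 0" using neg that by blast
      have "(\<Sum>a<N. mm d (mm d (c a) y) (x a)) = (\<Sum>a<Suc n. mm d (mm d (c a) y) (x a))"
        using n by (intro sum.mono_neutral_right) (auto simp: c_def)
      also have "\<dots> = S y (x n)"
        by (simp add: S_def c_def t_def mm_assoc mm_uminus_left sum_negf)
      finally show "(\<Sum>a<N. mm d (mm d (c a) y) (x a)) = 0" using \<open>S y (x n) = 0\<close> by simp
    qed (rule n)
    then show False using p by (simp add: c_def)
  qed
  define s where "s = S y (x n)"
  define ss where "ss = (mm d p y, scal d 1) # concat (map (\<lambda>a. map (\<lambda>(b, c). (- b, mm d c (mm d y (x a)))) (ts a)) [0..<n])"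
  have neg_right: "app d (map (\<lambda>(b, c). (- b, mm d c e)) us) z = - mm d (app d us z) e" for us z e
    by (induction us) (auto simp: mm_add_left mm_assoc mm_uminus_left)
  have ss: "app d ss z = S y z" if "z \<in> fmats d" for z
    by (simp add: ss_def S_def app_concat neg_right sum_negf)
  have ss_B: "set ss \<subseteq> B \<times> B"
    using p y ts x_B n by (fastforce simp: ss_def intro: B_mult B_uminus B_one)
  have s_B: "s \<in> B"
    unfolding s_def using app_B[OF ss_B x_B[OF n]] ss B_fmats[OF x_B[OF n]] by simp
  have S_zero: "S y (x b) = 0" if "b < n" for b
  proof -
    have "(\<Sum>a<n. mm d (app d (ts a) (x b)) (mm d y (x a))) = (\<Sum>a<n. if a = b then mm d p (mm d y (x a)) else 0)"
      using dual that by (intro sum.cong refl) auto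
    then show ?thesis using that by (simp add: S_def mm_assoc)
  qed
  define r where "r a = - t a" for a
  \<comment> \<open>The new common factor is \<open>p s\<close>. Right multiplication by
    \<open>s\<close> produces it for the old operators; the correction by \<open>r a = - t a\<close>
    makes them kill \<open>x n\<close> and changes nothing on the earlier \<open>x b\<close>, where
    \<open>S\<close> vanishes.\<close>
  define ts' where "ts' a = (if a = n then map (\<lambda>(b, c). (mm d p b, c)) ss
     else map (\<lambda>(b, c). (b, mm d c s)) (ts a) @ map (\<lambda>(b, c). (mm d (r a) b, c)) ss)" for a
  have app': "app d (ts' a) z = (if a = n then mm d p (S y z) else mm d (app d (ts a) z) s + mm d (r a) (S y z))"
    if "z \<in> fmats d" for a z
    using that by (auto simp: ts'_def app_left app_right ss)
  have "set (ts' a) \<subseteq> B \<times> B" if "a < Suc n" for a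
  proof (cases "a = n")
    case True
    then show ?thesis using ss_B p by (auto simp: ts'_def intro: B_mult)
  next
    case False
    then have "a < n" using that by simp
    then show ?thesis using False ss_B ts[of a] t_B[of a] s_B by (auto simp: ts'_def r_def intro: B_mult B_uminus)
  qed
  moreover have "app d (ts' a) (x b) = (if a = b then mm d p s else 0)" if "a < Suc n" "b < Suc n" for a b
  proof -
    have "x b \<in> fmats d" using that n x_B B_fmats by auto
    then show ?thesis
      using that S_zero[of b] dual[of a b] by (auto simp: app' less_Suc_eq s_def t_def r_def mm_uminus_left)
  qed
  moreover have "mm d p s \<in> B" "mm d p s \<noteq> 0"
    using p s_B B_domain[OF p(1) s_B] y(2) by (auto simp: s_def intro: B_mult)
  ultimately show ?case by (intro exI[of _ "mm d p s"] exI[of _ ts']) auto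
qed

section \<open>The dual basis for the trace form\<close>

definition coord :: "nat \<Rightarrow> 'f fm \<Rightarrow> 'f" where
  "coord a z = (SOME c. z = (\<Sum>a<N. smul (c a) (x a))) a"

lemma coord_sum: "z \<in> fmats d \<Longrightarrow> z = (\<Sum>a<N. smul (coord a z) (x a))"
  unfolding coord_def using someI_ex[OF x_span] .

lemma coord_unique:
  assumes "(\<Sum>a<N. smul (c a) (x a)) = (\<Sum>a<N. smul (e a) (x a))" "a < N"
  shows "c a = e a"
proof -
  have "(\<Sum>a<N. smul (c a - e a) (x a)) = (\<Sum>a<N. smul (c a) (x a)) - (\<Sum>a<N. smul (e a) (x a))"
    unfolding sum_subtractf[symmetric] by (intro sum.cong refl fm_eqI) (simp add: left_diff_distrib)
  then have "(\<Sum>a<N. smul (c a - e a) (x a)) = 0" using assms by simp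
  from x_indep[OF this assms(2)] show ?thesis by simp
qed

text \<open>The linear functional \<open>coord a\<close> as a trace against a fixed matrix, whose
  entries are the values of the functional on the transposed matrix units.\<close>

definition dual :: "nat \<Rightarrow> 'f fm" where
  "dual a = Mk (\<lambda>l k. if l < d \<and> k < d then coord a (munit k l) else 0)"

lemma dual_fmats [simp]: "dual a \<in> fmats d"
  by (auto simp: dual_def fmats_def)

lemma coord_trace:
  assumes z: "z \<in> fmats d" and a: "a < N"
  shows "coord a z = tr d (mm d (dual a) z)"
proof -
  have "z = (\<Sum>k<d. \<Sum>l<d. smul (ent z k l) (munit k l))"
    by (rule munit_expand[OF z])
  also have "\<dots> = (\<Sum>k<d. \<Sum>l<d. smul (ent z k l) (\<Sum>a<N. smul (coord a (munit k l)) (x a)))"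
    using coord_sum by (intro sum.cong refl arg_cong[of _ _ "smul _"]) auto
  also have "\<dots> = (\<Sum>k<d. \<Sum>l<d. \<Sum>a<N. smul (ent z k l * coord a (munit k l)) (x a))"
    by (simp add: smul_sum)
  also have "\<dots> = (\<Sum>k<d. \<Sum>a<N. \<Sum>l<d. smul (ent z k l * coord a (munit k l)) (x a))"
    by (rule sum.cong[OF refl]) (rule sum.swap)
  also have "\<dots> = (\<Sum>a<N. \<Sum>k<d. \<Sum>l<d. smul (ent z k l * coord a (munit k l)) (x a))"
    by (rule sum.swap)
  also have "\<dots> = (\<Sum>a<N. smul (\<Sum>k<d. \<Sum>l<d. ent z k l * coord a (munit k l)) (x a))"
    by (intro sum.cong refl fm_eqI) (simp add: sum_distrib_right)
  finally have eq: "z = (\<Sum>a<N. smul (\<Sum>k<d. \<Sum>l<d. ent z k l * coord a (munit k l)) (x a))" .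
  have "coord a z = (\<Sum>k<d. \<Sum>l<d. ent z k l * coord a (munit k l))"
    by (rule coord_unique[OF _ a]) (rule trans[OF coord_sum[OF z, symmetric] eq])
  also have "\<dots> = tr d (mm d (dual a) z)"
    by (subst sum.swap) (simp add: tr_def ent_mm dual_def mult.commute)
  finally show ?thesis .
qed

text \<open>The Casimir element \<open>\<Sum> x a \<otimes> dual a\<close> does not depend on the
  basis, and for matrix units this sandwich is visibly the trace.\<close>

lemma casimir:
  assumes z: "z \<in> fmats d"
  shows "(\<Sum>a<N. mm d (mm d (x a) z) (dual a)) = scal d (tr d z)"
proof (rule fmats_eqI[of _ d])
  fix r k assume rk: "r < d" "k < d"
  have "ent (\<Sum>a<N. mm d (mm d (x a) z) (dual a)) r k
      = (\<Sum>a<N. \<Sum>l<d. \<Sum>s<d. ent (x a) r s * ent z s l * coord a (munit k l))"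
    using rk by (simp add: ent_mm dual_def sum_distrib_right)
  also have "\<dots> = (\<Sum>l<d. \<Sum>a<N. \<Sum>s<d. ent (x a) r s * ent z s l * coord a (munit k l))"
    by (rule sum.swap)
  also have "\<dots> = (\<Sum>l<d. \<Sum>s<d. \<Sum>a<N. ent (x a) r s * ent z s l * coord a (munit k l))"
    by (rule sum.cong[OF refl]) (rule sum.swap)
  also have "\<dots> = (\<Sum>l<d. \<Sum>s<d. ent z s l * ent (\<Sum>a<N. smul (coord a (munit k l)) (x a)) r s)"
    by (simp add: sum_distrib_left mult_ac)
  also have "\<dots> = (\<Sum>l<d. \<Sum>s<d. ent z s l * ent (munit k l) r s)"
    using rk by (intro sum.cong refl) (simp only: coord_sum[symmetric] munit_fmats lessThan_iff)
  also have "\<dots> = (\<Sum>l<d. \<Sum>s<d. if s = l then (if r = k then ent z s l else 0) else 0)"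
    by (intro sum.cong refl) (simp add: ent_munit)
  also have "\<dots> = ent (scal d (tr d z)) r k"
    using rk by (simp add: ent_scal tr_def)
  finally show "ent (\<Sum>a<N. mm d (mm d (x a) z) (dual a)) r k = ent (scal d (tr d z)) r k" .
qed auto

text \<open>The trace form is nondegenerate on all matrices, and \<open>B\<close> spans
  them.\<close>

lemma trace_nondegenerate:
  assumes p: "p \<in> fmats d" "p \<noteq> 0"
  shows "\<exists>y\<in>B. tr d (mm d y p) \<noteq> 0"
proof (rule ccontr)
  assume "\<not> ?thesis"
  then have zero: "tr d (mm d y p) = 0" if "y \<in> B" for y using that by blast
  have all: "tr d (mm d y p) = 0" if y: "y \<in> fmats d" for y
  proof -
    have "tr d (mm d (\<Sum>a<N. smul (coord a y) (x a)) p) = (\<Sum>a<N. coord a y * tr d (mm d (x a) p))"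
      unfolding tr_def mm_sum_left mm_smul_left ent_sum ent_smul sum_distrib_left
      by (rule sum.swap)
    then have "tr d (mm d (\<Sum>a<N. smul (coord a y) (x a)) p) = 0" using zero x_B by simp
    then show ?thesis by (simp only: coord_sum[OF y, symmetric])
  qed
  have "ent p i j = 0" if ij: "i < d" "j < d" for i j
  proof -
    have "0 = tr d (mm d (munit j i) p)" using all ij by simp
    also have "\<dots> = tr d (mm d (mm d (scal d 1) (munit j i)) p)" using ij by simp
    also have "\<dots> = (\<Sum>r<d. if r = j then ent p i r else 0)"
      unfolding tr_def using ij by (intro sum.cong refl) (simp add: ent_mult_munit ent_scal del: mm_scal_left mm_one)
    finally show ?thesis using ij by simp
  qed
  then show False using p by (metis fmats_eqI zero_fmats ent_zero)
qed

text \<open>The source of denominators. The dual operators act by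
  \<open>z \<mapsto> coord a z\<close> times \<open>p\<close>; their adjoints send \<open>y\<close>
  to \<open>tr (y p)\<close> times \<open>dual a\<close>, so these multiples lie in
  \<open>B\<close>. The Casimir identity then turns them into scalar matrices in
  \<open>B\<close>.\<close>

lemma central_elements:
  obtains p where "p \<in> B" "p \<noteq> 0"
    "\<And>y z. y \<in> B \<Longrightarrow> z \<in> B \<Longrightarrow> scal d (tr d (mm d y p) * tr d z) \<in> B"
    "\<And>a y. a < N \<Longrightarrow> y \<in> B \<Longrightarrow> smul (tr d (mm d y p)) (dual a) \<in> B"
proof -
  obtain p ts where p: "p \<in> B" "p \<noteq> 0" and *: "\<forall>a<N. set (ts a) \<subseteq> B \<times> B \<and>
      (\<forall>b<N. app d (ts a) (x b) = (if a = b then p else 0))"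
    using dual_operators_step[of N] by blast
  have ts: "\<And>a. a < N \<Longrightarrow> set (ts a) \<subseteq> B \<times> B"
    and dual: "\<And>a b. a < N \<Longrightarrow> b < N \<Longrightarrow> app d (ts a) (x b) = (if a = b then p else 0)"
    using * by blast+
  have app_coord: "app d (ts a) z = smul (coord a z) p" if a: "a < N" and z: "z \<in> fmats d" for a z
  proof -
    have "app d (ts a) (\<Sum>b<N. smul (coord b z) (x b)) = (\<Sum>b<N. if b = a then smul (coord b z) p else 0)"
      unfolding app_sum app_smul using dual a by (intro sum.cong refl) auto
    then have "app d (ts a) (\<Sum>b<N. smul (coord b z) (x b)) = smul (coord a z) p" using a by simp
    then show ?thesis by (simp only: coord_sum[OF z, symmetric])
  qed
  have swap: "app d (map prod.swap (ts a)) y = smul (tr d (mm d y p)) (dual a)"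
    if a: "a < N" for a y
  proof (rule fmats_eqI[of _ d])
    fix l k assume lk: "l < d" "k < d"
    have "ent (app d (map prod.swap (ts a)) y) l k = (\<Sum>n<d. \<Sum>m<d. ent y n m * (coord a (munit k l) * ent p m n))"
      using lk a by (simp add: ent_app_swap app_coord)
    also have "\<dots> = coord a (munit k l) * tr d (mm d y p)"
      by (simp add: tr_def ent_mm sum_distrib_left mult_ac)
    finally show "ent (app d (map prod.swap (ts a)) y) l k = ent (smul (tr d (mm d y p)) (dual a)) l k"
      using lk by (simp add: dual_def)
  qed auto
  have dual_B: "smul (tr d (mm d y p)) (dual a) \<in> B" if "a < N" "y \<in> B" for a y
    unfolding swap[OF that(1), symmetric] using ts[OF that(1)] that(2)
    by (intro app_B) auto
  have "scal d (tr d (mm d y p) * tr d z) \<in> B" if "y \<in> B" "z \<in> B" for y z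
  proof -
    have "scal d (tr d (mm d y p) * tr d z) = smul (tr d (mm d y p)) (\<Sum>a<N. mm d (mm d (x a) z) (dual a))"
      using that B_fmats by (simp add: casimir)
    also have "\<dots> = (\<Sum>a<N. mm d (mm d (x a) z) (smul (tr d (mm d y p)) (dual a)))"
      by (simp add: smul_sum mm_smul_right)
    also have "\<dots> \<in> B"
      using that dual_B x_B by (intro B_sum B_mult) auto
    finally show ?thesis .
  qed
  with p dual_B show ?thesis using that by blast
qed

text \<open>The localization of \<open>B\<close> at its nonzero scalar matrices, realized inside the
  matrices over the ambient field.\<close>

definition Q :: "'f fm set" where
  "Q = {z \<in> fmats d. \<exists>s. s \<noteq> 0 \<and> scal d s \<in> B \<and> smul s z \<in> B}"

lemma coord_Q:
  assumes z: "z \<in> Q" and a: "a < N"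
  shows "scal d (coord a z) \<in> Q"
proof -
  obtain s where s: "s \<noteq> 0" "scal d s \<in> B" "smul s z \<in> B" and zf: "z \<in> fmats d"
    using z by (auto simp: Q_def)
  obtain p where p: "p \<in> B" "p \<noteq> 0"
    and cent: "\<And>y z. y \<in> B \<Longrightarrow> z \<in> B \<Longrightarrow> scal d (tr d (mm d y p) * tr d z) \<in> B"
    and dual: "\<And>a y. a < N \<Longrightarrow> y \<in> B \<Longrightarrow> smul (tr d (mm d y p)) (dual a) \<in> B"
    using central_elements by blast
  obtain y where y: "y \<in> B" "tr d (mm d y p) \<noteq> 0"
    using trace_nondegenerate[OF B_fmats] p by blast
  define \<tau> where "\<tau> = tr d (mm d y p)"
  \<comment> \<open>\<open>b\<close> lies in \<open>B\<close> and has trace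
    \<open>\<tau> s coord a z\<close>, so \<open>\<tau>\<close> times this trace is a scalar of
    \<open>B\<close>. This presents the coordinate as a quotient with denominator
    \<open>\<tau> \<tau> s\<close>.\<close>
  define b where "b = mm d (smul \<tau> (dual a)) (smul s z)"
  have b: "b \<in> B" unfolding b_def \<tau>_def using dual[OF a y(1)] s by (intro B_mult)
  have tr_b: "tr d b = \<tau> * s * coord a z"
    unfolding coord_trace[OF zf a] b_def
    by (simp add: tr_def mm_smul_left mm_smul_right sum_distrib_left mult_ac)
  have "scal d (\<tau> * \<tau>) \<in> B"
    using cent[OF y(1), of "mm d y p"] y p by (simp add: \<tau>_def B_mult)
  then have "mm d (scal d (\<tau> * \<tau>)) (scal d s) \<in> B" using s by (intro B_mult)
  then have 1: "scal d (\<tau> * \<tau> * s) \<in> B" by (simp add: mult_ac)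
  have 2: "smul (\<tau> * \<tau> * s) (scal d (coord a z)) \<in> B"
    using cent[OF y(1) b] by (simp add: tr_b \<tau>_def mult_ac)
  show ?thesis
    unfolding Q_def using 1 2 y(2) s(1) by (auto simp: \<tau>_def intro!: exI[of _ "\<tau> * \<tau> * s"])
qed

lemma B_Q: "b \<in> B \<Longrightarrow> b \<in> Q"
  using B_one B_fmats by (auto simp: Q_def intro!: exI[of _ 1])

lemma scal_B_mult: "scal d s \<in> B \<Longrightarrow> z \<in> B \<Longrightarrow> smul s z \<in> B"
  using B_mult[of "scal d s" z] B_fmats by simp

lemma Q_fmats: "z \<in> Q \<Longrightarrow> z \<in> fmats d"
  by (simp add: Q_def)

lemma scal_B_times: "scal d s \<in> B \<Longrightarrow> scal d t \<in> B \<Longrightarrow> scal d (s * t) \<in> B"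
  using B_mult[of "scal d s" "scal d t"] by (simp add: mult.commute)

lemma Q_I: "z \<in> fmats d \<Longrightarrow> s \<noteq> 0 \<Longrightarrow> scal d s \<in> B \<Longrightarrow> smul s z \<in> B \<Longrightarrow> z \<in> Q"
  by (auto simp: Q_def)

lemma Q_E: "z \<in> Q \<Longrightarrow> (\<And>s. s \<noteq> 0 \<Longrightarrow> scal d s \<in> B \<Longrightarrow> smul s z \<in> B \<Longrightarrow> thesis) \<Longrightarrow> thesis"
  by (auto simp: Q_def)

lemma Q_mult: "y \<in> Q \<Longrightarrow> z \<in> Q \<Longrightarrow> mm d y z \<in> Q"
proof (elim Q_E)
  fix s t assume s: "s \<noteq> 0" "scal d s \<in> B" "smul s y \<in> B" and t: "t \<noteq> 0" "scal d t \<in> B" "smul t z \<in> B"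
  have "smul (s * t) (mm d y z) = mm d (smul s y) (smul t z)"
    by (simp add: mm_smul_left mm_smul_right mult.commute)
  also have "\<dots> \<in> B" using s t by (intro B_mult)
  finally show "mm d y z \<in> Q"
    using s t scal_B_times by (intro Q_I[of _ "s * t"]) auto
qed

lemma Q_add: "y \<in> Q \<Longrightarrow> z \<in> Q \<Longrightarrow> y + z \<in> Q"
proof -
  assume yz: "y \<in> Q" "z \<in> Q"
  obtain s where s: "s \<noteq> 0" "scal d s \<in> B" "smul s y \<in> B" by (rule Q_E[OF yz(1)])
  obtain t where t: "t \<noteq> 0" "scal d t \<in> B" "smul t z \<in> B" by (rule Q_E[OF yz(2)])
  have "smul (s * t) (y + z) = smul t (smul s y) + smul s (smul t z)"
    by (simp add: smul_add mult.commute[of t s])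
  also have "\<dots> \<in> B"
    using scal_B_mult[OF t(2) s(3)] scal_B_mult[OF s(2) t(3)] by (rule B_add)
  finally show "y + z \<in> Q"
    using s t scal_B_times yz Q_fmats by (intro Q_I[of _ "s * t"]) auto
qed

lemma Q_uminus: "z \<in> Q \<Longrightarrow> - z \<in> Q"
proof -
  have "smul s (- z) = - smul s z" for s by (rule fm_eqI) simp
  then show "z \<in> Q \<Longrightarrow> - z \<in> Q"
    by (auto simp: Q_def B_uminus)
qed

lemma Q_domain: "y \<in> Q \<Longrightarrow> z \<in> Q \<Longrightarrow> mm d y z = 0 \<Longrightarrow> y = 0 \<or> z = 0"
proof -
  assume "y \<in> Q" "z \<in> Q" and 0: "mm d y z = 0"
  then obtain s t where s: "s \<noteq> 0" "smul s y \<in> B" and t: "t \<noteq> 0" "smul t z \<in> B"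
    by (auto simp: Q_def)
  have "mm d (smul s y) (smul t z) = 0" by (simp add: mm_smul_left mm_smul_right 0)
  then show "y = 0 \<or> z = 0"
    using B_domain[OF s(2) t(2)] s t by (auto simp: smul_eq_0_iff)
qed

lemma Q_scal_inverse: "scal d c \<in> Q \<Longrightarrow> c \<noteq> 0 \<Longrightarrow> scal d (inverse c) \<in> Q"
proof (elim Q_E)
  fix s assume s: "s \<noteq> 0" "scal d s \<in> B" "smul s (scal d c) \<in> B" and c: "c \<noteq> 0"
  have "s * c * inverse c = s" using c by simp
  then show "scal d (inverse c) \<in> Q"
    using s c by (intro Q_I[of _ "s * c"]) (simp_all only: scal_fmats smul_scal, auto)
qed

end

text \<open>The criterion for independence ranges over coefficient lists of every length; padding or
  truncating reduces it to lists of matching length.\<close>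

lemma (in ring) independent_if_trivial:
  assumes K: "subfield K R" and Us: "set Us \<subseteq> carrier R"
    and triv: "\<And>Ks. set Ks \<subseteq> K \<Longrightarrow> length Ks = length Us \<Longrightarrow> combine Ks Us = \<zero> \<Longrightarrow> set Ks \<subseteq> {\<zero>}"
  shows "independent K Us"
proof (rule trivial_combine_imp_independent[OF K Us])
  fix Ks assume Ks: "set Ks \<subseteq> K" "combine Ks Us = \<zero>"
  have "set Ks \<subseteq> carrier R" using Ks(1) subfieldE(3)[OF K] by blast
  from combine_normalize[OF this Us Ks(2)] obtain Ks' where Ks':
    "set (take (length Us) Ks) \<subseteq> set Ks'" "set Ks' \<subseteq> set (take (length Us) Ks) \<union> {\<zero>}"
    "length Ks' = length Us" "combine Ks' Us = \<zero>" .
  have "set (take (length Us) Ks) \<subseteq> K" using Ks(1) by (meson set_take_subset subset_trans)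
  then have "set Ks' \<subseteq> K" using Ks'(2) subringE(2)[OF subfieldE(1)[OF K]] by blast
  from triv[OF this Ks'(3,4)] show "set (take (length Us) Ks) \<subseteq> {\<zero>}" using Ks'(1) by blast
qed

lemma (in ring) independent_trivial:
  assumes "subfield K R" "independent K Us" "set Ks \<subseteq> K" "length Ks = length Us" "combine Ks Us = \<zero>"
  shows "set Ks \<subseteq> {\<zero>}"
  using independent_imp_trivial_combine[OF assms(1,2,3,5)] assms(4) by simp

section \<open>The ring of central quotients as a division ring\<close>

context matrix_domain
begin

definition QR :: "'f fm ring" where
  "QR = \<lparr>carrier = Q, monoid.mult = mm d, monoid.one = scal d 1, ring.zero = 0, ring.add = (+)\<rparr>"

lemma QR_simps [simp]:
  "carrier QR = Q" "monoid.mult QR = mm d" "monoid.one QR = scal d 1" "ring.zero QR = 0" "ring.add QR = (+)"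
  by (simp_all add: QR_def)

lemma ring_QR: "ring QR"
proof (rule ringI)
  show "abelian_group QR"
    by (rule abelian_groupI)
       (auto simp: Q_add B_Q B_zero ac_simps intro: Q_uminus exI[of _ "- _"] bexI[of _ "- _"])
  show "monoid QR"
    by (rule monoidI) (auto simp: Q_mult B_Q B_one Q_fmats mm_assoc)
qed (auto simp: mm_add_left mm_add_right)

lemma QR_a_inv: "z \<in> Q \<Longrightarrow> a_inv QR z = - z"
  using ring.ring_simprules(3) abelian_group.minus_equality[OF ring.is_abelian_group[OF ring_QR], of "- z" z] Q_uminus
  by simp

definition scalars :: "'f fm set" where
  "scalars = {scal d c |c. scal d c \<in> Q}"

lemma scalarsI: "scal d c \<in> Q \<Longrightarrow> scal d c \<in> scalars"
  by (auto simp: scalars_def)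

lemma scalars_subfield: "subfield scalars QR"
proof -
  interpret ring QR by (rule ring_QR)
  have sub: "subring scalars QR"
  proof (rule subringI)
    show "\<one>\<^bsub>QR\<^esub> \<in> scalars" using B_Q[OF B_one] by (auto simp: scalars_def)
    show "\<ominus>\<^bsub>QR\<^esub> h \<in> scalars" if "h \<in> scalars" for h
    proof -
      from that obtain c where "h = scal d c" "scal d c \<in> Q" by (auto simp: scalars_def)
      then show ?thesis using Q_uminus[of h] scalarsI[of "- c"] by (simp add: QR_a_inv scal_uminus)
    qed
    show "h1 \<otimes>\<^bsub>QR\<^esub> h2 \<in> scalars" if "h1 \<in> scalars" "h2 \<in> scalars" for h1 h2
    proof -
      from that obtain c e where "h1 = scal d c" "h2 = scal d e" "scal d c \<in> Q" "scal d e \<in> Q"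
        by (auto simp: scalars_def)
      then show ?thesis using Q_mult[of h1 h2] scalarsI[of "c * e"] by (simp add: mult.commute)
    qed
    show "h1 \<oplus>\<^bsub>QR\<^esub> h2 \<in> scalars" if "h1 \<in> scalars" "h2 \<in> scalars" for h1 h2
    proof -
      from that obtain c e where "h1 = scal d c" "h2 = scal d e" "scal d c \<in> Q" "scal d e \<in> Q"
        by (auto simp: scalars_def)
      then show ?thesis using Q_add[of h1 h2] scalarsI[of "c + e"] by (simp add: scal_add)
    qed
  qed (auto simp: scalars_def)
  show ?thesis
  proof (rule subfieldI)
    show "subcring scalars QR"
      by (rule subcringI[OF sub]) (auto simp: scalars_def mult.commute)
    show "Units (QR\<lparr>carrier := scalars\<rparr>) = scalars - {\<zero>\<^bsub>QR\<^esub>}"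
    proof (intro equalityI subsetI)
      fix u assume "u \<in> Units (QR\<lparr>carrier := scalars\<rparr>)"
      then obtain v where "u \<in> scalars" "mm d v u = scal d 1" by (auto simp: Units_def)
      then show "u \<in> scalars - {\<zero>\<^bsub>QR\<^esub>}"
        using scal_inject[OF d_pos, of 0 "1::'f"] by auto
    next
      fix u assume "u \<in> scalars - {\<zero>\<^bsub>QR\<^esub>}"
      then obtain c where uc: "u = scal d c" "scal d c \<in> Q" "u \<noteq> 0" by (auto simp: scalars_def)
      then have c: "u = scal d c" "scal d c \<in> Q" "c \<noteq> 0" by auto
      then show "u \<in> Units (QR\<lparr>carrier := scalars\<rparr>)"
        using Q_scal_inverse[OF c(2,3)]
        by (auto simp: Units_def intro!: scalarsI bexI[of _ "scal d (inverse c)"])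
    qed
  qed
qed

lemma combine_QR:
  assumes "\<And>a. a \<in> set is \<Longrightarrow> v a \<in> fmats d"
  shows "ring.combine QR (map (\<lambda>a. scal d (c a)) is) (map v is) = (\<Sum>a\<leftarrow>is. smul (c a) (v a))"
proof -
  interpret ring QR by (rule ring_QR)
  show ?thesis using assms by (induction "is") auto
qed

lemma combine_QR_upt:
  assumes "\<And>a. a < n \<Longrightarrow> v a \<in> fmats d"
  shows "ring.combine QR (map (\<lambda>a. scal d (c a)) [0..<n]) (map v [0..<n]) = (\<Sum>a<n. smul (c a) (v a))"
  using assms by (subst combine_QR) (auto simp: interv_sum_list_conv_sum_set_nat atLeast0LessThan)

lemma scalars_list:
  assumes "set ks \<subseteq> scalars" "length ks = n"
  obtains c where "ks = map (\<lambda>a. scal d (c a)) [0..<n]"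
proof
  show "ks = map (\<lambda>a. scal d (ent (ks ! a) 0 0)) [0..<n]"
  proof (rule nth_equalityI)
    fix i assume i: "i < length ks"
    then have "ks ! i \<in> scalars" using assms nth_mem by blast
    then show "ks ! i = map (\<lambda>a. scal d (ent (ks ! a) 0 0)) [0..<n] ! i"
      using i assms d_pos by (auto simp: scalars_def ent_scal)
  qed (use assms in simp)
qed

lemma independent_QR:
  assumes v: "\<And>a. a < n \<Longrightarrow> v a \<in> Q"
    and ind: "\<And>c a. (\<Sum>a<n. smul (c a) (v a)) = 0 \<Longrightarrow> a < n \<Longrightarrow> c a = 0"
  shows "ring.independent QR scalars (map v [0..<n])"
proof -
  interpret ring QR by (rule ring_QR)
  show ?thesis
  proof (rule independent_if_trivial[OF scalars_subfield])
    fix ks assume ks: "set ks \<subseteq> scalars" "length ks = length (map v [0..<n])"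
      and 0: "combine ks (map v [0..<n]) = \<zero>\<^bsub>QR\<^esub>"
    obtain c where c: "ks = map (\<lambda>a. scal d (c a)) [0..<n]"
      using scalars_list[OF ks(1)] ks(2) by auto
    have "(\<Sum>a<n. smul (c a) (v a)) = 0"
      using 0 v Q_fmats unfolding c by (subst (asm) combine_QR_upt) auto
    from ind[OF this] show "set ks \<subseteq> {\<zero>\<^bsub>QR\<^esub>}" unfolding c by auto
  qed (use v in auto)
qed

text \<open>By \<open>coord_Q\<close> an element of \<open>Q\<close> has its coordinates in
  \<open>Q\<close>, so a basis of all matrices over the ambient field is also a basis of
  \<open>Q\<close> over its scalars.\<close>

lemma dimension_QR: "ring.dimension QR N scalars Q"
proof -
  interpret ring QR by (rule ring_QR)
  have xQ: "x a \<in> Q" if "a < N" for a using that x_B B_Q by blast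
  have ind: "independent scalars (map x [0..<N])"
    using xQ x_indep by (rule independent_QR)
  have "Span scalars (map x [0..<N]) = Q"
  proof (intro equalityI subsetI)
    fix z assume "z \<in> Span scalars (map x [0..<N])"
    moreover have "scalars \<subseteq> carrier QR" "set (map x [0..<N]) \<subseteq> carrier QR"
      using xQ by (auto simp: scalars_def)
    ultimately have "z \<in> carrier QR" using Span_in_carrier by blast
    then show "z \<in> Q" by simp
  next
    fix z assume z: "z \<in> Q"
    have "set (map (\<lambda>a. scal d (coord a z)) [0..<N]) \<subseteq> scalars"
      using coord_Q[OF z] by (auto intro: scalarsI)
    moreover have "z = combine (map (\<lambda>a. scal d (coord a z)) [0..<N]) (map x [0..<N])"
      by (rule trans[OF coord_sum[OF Q_fmats[OF z]] combine_QR_upt[symmetric]]) (use xQ Q_fmats in auto)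
    ultimately show "z \<in> Span scalars (map x [0..<N])"
    proof -
      have "set (map x [0..<N]) \<subseteq> carrier QR" using xQ by auto
      note Span_eq_combine_set[OF scalars_subfield this]
      then show ?thesis using \<open>set _ \<subseteq> scalars\<close> \<open>z = combine _ _\<close> by blast
    qed
  qed
  then show ?thesis
    using dimensionI[OF scalars_subfield ind] by simp
qed

text \<open>Left multiplication by \<open>z\<close> is injective and linear over the scalars, so the
  elements \<open>z x a\<close> are again independent. By dimension they span \<open>Q\<close>, and
  1 is among their combinations.\<close>

lemma QR_right_inverse:
  assumes z: "z \<in> Q" "z \<noteq> 0"
  shows "\<exists>y\<in>Q. mm d z y = scal d 1"
proof -
  interpret ring QR by (rule ring_QR)
  define v where "v a = mm d z (x a)" for a
  have xQ: "x a \<in> Q" if "a < N" for a using that x_B B_Q by blast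
  have vQ: "v a \<in> Q" if "a < N" for a using that z xQ Q_mult by (simp add: v_def)
  have sum_v: "(\<Sum>a<N. smul (c a) (v a)) = mm d z (\<Sum>a<N. smul (c a) (x a))" for c
    by (simp add: v_def mm_sum_right mm_smul_right)
  have scalars_Q: "scal d (c a) \<in> Q"
    if "set (map (\<lambda>a. scal d (c a)) [0..<N]) \<subseteq> scalars" "a < N" for c a
  proof -
    have "scal d (c a) \<in> scalars" using that by auto
    then show ?thesis by (auto simp: scalars_def)
  qed
  have comb_Q: "(\<Sum>a<n. smul (c a) (x a)) \<in> Q" if "\<And>a. a < n \<Longrightarrow> scal d (c a) \<in> Q" "n \<le> N" for c n
    using that
  proof (induction n)
    case (Suc n)
    have "mm d (scal d (c n)) (x n) \<in> Q" using Suc.prems xQ by (intro Q_mult) auto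
    then have "smul (c n) (x n) \<in> Q" using xQ[of n] Q_fmats Suc.prems by simp
    then show ?case using Suc by (simp add: Q_add)
  qed (simp add: B_Q B_zero)
  have ind: "independent scalars (map v [0..<N])"
  proof (rule independent_if_trivial[OF scalars_subfield])
    fix ks assume ks: "set ks \<subseteq> scalars" "length ks = length (map v [0..<N])"
      and 0: "combine ks (map v [0..<N]) = \<zero>\<^bsub>QR\<^esub>"
    obtain c where c: "ks = map (\<lambda>a. scal d (c a)) [0..<N]"
      using scalars_list[OF ks(1)] ks(2) by auto
    have "combine ks (map v [0..<N]) = (\<Sum>a<N. smul (c a) (v a))"
      unfolding c by (rule combine_QR_upt) (use vQ Q_fmats in auto)
    with 0 have "(\<Sum>a<N. smul (c a) (v a)) = 0" by simp
    then have "mm d z (\<Sum>a<N. smul (c a) (x a)) = 0" by (simp only: sum_v)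
    moreover have "(\<Sum>a<N. smul (c a) (x a)) \<in> Q"
      by (rule comb_Q[OF scalars_Q[OF ks(1)[unfolded c]]]) auto
    ultimately have "(\<Sum>a<N. smul (c a) (x a)) = 0" using Q_domain z by blast
    from x_indep[OF this] show "set ks \<subseteq> {\<zero>\<^bsub>QR\<^esub>}" unfolding c by auto
  qed (use vQ in auto)
  have "Span scalars (map v [0..<N]) = Q"
  proof -
    have "set (map v [0..<N]) \<subseteq> Q" using vQ by auto
    from independent_length_eq_dimension[OF scalars_subfield dimension_QR ind this]
    show ?thesis by (simp del: Span.simps)
  qed
  then have "scal d 1 \<in> Span scalars (map v [0..<N])" using B_Q[OF B_one] by simp
  then obtain ks where ks: "set ks \<subseteq> scalars" "length ks = N" "scal d 1 = combine ks (map v [0..<N])"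
  proof -
    have "set (map v [0..<N]) \<subseteq> carrier QR" using vQ by auto
    note Span_mem_iff_length_version[OF scalars_subfield this, of "scal d 1"]
    then show ?thesis using \<open>scal d 1 \<in> Span _ _\<close> that by (metis length_map length_upt diff_zero)
  qed
  obtain c where c: "ks = map (\<lambda>a. scal d (c a)) [0..<N]"
    using scalars_list[OF ks(1,2)] by blast
  have "combine ks (map v [0..<N]) = (\<Sum>a<N. smul (c a) (v a))"
    unfolding c by (rule combine_QR_upt) (use vQ Q_fmats in auto)
  then have "scal d 1 = mm d z (\<Sum>a<N. smul (c a) (x a))"
    using ks(3) by (simp only: sum_v)
  moreover have "(\<Sum>a<N. smul (c a) (x a)) \<in> Q"
    by (rule comb_Q[OF scalars_Q[OF ks(1)[unfolded c]]]) auto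
  ultimately show ?thesis by (metis (no_types))
qed

lemma skew_field_QR: "skew_field QR"
  unfolding skew_field_def
proof (intro conjI ring_QR equalityI subsetI)
  have one_nz: "scal d 1 \<noteq> (0 :: 'f fm)" using scal_inject[OF d_pos, of 1 "0::'f"] by simp
  fix u
  show "u \<in> carrier QR - {\<zero>\<^bsub>QR\<^esub>}" if "u \<in> Units QR"
    using that one_nz by (auto simp: Units_def)
  show "u \<in> Units QR" if "u \<in> carrier QR - {\<zero>\<^bsub>QR\<^esub>}"
  proof -
    have u: "u \<in> Q" "u \<noteq> 0" using that by auto
    obtain y where y: "y \<in> Q" "mm d u y = scal d 1" using QR_right_inverse[OF u] by blast
    then have "y \<noteq> 0" using one_nz by auto
    then obtain z where z: "z \<in> Q" "mm d y z = scal d 1" using QR_right_inverse[OF y(1)] by blast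
    \<comment> \<open>From \<open>u y = 1 = y z\<close> the outer factors agree, so \<open>y\<close>
      is a two-sided inverse.\<close>
    have "u = mm d u (mm d y z)" using u Q_fmats by (simp add: z(2))
    also have "\<dots> = mm d (mm d u y) z" by (simp add: mm_assoc)
    also have "\<dots> = z" using z Q_fmats by (simp add: y(2))
    finally have "mm d y u = scal d 1" using z by simp
    then show ?thesis using u y by (auto simp: Units_def)
  qed
qed

text \<open>An element that commutes with the spanning family \<open>x\<close> commutes with every
  matrix and is therefore scalar.\<close>

lemma center_QR: "ring_center QR = scalars"
proof (intro equalityI subsetI)
  fix z assume "z \<in> ring_center QR"
  then have z: "z \<in> Q" and comm: "\<And>a. a \<in> Q \<Longrightarrow> mm d z a = mm d a z"
    by (auto simp: ring_center_def)
  have "mm d z y = mm d y z" if "y \<in> fmats d" for y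
  proof -
    have "mm d z (\<Sum>a<N. smul (coord a y) (x a)) = mm d (\<Sum>a<N. smul (coord a y) (x a)) z"
      using comm x_B B_Q by (simp add: mm_sum_left mm_sum_right mm_smul_left mm_smul_right)
    then show ?thesis by (simp only: coord_sum[OF that, symmetric])
  qed
  then have eq: "scal d (ent z 0 0) = z"
    by (intro scalar_if_central[symmetric] Q_fmats[OF z] d_pos) auto
  show "z \<in> scalars" using scalarsI[of "ent z 0 0", unfolded eq, OF z] .
next
  fix z assume "z \<in> scalars"
  then obtain c where "z = scal d c" "scal d c \<in> Q" by (auto simp: scalars_def)
  then show "z \<in> ring_center QR" using Q_fmats by (simp add: ring_center_def)
qed

end

section \<open>Division rings and Galois subfields\<close>

locale division_ring = ring R for R (structure) +
  assumes Units_eq: "Units R = carrier R - {\<zero>}"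
begin

lemma one_not_zero: "\<one> \<noteq> \<zero>"
  using Units_one_closed unfolding Units_eq by blast

lemma inv_nz [simp]: "a \<in> carrier R \<Longrightarrow> a \<noteq> \<zero> \<Longrightarrow> inv a \<in> carrier R"
  "a \<in> carrier R \<Longrightarrow> a \<noteq> \<zero> \<Longrightarrow> a \<otimes> inv a = \<one>"
  "a \<in> carrier R \<Longrightarrow> a \<noteq> \<zero> \<Longrightarrow> inv a \<otimes> a = \<one>"
  using Units_eq Units_inv_closed Units_r_inv Units_l_inv by blast+

lemma nz_divisors: "a \<in> carrier R \<Longrightarrow> b \<in> carrier R \<Longrightarrow> a \<otimes> b = \<zero> \<Longrightarrow> a = \<zero> \<or> b = \<zero>"
proof (rule ccontr)
  assume a: "a \<in> carrier R" "b \<in> carrier R" "a \<otimes> b = \<zero>" "\<not> (a = \<zero> \<or> b = \<zero>)"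
  from a(1,2,4) have "inv a \<otimes> (a \<otimes> b) = b" by (simp flip: m_assoc)
  then have "b = \<zero>" using a(1,3,4) r_null[of "inv a"] by auto
  then show False using a by simp
qed

definition centr :: "'a set \<Rightarrow> 'a set" where
  "centr S = {z \<in> carrier R. \<forall>s\<in>S. z \<otimes> s = s \<otimes> z}"

lemma centr_subring: "S \<subseteq> carrier R \<Longrightarrow> subring (centr S) R"
proof (rule subringI)
  assume S: "S \<subseteq> carrier R"
  show "h1 \<otimes> h2 \<in> centr S" if h: "h1 \<in> centr S" "h2 \<in> centr S" for h1 h2
  proof -
    have "h1 \<otimes> h2 \<otimes> s = s \<otimes> (h1 \<otimes> h2)" if s: "s \<in> S" for s
    proof -
      have "s \<in> carrier R" "h1 \<in> carrier R" "h2 \<in> carrier R" "h1 \<otimes> s = s \<otimes> h1" "h2 \<otimes> s = s \<otimes> h2"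
        using s h S by (auto simp: centr_def)
      then show ?thesis by (metis m_assoc)
    qed
    then show ?thesis using h by (auto simp: centr_def)
  qed
  show "\<ominus> h \<in> centr S" if "h \<in> centr S" for h
    using that S by (auto simp: centr_def l_minus r_minus subset_iff)
qed (auto simp: centr_def l_distr r_distr subset_iff)

lemma centr_inv: "S \<subseteq> carrier R \<Longrightarrow> z \<in> centr S \<Longrightarrow> z \<noteq> \<zero> \<Longrightarrow> inv z \<in> centr S"
proof -
  assume S: "S \<subseteq> carrier R" and z: "z \<in> centr S" "z \<noteq> \<zero>"
  have zc: "z \<in> carrier R" using z by (simp add: centr_def)
  have "inv z \<otimes> s = s \<otimes> inv z" if s: "s \<in> S" for s
  proof -
    have sc: "s \<in> carrier R" using s S by blast
    have "inv z \<otimes> s = inv z \<otimes> (s \<otimes> z) \<otimes> inv z" using zc sc z(2) by (simp add: m_assoc)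
    also have "s \<otimes> z = z \<otimes> s" using z s by (simp add: centr_def)
    also have "inv z \<otimes> (z \<otimes> s) \<otimes> inv z = s \<otimes> inv z" using zc sc z(2) by (simp flip: m_assoc)
    finally show ?thesis .
  qed
  then show ?thesis using zc z(2) by (simp add: centr_def)
qed

lemma subfield_if_inverse_closed:
  assumes S: "subring S R" and comm: "\<And>a b. a \<in> S \<Longrightarrow> b \<in> S \<Longrightarrow> a \<otimes> b = b \<otimes> a"
    and inv: "\<And>a. a \<in> S \<Longrightarrow> a \<noteq> \<zero> \<Longrightarrow> inv a \<in> S"
  shows "subfield S R"
proof (rule subfieldI)
  show "subcring S R" by (rule subcringI[OF S comm])
  have Sc: "S \<subseteq> carrier R" by (rule subringE(1)[OF S])
  show "Units (R\<lparr>carrier := S\<rparr>) = S - {\<zero>}"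
  proof (intro equalityI subsetI)
    fix u assume "u \<in> Units (R\<lparr>carrier := S\<rparr>)"
    then obtain v where v: "u \<in> S" "v \<in> S" "v \<otimes> u = \<one>" by (auto simp: Units_def)
    have "u \<noteq> \<zero>"
    proof
      assume "u = \<zero>"
      then have "\<one> = \<zero>" using v Sc by auto
      then show False using one_not_zero by simp
    qed
    then show "u \<in> S - {\<zero>}" using v by simp
  next
    fix u assume u: "u \<in> S - {\<zero>}"
    then have "u \<in> carrier R" "u \<noteq> \<zero>" using Sc by auto
    then have "inv u \<otimes> u = \<one>" "u \<otimes> inv u = \<one>" "inv u \<in> S" using inv u by auto
    then show "u \<in> Units (R\<lparr>carrier := S\<rparr>)"
      using u by (auto simp: Units_def intro!: bexI[of _ "inv u"])
  qed
qed

lemma center_eq_centr: "ring_center R = centr (carrier R)"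
  by (simp only: ring_center_def centr_def)

lemma center_subfield: "subfield (ring_center R) R"
  unfolding center_eq_centr
proof (rule subfield_if_inverse_closed)
  show "subring (centr (carrier R)) R" by (rule centr_subring) simp
  show "a \<otimes> b = b \<otimes> a" if "a \<in> centr (carrier R)" "b \<in> centr (carrier R)" for a b
    using that unfolding centr_def by blast
  show "inv a \<in> centr (carrier R)" if "a \<in> centr (carrier R)" "a \<noteq> \<zero>" for a
    by (rule centr_inv[OF _ that]) simp
qed

text \<open>If \<open>z\<close> centralizes \<open>K\<close>, then the double centralizer of \<open>K \<union> {z}\<close> is a subfield.\<close>

lemma maximal_subfield_centralizer:
  assumes K: "maximal_subfield K R" and z: "z \<in> carrier R" "\<And>k. k \<in> K \<Longrightarrow> z \<otimes> k = k \<otimes> z"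
  shows "z \<in> K"
proof -
  define S where "S = insert z K"
  have sf: "subfield K R" using K by (simp add: maximal_subfield_def)
  have Kc: "K \<subseteq> carrier R" and Kcomm: "\<And>a b. a \<in> K \<Longrightarrow> b \<in> K \<Longrightarrow> a \<otimes> b = b \<otimes> a"
    using subfieldE(3,4)[OF sf] by auto
  have Sc: "S \<subseteq> carrier R" using Kc z by (simp add: S_def)
  \<comment> \<open>\<open>S\<close> is commutative, so it lies in its own centralizer. Centralizers
    reverse inclusions; hence the double centralizer lies in the centralizer and is commutative as
    well.\<close>
  have S1: "S \<subseteq> centr S" using Sc Kcomm z by (auto simp: S_def centr_def)
  have Cc: "centr S \<subseteq> carrier R" by (auto simp: centr_def)
  have CC: "centr (centr S) \<subseteq> centr S" using S1 by (auto simp: centr_def)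
  have S2: "S \<subseteq> centr (centr S)" using Sc by (auto simp: centr_def)
  have "subfield (centr (centr S)) R"
  proof (rule subfield_if_inverse_closed)
    show "subring (centr (centr S)) R" by (rule centr_subring[OF Cc])
    show "a \<otimes> b = b \<otimes> a" if "a \<in> centr (centr S)" "b \<in> centr (centr S)" for a b
      using that CC by (auto simp: centr_def[of "centr S"])
    show "inv a \<in> centr (centr S)" if "a \<in> centr (centr S)" "a \<noteq> \<zero>" for a
      by (rule centr_inv[OF Cc that])
  qed
  moreover have "K \<subseteq> centr (centr S)" using S2 by (auto simp: S_def)
  ultimately have "centr (centr S) = K" using K by (auto simp: maximal_subfield_def)
  then show ?thesis using S2 by (auto simp: S_def)
qed

lemma combine_diff:
  "length cs = length us \<Longrightarrow> set cs \<subseteq> carrier R \<Longrightarrow> set us \<subseteq> carrier R \<Longrightarrow> (\<And>c. c \<in> set cs \<Longrightarrow> f c \<in> carrier R) \<Longrightarrow>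
   combine (map (\<lambda>c. c \<ominus> f c) cs) us = combine cs us \<ominus> combine (map f cs) us"
proof (induction cs us rule: list_induct2)
  case (Cons c cs u us)
  have cl: "c \<in> carrier R" "u \<in> carrier R" "f c \<in> carrier R" "combine cs us \<in> carrier R" "combine (map f cs) us \<in> carrier R"
    using Cons.prems by (auto intro!: combine_in_carrier)
  have "combine (map (\<lambda>c. c \<ominus> f c) (c # cs)) (u # us) = (c \<ominus> f c) \<otimes> u \<oplus> (combine cs us \<ominus> combine (map f cs) us)"
    using Cons by simp
  also have "\<dots> = (c \<otimes> u \<oplus> combine cs us) \<ominus> (f c \<otimes> u \<oplus> combine (map f cs) us)"
    using cl by (simp add: a_minus_def l_distr l_minus minus_add a_ac)
  finally show ?case by simp
qed (simp add: a_minus_def)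

text \<open>A common generalization of Artin's lemma (tests: automorphisms) and of the faithfulness of the action of
  \<open>R \<otimes> R\<^sup>o\<^sup>p\<close> (tests: right multiplications): take a relation whose first coefficient is 1 and subtract
  its images under the group \<open>A\<close>.\<close>

lemma independent_separation:
  assumes F: "subfield F R" and C: "subring C R" "\<And>c. c \<in> C \<Longrightarrow> c \<noteq> \<zero> \<Longrightarrow> inv c \<in> C"
    and tests: "\<And>f x. f \<in> T \<Longrightarrow> x \<in> V \<Longrightarrow> f x \<in> carrier R"
    and ident: "e \<in> T" "\<And>x. x \<in> V \<Longrightarrow> e x = x"
    and A: "\<And>\<alpha> c. \<alpha> \<in> A \<Longrightarrow> c \<in> C \<Longrightarrow> \<alpha> c \<in> C" "\<And>\<alpha>. \<alpha> \<in> A \<Longrightarrow> \<alpha> \<one> = \<one>"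
    and transform: "\<And>\<alpha> cs xs f. \<alpha> \<in> A \<Longrightarrow> set cs \<subseteq> C \<Longrightarrow> set xs \<subseteq> V \<Longrightarrow> f \<in> T \<Longrightarrow>
       (\<And>g. g \<in> T \<Longrightarrow> combine cs (map g xs) = \<zero>) \<Longrightarrow> combine (map \<alpha> cs) (map f xs) = \<zero>"
    and fixed: "\<And>c. c \<in> C \<Longrightarrow> (\<And>\<alpha>. \<alpha> \<in> A \<Longrightarrow> \<alpha> c = c) \<Longrightarrow> c \<in> F"
    and xs: "independent F xs" "set xs \<subseteq> V"
    and cs: "length cs = length xs" "set cs \<subseteq> C" "\<And>f. f \<in> T \<Longrightarrow> combine cs (map f xs) = \<zero>"
  shows "set cs \<subseteq> {\<zero>}"
  using xs cs
proof (induction xs arbitrary: cs rule: list.induct)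
  case Nil
  then show ?case by simp
next
  case (Cons x xs)
  obtain c cs0 where cs: "cs = c # cs0" using Cons.prems(3) by (cases cs) auto
  have Cc: "C \<subseteq> carrier R" by (rule subringE(1)[OF C(1)])
  have ind: "independent F xs" using Cons.prems(1) independent_backwards(2) by blast
  have c: "c \<in> C" "set cs0 \<subseteq> C" "length cs0 = length xs" using Cons.prems cs by auto
  have xX: "x \<in> V" "set xs \<subseteq> V" using Cons.prems by auto
  have fxs: "set (map f xs) \<subseteq> carrier R" if "f \<in> T" for f using xX tests that by auto
  show ?case
  proof (cases "c = \<zero>")
    case True
    have "set cs0 \<subseteq> {\<zero>}"
    proof (rule Cons.IH[OF ind xX(2) c(3,2)])
      fix f assume f: "f \<in> T"
      have "\<zero> \<otimes> f x \<oplus> combine cs0 (map f xs) = \<zero>" using Cons.prems(5)[OF f] cs True by simp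
      moreover have "combine cs0 (map f xs) \<in> carrier R" using c Cc fxs[OF f] by (intro combine_in_carrier) auto
      ultimately show "combine cs0 (map f xs) = \<zero>" using tests[OF f xX(1)] by simp
    qed
    then show ?thesis using cs True by simp
  next
    case False
    define ds where "ds = map ((\<otimes>) (inv c)) cs0"
    have ic: "inv c \<in> C" using C(2) c False by blast
    have ds: "set ds \<subseteq> C" "length ds = length xs"
      using c ic subringE(6)[OF C(1)] by (auto simp: ds_def)
    have one: "\<one> \<in> C" by (rule subringE(3)[OF C(1)])
    have rel: "combine (\<one> # ds) (map f (x # xs)) = \<zero>" if f: "f \<in> T" for f
    proof -
      have "combine (map ((\<otimes>) (inv c)) cs) (map f (x # xs)) = inv c \<otimes> combine cs (map f (x # xs))"
        using Cons.prems(4) Cc ic xX tests[OF f] by (intro combine_r_distr[symmetric]) auto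
      also have "\<dots> = \<zero>" using Cons.prems(5)[OF f] ic Cc by auto
      finally show ?thesis using c(1) Cc False by (auto simp: cs ds_def)
    qed
    have ds_F: "set ds \<subseteq> F"
    proof
      fix e assume e: "e \<in> set ds"
      show "e \<in> F"
      proof (rule fixed)
        show "e \<in> C" using e ds by blast
        fix \<alpha> assume \<alpha>: "\<alpha> \<in> A"
        \<comment> \<open>The first coefficient 1 is fixed by \<open>\<alpha>\<close> and cancels in
          the difference, which leaves a relation for the shorter list.\<close>
        have "set (map (\<lambda>c. c \<ominus> \<alpha> c) ds) \<subseteq> {\<zero>}"
        proof (rule Cons.IH[OF ind xX(2)])
          show "set (map (\<lambda>c. c \<ominus> \<alpha> c) ds) \<subseteq> C"
            using ds A(1)[OF \<alpha>] subringE(5,7)[OF C(1)] by (auto simp: a_minus_def)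
          fix f assume f: "f \<in> T"
          have "combine (map \<alpha> (\<one> # ds)) (map f (x # xs)) = \<zero>"
            using ds one xX by (intro transform[OF \<alpha> _ _ f] rel) auto
          then have 1: "f x \<oplus> combine (map \<alpha> ds) (map f xs) = \<zero>"
            using A(2)[OF \<alpha>] tests[OF f xX(1)] by simp
          have 2: "f x \<oplus> combine ds (map f xs) = \<zero>"
            using rel[OF f] tests[OF f xX(1)] by simp
          have \<alpha>ds: "\<alpha> c \<in> carrier R" if "c \<in> set ds" for c
            using that ds(1) A(1)[OF \<alpha>] Cc by blast
          have cl: "combine ds (map f xs) \<in> carrier R" "combine (map \<alpha> ds) (map f xs) \<in> carrier R"
            using ds(1) \<alpha>ds Cc fxs[OF f] by (auto intro!: combine_in_carrier)
          have eq: "combine ds (map f xs) = combine (map \<alpha> ds) (map f xs)"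
            using 1 2 cl tests[OF f xX(1)] by (metis add.l_cancel)
          have "combine (map (\<lambda>c. c \<ominus> \<alpha> c) ds) (map f xs) = combine ds (map f xs) \<ominus> combine (map \<alpha> ds) (map f xs)"
            using ds(1) \<alpha>ds Cc fxs[OF f] by (intro combine_diff) (auto simp: ds(2))
          then show "combine (map (\<lambda>c. c \<ominus> \<alpha> c) ds) (map f xs) = \<zero>"
            using cl by (simp add: eq a_minus_def r_neg)
        qed (use ds in simp)
        then have "e \<ominus> \<alpha> e = \<zero>" using e by auto
        moreover have "e \<in> carrier R" "\<alpha> e \<in> carrier R" using e ds A(1)[OF \<alpha>] Cc by auto
        ultimately show "\<alpha> e = e" by (simp add: r_right_minus_eq)
      qed
    qed
    have map_e: "map e (x # xs) = x # xs"
      using ident(2) xX by (intro map_idI) auto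
    \<comment> \<open>All coefficients now lie in \<open>F\<close>, and the identity test turns the
      relation into a linear one over \<open>F\<close> with a coefficient 1.\<close>
    have "set (\<one> # ds) \<subseteq> {\<zero>}"
    proof (rule independent_trivial[OF F Cons.prems(1)])
      show "set (\<one> # ds) \<subseteq> F" using ds_F subringE(3)[OF subfieldE(1)[OF F]] by simp
      show "combine (\<one> # ds) (x # xs) = \<zero>" using rel[OF ident(1)] unfolding map_e .
    qed (use ds in simp)
    then show ?thesis using one_not_zero by simp
  qed
qed

end

text \<open>\<open>K\<close> is its own centralizer, \<open>G\<close> a group of automorphisms with
  fixed field \<open>F\<close>, and \<open>xs\<close> a basis of \<open>K\<close> over
  \<open>F\<close>. Finiteness of \<open>G\<close> and the count
  \<open>[K : F] |G| = [R : F]\<close> will be conclusions.\<close>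

locale galois_subfield = division_ring R for R (structure) +
  fixes F K :: "'a set" and G :: "('a \<Rightarrow> 'a) set" and xs :: "'a list"
  assumes F_center: "F = ring_center R"
    and K_subfield: "subfield K R" and F_K: "F \<subseteq> K"
    and K_centralizer: "z \<in> carrier R \<Longrightarrow> (\<And>k. k \<in> K \<Longrightarrow> z \<otimes> k = k \<otimes> z) \<Longrightarrow> z \<in> K"
    and G_closed: "\<phi> \<in> G \<Longrightarrow> x \<in> K \<Longrightarrow> \<phi> x \<in> K"
    and G_mult: "\<phi> \<in> G \<Longrightarrow> x \<in> K \<Longrightarrow> y \<in> K \<Longrightarrow> \<phi> (x \<otimes> y) = \<phi> x \<otimes> \<phi> y"
    and G_add: "\<phi> \<in> G \<Longrightarrow> x \<in> K \<Longrightarrow> y \<in> K \<Longrightarrow> \<phi> (x \<oplus> y) = \<phi> x \<oplus> \<phi> y"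
    and G_one: "\<phi> \<in> G \<Longrightarrow> \<phi> \<one> = \<one>"
    and G_F: "\<phi> \<in> G \<Longrightarrow> x \<in> F \<Longrightarrow> \<phi> x = x"
    and G_ext: "\<phi> \<in> G \<Longrightarrow> \<tau> \<in> G \<Longrightarrow> (\<And>x. x \<in> K \<Longrightarrow> \<phi> x = \<tau> x) \<Longrightarrow> \<phi> = \<tau>"
    and G_id: "(\<lambda>x\<in>K. x) \<in> G"
    and G_comp: "\<phi> \<in> G \<Longrightarrow> \<tau> \<in> G \<Longrightarrow> compose K \<phi> \<tau> \<in> G"
    and G_inv: "\<phi> \<in> G \<Longrightarrow> \<exists>\<tau>\<in>G. \<forall>x\<in>K. \<phi> (\<tau> x) = x"
    and G_fixed: "x \<in> K \<Longrightarrow> (\<And>\<phi>. \<phi> \<in> G \<Longrightarrow> \<phi> x = x) \<Longrightarrow> x \<in> F"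
    and xs_basis: "independent F xs" "Span F xs = K" "set xs \<subseteq> K"
begin

lemma F_subfield: "subfield F R"
  unfolding F_center by (rule center_subfield)

lemma F_central: "f \<in> F \<Longrightarrow> z \<in> carrier R \<Longrightarrow> f \<otimes> z = z \<otimes> f"
  unfolding F_center ring_center_def by blast

lemma K_carrier [simp]: "k \<in> K \<Longrightarrow> k \<in> carrier R"
  using subfieldE(3)[OF K_subfield] by blast

lemma F_carrier [simp]: "k \<in> F \<Longrightarrow> k \<in> carrier R"
  using F_K K_carrier by blast

lemma K_comm: "a \<in> K \<Longrightarrow> b \<in> K \<Longrightarrow> a \<otimes> b = b \<otimes> a"
  using subfieldE(4)[OF K_subfield] by blast

lemma K_closed [simp]:
  "\<zero> \<in> K" "\<one> \<in> K" "a \<in> K \<Longrightarrow> b \<in> K \<Longrightarrow> a \<otimes> b \<in> K" "a \<in> K \<Longrightarrow> b \<in> K \<Longrightarrow> a \<oplus> b \<in> K"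
  "a \<in> K \<Longrightarrow> \<ominus> a \<in> K" "a \<in> K \<Longrightarrow> b \<in> K \<Longrightarrow> a \<ominus> b \<in> K"
  using subringE(2,3,5,6,7)[OF subfieldE(1)[OF K_subfield]] by (auto simp: a_minus_def)

lemma K_inv: "a \<in> K \<Longrightarrow> a \<noteq> \<zero> \<Longrightarrow> inv a \<in> K"
  using subfield_m_inv(1)[OF K_subfield] by blast

lemma G_zero: "\<phi> \<in> G \<Longrightarrow> \<phi> \<zero> = \<zero>"
proof -
  assume \<phi>: "\<phi> \<in> G"
  have "\<phi> \<zero> \<oplus> \<phi> \<zero> = \<phi> \<zero>" using G_add[OF \<phi>, of \<zero> \<zero>] by simp
  then show ?thesis using G_closed[OF \<phi>, of \<zero>] by (simp add: add.l_cancel_one)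
qed

lemma xs_carrier: "set xs \<subseteq> carrier R"
  using xs_basis(3) by auto

subsection \<open>\<open>F\<close>-linear tests\<close>

text \<open>Automorphisms of \<open>K\<close> and left multiplications by elements of
  \<open>R\<close> are both linear over \<open>F\<close>; treating them alike lets identities pass
  from the former to the latter.\<close>

definition flin :: "('a \<Rightarrow> 'a) \<Rightarrow> bool" where
  "flin f \<longleftrightarrow> (\<forall>x\<in>K. f x \<in> carrier R) \<and> (\<forall>x\<in>K. \<forall>y\<in>K. f (x \<oplus> y) = f x \<oplus> f y) \<and>
     (\<forall>l\<in>F. \<forall>x\<in>K. f (l \<otimes> x) = l \<otimes> f x)"

lemma flin_G: "\<phi> \<in> G \<Longrightarrow> flin \<phi>"
  using F_K by (auto simp: flin_def G_closed G_add G_mult G_F subset_iff)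

lemma flin_rmult: "z \<in> carrier R \<Longrightarrow> flin (\<lambda>x. z \<otimes> x)"
proof -
  assume z: "z \<in> carrier R"
  have "z \<otimes> (l \<otimes> x) = l \<otimes> (z \<otimes> x)" if "l \<in> F" "x \<in> K" for l x
  proof -
    have "z \<otimes> (l \<otimes> x) = (z \<otimes> l) \<otimes> x" using that z by (simp add: m_assoc)
    also have "z \<otimes> l = l \<otimes> z" using F_central[OF that(1) z] by simp
    finally show ?thesis using that z by (simp add: m_assoc)
  qed
  then show ?thesis using z by (auto simp: flin_def r_distr)
qed

lemma flin_zero: "flin f \<Longrightarrow> f \<zero> = \<zero>"
proof -
  assume f: "flin f"
  have "f \<zero> \<oplus> f \<zero> = f (\<zero> \<oplus> \<zero>)" "f \<zero> \<in> carrier R" using f unfolding flin_def by (metis K_closed(1))+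
  then show ?thesis by (simp add: add.l_cancel_one)
qed

lemma combine_K: "set cs \<subseteq> K \<Longrightarrow> set us \<subseteq> K \<Longrightarrow> combine cs us \<in> K"
  by (induction cs us rule: combine.induct) auto

lemma flin_combine:
  "flin f \<Longrightarrow> set ls \<subseteq> F \<Longrightarrow> set us \<subseteq> K \<Longrightarrow> f (combine ls us) = combine ls (map f us)"
proof (induction ls us rule: combine.induct)
  case (1 k Ks u Us)
  have "combine Ks Us \<in> K" "k \<otimes> u \<in> K" using 1 F_K by (auto intro!: combine_K)
  then show ?case using 1 by (simp add: flin_def)
qed (auto simp: flin_zero)

text \<open>The list \<open>cs\<close> stands for the tensor \<open>\<Sum> c \<otimes> x\<close> in
  \<open>K \<otimes> K\<close> over \<open>F\<close>, and \<open>\<theta> cs f\<close> applies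
  \<open>f\<close> to the second factor and multiplies.\<close>

definition \<theta> :: "'a list \<Rightarrow> ('a \<Rightarrow> 'a) \<Rightarrow> 'a" where
  "\<theta> cs f = combine cs (map f xs)"

definition vec :: "'a list \<Rightarrow> bool" where
  "vec cs \<longleftrightarrow> length cs = length xs \<and> set cs \<subseteq> K"

lemma flin_set: "flin f \<Longrightarrow> set us \<subseteq> K \<Longrightarrow> set (map f us) \<subseteq> carrier R"
  by (auto simp: flin_def)

lemma \<theta>_closed: "vec cs \<Longrightarrow> flin f \<Longrightarrow> \<theta> cs f \<in> carrier R"
  unfolding \<theta>_def vec_def using flin_set[OF _ xs_basis(3)] by (intro combine_in_carrier) (auto simp: subset_iff)

lemma \<theta>_K: "vec cs \<Longrightarrow> \<phi> \<in> G \<Longrightarrow> \<theta> cs \<phi> \<in> K"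
  unfolding \<theta>_def vec_def using xs_basis(3) G_closed by (intro combine_K) auto

lemma vec_scale: "vec cs \<Longrightarrow> k \<in> K \<Longrightarrow> \<exists>ds. vec ds \<and> (\<forall>f. flin f \<longrightarrow> \<theta> ds f = k \<otimes> \<theta> cs f)"
proof -
  assume cs: "vec cs" "k \<in> K"
  have "vec (map ((\<otimes>) k) cs)" using cs by (auto simp: vec_def)
  moreover have "\<theta> (map ((\<otimes>) k) cs) f = k \<otimes> \<theta> cs f" if "flin f" for f
    unfolding \<theta>_def using cs flin_set[OF that xs_basis(3)]
    by (intro combine_r_distr[symmetric]) (auto simp: vec_def)
  ultimately show ?thesis by blast
qed

lemma vec_add: "vec cs \<Longrightarrow> vec ds \<Longrightarrow> \<exists>es. vec es \<and> (\<forall>f. flin f \<longrightarrow> \<theta> es f = \<theta> cs f \<oplus> \<theta> ds f)"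
proof -
  assume cs: "vec cs" "vec ds"
  have "vec (map2 (\<oplus>) cs ds)"
  proof -
    have "a \<oplus> b \<in> K" if "(a, b) \<in> set (zip cs ds)" for a b
    proof -
      have "a \<in> set cs" "b \<in> set ds" using that by (auto dest: set_zip_leftD set_zip_rightD)
      then show ?thesis using cs by (intro K_closed) (auto simp: vec_def)
    qed
    then show ?thesis using cs by (auto simp: vec_def)
  qed
  moreover have "\<theta> (map2 (\<oplus>) cs ds) f = \<theta> cs f \<oplus> \<theta> ds f" if "flin f" for f
    unfolding \<theta>_def using cs flin_set[OF that xs_basis(3)]
    by (intro combine_add[symmetric]) (auto simp: vec_def)
  ultimately show ?thesis by blast
qed

lemma vec_diff: "vec cs \<Longrightarrow> vec ds \<Longrightarrow> \<exists>es. vec es \<and> (\<forall>f. flin f \<longrightarrow> \<theta> es f = \<theta> cs f \<ominus> \<theta> ds f)"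
proof -
  assume cs: "vec cs" "vec ds"
  obtain ds' where ds': "vec ds'" "\<And>f. flin f \<Longrightarrow> \<theta> ds' f = \<ominus> \<one> \<otimes> \<theta> ds f"
    using vec_scale[OF cs(2), of "\<ominus> \<one>"] by auto
  from vec_add[OF cs(1) ds'(1)] obtain es where "vec es" "\<And>f. flin f \<Longrightarrow> \<theta> es f = \<theta> cs f \<oplus> \<theta> ds' f"
    by blast
  then show ?thesis
    using ds' \<theta>_closed[OF cs(2)] by (auto simp: a_minus_def l_minus intro!: exI[of _ es])
qed

lemma vec_zero: "\<exists>ds. vec ds \<and> (\<forall>f. flin f \<longrightarrow> \<theta> ds f = \<zero>)"
proof -
  have "vec (replicate (length xs) \<zero>)" by (auto simp: vec_def)
  moreover have "\<theta> (replicate (length xs) \<zero>) f = \<zero>" if "flin f" for f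
    unfolding \<theta>_def using combine_replicate[OF flin_set[OF that xs_basis(3)]] by simp
  ultimately show ?thesis by blast
qed

text \<open>The tensor \<open>1 \<otimes> y\<close>, with \<open>y\<close> expanded in the basis
  \<open>xs\<close>.\<close>

lemma vec_point: "y \<in> K \<Longrightarrow> \<exists>ds. vec ds \<and> (\<forall>f. flin f \<longrightarrow> \<theta> ds f = f y)"
proof -
  assume "y \<in> K"
  then have "y \<in> Span F xs" using xs_basis(2) by simp
  then obtain ls where ls: "set ls \<subseteq> F" "length ls = length xs" "y = combine ls xs"
    using Span_mem_iff_length_version[OF F_subfield xs_carrier] by blast
  then have "vec ls" "\<And>f. flin f \<Longrightarrow> \<theta> ls f = f y"
    using F_K flin_combine xs_basis(3) by (auto simp: vec_def \<theta>_def)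
  then show ?thesis by blast
qed

lemma vec_combine:
  "set cs \<subseteq> K \<Longrightarrow> set ys \<subseteq> K \<Longrightarrow> \<exists>ds. vec ds \<and> (\<forall>f. flin f \<longrightarrow> \<theta> ds f = combine cs (map f ys))"
proof (induction cs ys rule: combine.induct)
  case (1 c cs y ys)
  obtain d1 where d1: "vec d1" "\<And>f. flin f \<Longrightarrow> \<theta> d1 f = combine cs (map f ys)" using 1 by auto
  obtain d2 where d2: "vec d2" "\<And>f. flin f \<Longrightarrow> \<theta> d2 f = f y" using vec_point[of y] 1 by auto
  obtain d3 where d3: "vec d3" "\<And>f. flin f \<Longrightarrow> \<theta> d3 f = c \<otimes> \<theta> d2 f" using vec_scale[OF d2(1), of c] 1 by auto
  obtain d4 where "vec d4" "\<And>f. flin f \<Longrightarrow> \<theta> d4 f = \<theta> d3 f \<oplus> \<theta> d1 f" using vec_add[OF d3(1) d1(1)] by blast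
  then show ?case using d1 d2 d3 by auto
qed (use vec_zero in auto)

text \<open>Multiplication by \<open>1 \<otimes> y\<close>. The products of \<open>y\<close> with
  the basis elements have to be expanded in the basis again, which \<open>vec_combine\<close>
  does.\<close>

lemma vec_rmult: "vec cs \<Longrightarrow> y \<in> K \<Longrightarrow> \<exists>ds. vec ds \<and> (\<forall>\<phi>\<in>G. \<theta> ds \<phi> = \<theta> cs \<phi> \<otimes> \<phi> y) \<and>
   (\<forall>z\<in>carrier R. \<theta> ds ((\<otimes>) z) = \<theta> cs ((\<otimes>) z) \<otimes> y)"
proof -
  assume cs: "vec cs" and y: "y \<in> K"
  obtain ds where ds: "vec ds" "\<And>f. flin f \<Longrightarrow> \<theta> ds f = combine cs (map f (map (\<lambda>x. x \<otimes> y) xs))"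
  proof -
    have "set cs \<subseteq> K" "set (map (\<lambda>x. x \<otimes> y) xs) \<subseteq> K" using cs y xs_basis(3) by (auto simp: vec_def)
    from vec_combine[OF this] show ?thesis using that by blast
  qed
  have csc: "set cs \<subseteq> carrier R" using cs by (auto simp: vec_def)
  have "\<theta> ds \<phi> = \<theta> cs \<phi> \<otimes> \<phi> y" if \<phi>: "\<phi> \<in> G" for \<phi>
  proof -
    have "map \<phi> (map (\<lambda>x. x \<otimes> y) xs) = map (\<lambda>u. u \<otimes> \<phi> y) (map \<phi> xs)"
      using G_mult[OF \<phi>] y xs_basis(3) by auto
    then have "\<theta> ds \<phi> = combine cs (map (\<lambda>u. u \<otimes> \<phi> y) (map \<phi> xs))"
      by (simp only: ds(2)[OF flin_G[OF \<phi>]])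
    also have "\<dots> = \<theta> cs \<phi> \<otimes> \<phi> y"
      unfolding \<theta>_def using csc flin_set[OF flin_G[OF \<phi>] xs_basis(3)] G_closed[OF \<phi> y]
      by (intro combine_l_distr[symmetric]) auto
    finally show ?thesis .
  qed
  moreover have "\<theta> ds ((\<otimes>) z) = \<theta> cs ((\<otimes>) z) \<otimes> y" if z: "z \<in> carrier R" for z
  proof -
    have "map ((\<otimes>) z) (map (\<lambda>x. x \<otimes> y) xs) = map (\<lambda>u. u \<otimes> y) (map ((\<otimes>) z) xs)"
      using y xs_basis(3) z by (auto simp: m_assoc)
    then have "\<theta> ds ((\<otimes>) z) = combine cs (map (\<lambda>u. u \<otimes> y) (map ((\<otimes>) z) xs))"
      using ds(2)[OF flin_rmult[OF z]] by (simp only:)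
    also have "\<dots> = \<theta> cs ((\<otimes>) z) \<otimes> y"
      unfolding \<theta>_def using csc flin_set[OF flin_rmult[OF z] xs_basis(3)] y
      by (intro combine_l_distr[symmetric]) auto
    finally show ?thesis .
  qed
  ultimately show ?thesis using ds(1) by blast
qed

subsection \<open>Artin's lemma and faithfulness\<close>

lemma G_combine:
  "\<phi> \<in> G \<Longrightarrow> set cs \<subseteq> K \<Longrightarrow> set us \<subseteq> K \<Longrightarrow> \<phi> (combine cs us) = combine (map \<phi> cs) (map \<phi> us)"
  by (induction cs us rule: combine.induct) (auto simp: G_add G_mult combine_K G_zero)

lemma artin:
  assumes "independent F us" "set us \<subseteq> K" "length cs = length us" "set cs \<subseteq> K"
    and "\<And>\<phi>. \<phi> \<in> G \<Longrightarrow> combine cs (map \<phi> us) = \<zero>"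
  shows "set cs \<subseteq> {\<zero>}"
proof (rule independent_separation[where V = K and A = G and T = G and C = K and e = "\<lambda>x\<in>K. x",
      OF F_subfield subfieldE(1)[OF K_subfield] K_inv _ G_id])
  fix \<alpha> cs ys \<phi>
  assume \<alpha>: "\<alpha> \<in> G" and cs: "set cs \<subseteq> K" "set ys \<subseteq> K" and \<phi>: "\<phi> \<in> G"
    and rel: "\<And>g. g \<in> G \<Longrightarrow> combine cs (map g ys) = \<zero>"
  \<comment> \<open>On \<open>K\<close> the test \<open>\<phi>\<close> is \<open>\<alpha>\<close>
    after \<open>\<beta> \<phi>\<close>, so the transformed relation is the image under
    \<open>\<alpha>\<close> of the relation tested with \<open>\<beta> \<phi>\<close>.\<close>
  obtain \<beta> where \<beta>: "\<beta> \<in> G" "\<And>x. x \<in> K \<Longrightarrow> \<alpha> (\<beta> x) = x" using G_inv[OF \<alpha>] by blast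
  have "map \<phi> ys = map \<alpha> (map (compose K \<beta> \<phi>) ys)"
    using cs(2) \<beta>(2) G_closed[OF \<phi>] by (auto simp: compose_def)
  moreover have "set (map (compose K \<beta> \<phi>) ys) \<subseteq> K"
    using cs(2) G_closed[OF G_comp[OF \<beta>(1) \<phi>]] by auto
  ultimately have "combine (map \<alpha> cs) (map \<phi> ys) = \<alpha> (combine cs (map (compose K \<beta> \<phi>) ys))"
    using G_combine[OF \<alpha> cs(1)] by metis
  then show "combine (map \<alpha> cs) (map \<phi> ys) = \<zero>"
    using rel[OF G_comp[OF \<beta>(1) \<phi>]] G_zero[OF \<alpha>] by simp
qed (use assms G_closed G_one G_fixed in auto)

text \<open>Here the acting group consists of the inner automorphisms, whose common fixed elements
  form the center \<open>F\<close>. The coefficients are allowed to range over all of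
  \<open>R\<close>, because conjugation leaves \<open>K\<close>.\<close>

lemma faithful:
  assumes cs: "vec cs" and zero: "\<And>z. z \<in> carrier R \<Longrightarrow> \<theta> cs ((\<otimes>) z) = \<zero>"
  shows "set cs \<subseteq> {\<zero>}"
proof (rule independent_separation[where V = K and A = "(\<lambda>a c. inv a \<otimes> c \<otimes> a) ` (carrier R - {\<zero>})" and
      T = "(\<lambda>z. (\<otimes>) z) ` carrier R" and C = "carrier R" and e = "(\<otimes>) \<one>", OF F_subfield carrier_is_subring])
  fix \<alpha> cs ys f
  assume "\<alpha> \<in> (\<lambda>a c. inv a \<otimes> c \<otimes> a) ` (carrier R - {\<zero>})" and cs: "set cs \<subseteq> carrier R" "set ys \<subseteq> K"
    and "f \<in> (\<lambda>z. (\<otimes>) z) ` carrier R"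
    and rel: "\<And>g. g \<in> (\<lambda>z. (\<otimes>) z) ` carrier R \<Longrightarrow> combine cs (map g ys) = \<zero>"
  then obtain a z where a: "a \<in> carrier R" "a \<noteq> \<zero>" "\<alpha> = (\<lambda>c. inv a \<otimes> c \<otimes> a)" and z: "z \<in> carrier R" "f = (\<otimes>) z"
    by auto
  \<comment> \<open>Conjugating the coefficients by \<open>a\<close> amounts to testing with
    \<open>a z\<close> and removing the factor \<open>a\<close> on the left.\<close>
  have "combine (map \<alpha> cs) (map f ys) = inv a \<otimes> combine cs (map ((\<otimes>) (a \<otimes> z)) ys)"
    using cs
  proof (induction cs ys rule: combine.induct)
    case (1 c cs y ys)
    have "y' \<in> carrier R" if "y' \<in> set ys" for y' using that 1 K_carrier by auto
    then have cl: "c \<in> carrier R" "y \<in> carrier R" "combine cs (map ((\<otimes>) (a \<otimes> z)) ys) \<in> carrier R"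
      using 1 a z K_carrier by (auto intro!: combine_in_carrier m_closed)
    then show ?case using 1 a z by (simp add: r_distr m_assoc)
  qed (use a in auto)
  then show "combine (map \<alpha> cs) (map f ys) = \<zero>"
    using rel[of "(\<otimes>) (a \<otimes> z)"] a z by auto
next
  fix c assume c: "c \<in> carrier R"
    and fixed: "\<And>\<alpha>. \<alpha> \<in> (\<lambda>a c. inv a \<otimes> c \<otimes> a) ` (carrier R - {\<zero>}) \<Longrightarrow> \<alpha> c = c"
  have "c \<otimes> a = a \<otimes> c" if a: "a \<in> carrier R" for a
  proof (cases "a = \<zero>")
    case False
    have "a \<otimes> (inv a \<otimes> c \<otimes> a) = a \<otimes> c" using fixed[of "\<lambda>c. inv a \<otimes> c \<otimes> a"] a False by auto
    moreover have "a \<otimes> (inv a \<otimes> c \<otimes> a) = c \<otimes> a" using a c False by (simp flip: m_assoc)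
    ultimately show ?thesis by simp
  qed (use c in simp)
  then show "c \<in> F" unfolding F_center ring_center_def using c by blast
next
  fix \<alpha> assume "\<alpha> \<in> (\<lambda>a c. inv a \<otimes> c \<otimes> a) ` (carrier R - {\<zero>})"
  then obtain a where "a \<in> carrier R" "a \<noteq> \<zero>" "\<alpha> = (\<lambda>c. inv a \<otimes> c \<otimes> a)" by blast
  then show "\<alpha> \<one> = \<one>" by simp
qed (use xs_basis(1,3) cs zero in \<open>auto simp: vec_def \<theta>_def\<close>)

end

lemma (in ring) combine_map2_diff:
  "length cs = length ds \<Longrightarrow> length ds = length us \<Longrightarrow> set cs \<subseteq> carrier R \<Longrightarrow> set ds \<subseteq> carrier R \<Longrightarrow>
   set us \<subseteq> carrier R \<Longrightarrow> c \<in> carrier R \<Longrightarrow>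
   combine (map2 (\<lambda>a b. a \<ominus> c \<otimes> b) cs ds) us = combine cs us \<ominus> c \<otimes> combine ds us"
proof (induction cs ds us rule: list_induct3)
  case (Cons a as b bs u us)
  have cl: "combine as us \<in> carrier R" "combine bs us \<in> carrier R"
    using Cons.prems by (auto intro!: combine_in_carrier)
  have IH: "combine (map2 (\<lambda>a b. a \<ominus> c \<otimes> b) as bs) us = combine as us \<ominus> c \<otimes> combine bs us"
    using Cons by simp
  have "combine (map2 (\<lambda>a b. a \<ominus> c \<otimes> b) (a # as) (b # bs)) (u # us)
      = (a \<ominus> c \<otimes> b) \<otimes> u \<oplus> (combine as us \<ominus> c \<otimes> combine bs us)"
    using IH by simp
  also have "\<dots> = (a \<otimes> u \<oplus> combine as us) \<ominus> c \<otimes> (b \<otimes> u \<oplus> combine bs us)"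
    using Cons.prems cl by (simp add: a_minus_def l_distr r_distr l_minus m_assoc minus_add a_ac)
  finally show ?case by simp
qed (simp add: a_minus_def)

lemma (in ring) add_eq_zeroD: "a \<in> carrier R \<Longrightarrow> b \<in> carrier R \<Longrightarrow> a \<oplus> b = \<zero> \<Longrightarrow> b = \<ominus> a"
  using minus_equality[of b a] by (simp add: a_comm)

section \<open>Finite separating sets and interpolation\<close>

context galois_subfield
begin

text \<open>Each new basis element requires at most one further automorphism: by induction a
  relation with first coefficient 1 is unique, so one automorphism that violates it excludes all
  relations.\<close>

lemma finite_artin:
  "independent F us \<Longrightarrow> set us \<subseteq> K \<Longrightarrow> \<exists>S. finite S \<and> S \<subseteq> G \<and>
    (\<forall>cs. length cs = length us \<and> set cs \<subseteq> K \<and> (\<forall>\<phi>\<in>S. combine cs (map \<phi> us) = \<zero>) \<longrightarrow> set cs \<subseteq> {\<zero>})"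
proof (induction us rule: list.induct)
  case Nil
  show ?case by (intro exI[of _ "{}"]) auto
next
  case (Cons x us)
  have ind: "independent F us" using Cons.prems(1) independent_backwards(2) by blast
  have uK: "set us \<subseteq> K" "x \<in> K" using Cons.prems by auto
  from Cons.IH[OF ind uK(1)] obtain S where S: "finite S" "S \<subseteq> G" and art':
    "\<forall>cs. length cs = length us \<and> set cs \<subseteq> K \<and> (\<forall>\<phi>\<in>S. combine cs (map \<phi> us) = \<zero>) \<longrightarrow> set cs \<subseteq> {\<zero>}"
    by (elim exE conjE)
  have art: "set cs \<subseteq> {\<zero>}" if "length cs = length us" "set cs \<subseteq> K" "\<And>\<phi>. \<phi> \<in> S \<Longrightarrow> combine cs (map \<phi> us) = \<zero>" for cs
    using art'[rule_format, of cs] that by blast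
  have img: "set (map \<phi> us) \<subseteq> carrier R" "\<phi> x \<in> carrier R" if "\<phi> \<in> G" for \<phi>
    using flin_set[OF flin_G[OF that]] uK G_closed[OF that] by auto
  have cc: "combine cs (map \<phi> us) \<in> carrier R" if "\<phi> \<in> G" "set cs \<subseteq> K" for \<phi> cs
  proof (rule combine_in_carrier)
    show "set cs \<subseteq> carrier R" using that(2) by auto
  qed (use img(1)[OF that(1)] in simp)
  show ?case
  proof (cases "\<exists>ds. length ds = length us \<and> set ds \<subseteq> K \<and> (\<forall>\<phi>\<in>S. \<phi> x \<oplus> combine ds (map \<phi> us) = \<zero>)")
    \<comment> \<open>A nonzero first coefficient could be divided out, so it must vanish and
      \<open>S\<close> already suffices.\<close>
    case False
    have "set cs \<subseteq> {\<zero>}" if cs: "length cs = length (x # us)" "set cs \<subseteq> K" "\<And>\<phi>. \<phi> \<in> S \<Longrightarrow> combine cs (map \<phi> (x # us)) = \<zero>" for cs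
    proof -
      obtain c cs0 where c: "cs = c # cs0" using cs(1) by (cases cs) auto
      have cK: "c \<in> K" "set cs0 \<subseteq> K" "length cs0 = length us" using cs c by auto
      have "c = \<zero>"
      proof (rule ccontr)
        assume nz: "c \<noteq> \<zero>"
        let ?ds = "map ((\<otimes>) (inv c)) cs0"
        have "\<phi> x \<oplus> combine ?ds (map \<phi> us) = \<zero>" if \<phi>: "\<phi> \<in> S" for \<phi>
        proof -
          have \<phi>G: "\<phi> \<in> G" using \<phi> S by blast
          have "combine (map ((\<otimes>) (inv c)) cs) (map \<phi> (x # us)) = inv c \<otimes> combine cs (map \<phi> (x # us))"
          proof (rule combine_r_distr[symmetric])
            show "set cs \<subseteq> carrier R" using cs(2) by auto
            show "set (map \<phi> (x # us)) \<subseteq> carrier R" using img[OF \<phi>G] by simp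
            show "inv c \<in> carrier R" using cK nz by simp
          qed
          then show ?thesis using cs(3)[OF \<phi>] img[OF \<phi>G] cK nz by (simp add: c)
        qed
        moreover have "set ?ds \<subseteq> K" using cK K_inv[OF cK(1) nz] by auto
        moreover have "length ?ds = length us" using cK(3) by simp
        ultimately show False using False by blast
      qed
      have "set cs0 \<subseteq> {\<zero>}"
      proof (rule art[OF cK(3,2)])
        fix \<phi> assume "\<phi> \<in> S"
        then show "combine cs0 (map \<phi> us) = \<zero>"
          using cs(3)[of \<phi>] img[of \<phi>] cc[of \<phi> cs0] cK S \<open>c = \<zero>\<close> by (auto simp: c)
      qed
      then show ?thesis using c \<open>c = \<zero>\<close> by simp
    qed
    note sep = this
    show ?thesis
    proof (intro exI[of _ S] conjI allI impI)
      fix cs assume "length cs = length (x # us) \<and> set cs \<subseteq> K \<and> (\<forall>\<phi>\<in>S. combine cs (map \<phi> (x # us)) = \<zero>)"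
      then show "set cs \<subseteq> {\<zero>}" by (elim conjE) (rule sep, assumption, assumption, erule (1) bspec)
    qed (use S in simp_all)
  next
    case True
    then obtain ds where ds: "length ds = length us" "set ds \<subseteq> K"
      and rel: "\<And>\<phi>. \<phi> \<in> S \<Longrightarrow> \<phi> x \<oplus> combine ds (map \<phi> us) = \<zero>" by blast
    \<comment> \<open>The relation cannot hold for all of \<open>G\<close>, by Artin's
      lemma.\<close>
    have "\<exists>\<psi>\<in>G. \<psi> x \<oplus> combine ds (map \<psi> us) \<noteq> \<zero>"
    proof (rule ccontr)
      assume "\<not> ?thesis"
      then have "combine (\<one> # ds) (map \<phi> (x # us)) = \<zero>" if "\<phi> \<in> G" for \<phi>
        using that img[OF that] by auto
      from artin[OF Cons.prems(1,2) _ _ this] have "set (\<one> # ds) \<subseteq> {\<zero>}" using ds by auto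
      then show False using one_not_zero by simp
    qed
    then obtain \<psi> where \<psi>: "\<psi> \<in> G" "\<psi> x \<oplus> combine ds (map \<psi> us) \<noteq> \<zero>" by blast
    have "set cs \<subseteq> {\<zero>}" if cs: "length cs = length (x # us)" "set cs \<subseteq> K"
      "\<And>\<phi>. \<phi> \<in> insert \<psi> S \<Longrightarrow> combine cs (map \<phi> (x # us)) = \<zero>" for cs
    proof -
      obtain c cs0 where c: "cs = c # cs0" using cs(1) by (cases cs) auto
      have cK: "c \<in> K" "set cs0 \<subseteq> K" "length cs0 = length us" using cs c by auto
      have rel': "c \<otimes> \<phi> x \<oplus> combine cs0 (map \<phi> us) = \<zero>" if "\<phi> \<in> insert \<psi> S" for \<phi>
        using cs(3)[OF that] by (simp add: c)
      \<comment> \<open>Subtracting \<open>c\<close> times the known relation removes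
        \<open>x\<close>. By induction the difference is zero, so \<open>cs\<close> is
        \<open>c\<close> times \<open>(1, ds)\<close>, and \<open>\<psi>\<close> forces
        \<open>c = 0\<close>.\<close>
      define es where "es = map2 (\<lambda>a b. a \<ominus> c \<otimes> b) cs0 ds"
      have sets: "set cs0 \<subseteq> carrier R" "set ds \<subseteq> carrier R" using cK ds by auto
      have es: "combine es (map \<phi> us) = combine cs0 (map \<phi> us) \<ominus> c \<otimes> combine ds (map \<phi> us)" if "\<phi> \<in> G" for \<phi>
        unfolding es_def using cK ds img[OF that] sets by (intro combine_map2_diff) auto
      have esK: "set es \<subseteq> K"
      proof -
        have "a \<ominus> c \<otimes> b \<in> K" if "(a, b) \<in> set (zip cs0 ds)" for a b
        proof -
          have "a \<in> set cs0" "b \<in> set ds" using that by (auto dest: set_zip_leftD set_zip_rightD)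
          then show ?thesis using cK ds by (intro K_closed) auto
        qed
        then show ?thesis by (auto simp: es_def)
      qed
      have zero: "set es \<subseteq> {\<zero>}"
      proof (rule art[OF _ esK])
        show "length es = length us" using cK ds by (simp add: es_def)
        fix \<phi> assume \<phi>: "\<phi> \<in> S"
        then have \<phi>G: "\<phi> \<in> G" using S by blast
        have cl: "combine cs0 (map \<phi> us) \<in> carrier R" "combine ds (map \<phi> us) \<in> carrier R" "\<phi> x \<in> carrier R" "c \<in> carrier R"
          using cc[OF \<phi>G] cK ds img[OF \<phi>G] by auto
        have "combine ds (map \<phi> us) = \<ominus> \<phi> x"
          using add_eq_zeroD[OF cl(3,2) rel[OF \<phi>]] .
        moreover have "combine cs0 (map \<phi> us) = \<ominus> (c \<otimes> \<phi> x)"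
          using add_eq_zeroD[OF m_closed[OF cl(4,3)] cl(1) rel'[of \<phi>]] \<phi> by simp
        ultimately show "combine es (map \<phi> us) = \<zero>"
          using es[OF \<phi>G] cl by (simp add: r_minus a_minus_def l_neg)
      qed
      have cl: "combine cs0 (map \<psi> us) \<in> carrier R" "combine ds (map \<psi> us) \<in> carrier R" "\<psi> x \<in> carrier R" "c \<in> carrier R"
        using cc[OF \<psi>(1)] cK ds img[OF \<psi>(1)] by auto
      have "combine es (map \<psi> us) = \<zero>"
      proof -
        have "combine es vs = \<zero>" if "set es \<subseteq> {\<zero>}" "set vs \<subseteq> carrier R" for es vs
          using that by (induction es vs rule: combine.induct) auto
        then show ?thesis using zero img[OF \<psi>(1)] by blast
      qed
      then have "combine cs0 (map \<psi> us) = c \<otimes> combine ds (map \<psi> us)"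
        using es[OF \<psi>(1)] cl by (simp add: r_right_minus_eq)
      then have "c \<otimes> (\<psi> x \<oplus> combine ds (map \<psi> us)) = \<zero>"
        using rel'[of \<psi>] cl by (simp add: r_distr)
      then have c0: "c = \<zero>" using nz_divisors[of c] \<psi>(2) cl by blast
      have "set cs0 \<subseteq> {\<zero>}"
      proof (rule art[OF cK(3,2)])
        fix \<phi> assume "\<phi> \<in> S"
        then show "combine cs0 (map \<phi> us) = \<zero>"
          using rel'[of \<phi>] img[of \<phi>] cc[of \<phi> cs0] cK S c0 by auto
      qed
      then show ?thesis using c c0 by simp
    qed
    note sep = this
    show ?thesis
    proof (intro exI[of _ "insert \<psi> S"] conjI allI impI)
      fix cs assume "length cs = length (x # us) \<and> set cs \<subseteq> K \<and> (\<forall>\<phi>\<in>insert \<psi> S. combine cs (map \<phi> (x # us)) = \<zero>)"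
      then show "set cs \<subseteq> {\<zero>}" by (elim conjE) (rule sep, assumption, assumption, erule (1) bspec)
    qed (use S \<psi>(1) in simp_all)
  qed
qed

text \<open>Lagrange interpolation in \<open>K \<otimes> K\<close>: the factor \<open>(1 \<otimes> y
  - \<psi> y \<otimes> 1) / (\<phi> y - \<psi> y)\<close> vanishes at \<open>\<psi>\<close> and is 1
  at \<open>\<phi>\<close>, where \<open>y\<close> is any element on which the two automorphisms
  differ.\<close>

lemma interpolation:
  "finite S \<Longrightarrow> S \<subseteq> G \<Longrightarrow> \<phi> \<in> G \<Longrightarrow> \<exists>cs. vec cs \<and> \<theta> cs \<phi> = \<one> \<and> (\<forall>\<psi>\<in>S - {\<phi>}. \<theta> cs \<psi> = \<zero>)"
proof (induction S rule: finite_induct)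
  case empty
  obtain cs where "vec cs" "\<And>f. flin f \<Longrightarrow> \<theta> cs f = f \<one>" using vec_point[of \<one>] by auto
  then show ?case using G_one[OF empty.prems(2)] flin_G[OF empty.prems(2)] by auto
next
  case (insert \<psi> S)
  then obtain cs where cs: "vec cs" "\<theta> cs \<phi> = \<one>" "\<And>\<psi>. \<psi> \<in> S - {\<phi>} \<Longrightarrow> \<theta> cs \<psi> = \<zero>" by auto
  show ?case
  proof (cases "\<psi> = \<phi>")
    case True
    then show ?thesis using cs by auto
  next
    case False
    have G: "\<psi> \<in> G" "\<phi> \<in> G" "S \<subseteq> G" using insert.prems by auto
    obtain y where y: "y \<in> K" "\<psi> y \<noteq> \<phi> y" using G_ext[OF G(1,2)] False by blast
    have yK: "\<psi> y \<in> K" "\<phi> y \<in> K" using G_closed G y by auto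
    define a where "a = inv (\<phi> y \<ominus> \<psi> y)"
    have nz: "\<phi> y \<ominus> \<psi> y \<noteq> \<zero>" using y yK by (auto simp: r_right_minus_eq)
    have aK: "a \<in> K" unfolding a_def using yK nz by (intro K_inv) auto
    obtain d1 where d1: "vec d1" "\<And>\<chi>. \<chi> \<in> G \<Longrightarrow> \<theta> d1 \<chi> = \<theta> cs \<chi> \<otimes> \<chi> y"
      using vec_rmult[OF cs(1) y(1)] by blast
    obtain d2 where d2: "vec d2" "\<And>f. flin f \<Longrightarrow> \<theta> d2 f = \<psi> y \<otimes> \<theta> cs f"
      using vec_scale[OF cs(1) yK(1)] by blast
    obtain d3 where d3: "vec d3" "\<And>f. flin f \<Longrightarrow> \<theta> d3 f = \<theta> d1 f \<ominus> \<theta> d2 f"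
      using vec_diff[OF d1(1) d2(1)] by blast
    obtain d4 where d4: "vec d4" "\<And>f. flin f \<Longrightarrow> \<theta> d4 f = a \<otimes> \<theta> d3 f"
      using vec_scale[OF d3(1) aK] by blast
    have val: "\<theta> d4 \<chi> = a \<otimes> (\<theta> cs \<chi> \<otimes> \<chi> y \<ominus> \<psi> y \<otimes> \<theta> cs \<chi>)" if "\<chi> \<in> G" for \<chi>
      using d1(2)[OF that] d2(2) d3(2) d4(2) flin_G[OF that] by simp
    have "\<theta> d4 \<phi> = \<one>"
      using val[OF G(2)] cs(2) yK nz by (simp add: a_def)
    moreover have "\<theta> d4 \<psi> = \<zero>"
      using val[OF G(1)] K_comm[OF yK(1) \<theta>_K[OF cs(1) G(1)]] yK \<theta>_K[OF cs(1) G(1)] aK by (simp add: a_minus_def r_neg)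
    moreover have "\<theta> d4 \<chi> = \<zero>" if \<chi>: "\<chi> \<in> S - {\<phi>}" for \<chi>
    proof -
      have \<chi>G: "\<chi> \<in> G" using \<chi> G by auto
      show ?thesis
        using val[OF \<chi>G] cs(3)[OF \<chi>] yK aK G_closed[OF \<chi>G y(1)] by (simp add: a_minus_def)
    qed
    ultimately show ?thesis using d4(1) by (intro exI[of _ d4]) auto
  qed
qed

end

text \<open>\<open>S\<close> will turn out to be all of \<open>G\<close>. Starting from a finite
  separating subset lets a dimension count prove that \<open>G\<close> is finite.\<close>

locale galois_complete = galois_subfield R F K G xs
  for R (structure) and F K G xs +
  fixes S :: "('a \<Rightarrow> 'a) set"
  assumes S_fin: "finite S" and S_G: "S \<subseteq> G"
    and S_sep: "vec cs \<Longrightarrow> (\<And>\<phi>. \<phi> \<in> S \<Longrightarrow> \<theta> cs \<phi> = \<zero>) \<Longrightarrow> set cs \<subseteq> {\<zero>}"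
begin

lemma \<theta>_zero: "set cs \<subseteq> {\<zero>} \<Longrightarrow> flin f \<Longrightarrow> \<theta> cs f = \<zero>"
proof -
  assume "set cs \<subseteq> {\<zero>}" and f: "flin f"
  then have "combine cs vs = \<zero>" if "set vs \<subseteq> carrier R" for vs
    using that by (induction cs vs rule: combine.induct) auto
  then show ?thesis unfolding \<theta>_def using flin_set[OF f xs_basis(3)] by blast
qed

text \<open>Vectors that agree on \<open>S\<close> have difference zero, so they agree in every
  linear test, in particular as operators on \<open>R\<close>.\<close>

lemma sep_eq:
  assumes "vec cs" "vec ds" "\<And>\<phi>. \<phi> \<in> S \<Longrightarrow> \<theta> cs \<phi> = \<theta> ds \<phi>" "flin f"
  shows "\<theta> cs f = \<theta> ds f"
proof -
  obtain es where es: "vec es" "\<And>f. flin f \<Longrightarrow> \<theta> es f = \<theta> cs f \<ominus> \<theta> ds f"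
    using vec_diff[OF assms(1,2)] by blast
  have "\<theta> es \<phi> = \<zero>" if "\<phi> \<in> S" for \<phi>
  proof -
    have "\<phi> \<in> G" using that S_G by blast
    then show ?thesis
      using es(2)[OF flin_G] assms(3)[OF that] \<theta>_closed[OF assms(2) flin_G] by (simp add: r_right_minus_eq)
  qed
  from \<theta>_zero[OF S_sep[OF es(1) this] assms(4)] have "\<theta> cs f \<ominus> \<theta> ds f = \<zero>" using es(2)[OF assms(4)] by simp
  then show ?thesis using \<theta>_closed assms by (simp add: r_right_minus_eq)
qed

text \<open>The idempotent of \<open>K \<otimes> K\<close> that belongs to the point
  \<open>\<phi>\<close> of \<open>S\<close>.\<close>

definition E :: "('a \<Rightarrow> 'a) \<Rightarrow> 'a list" where
  "E \<phi> = (SOME cs. vec cs \<and> \<theta> cs \<phi> = \<one> \<and> (\<forall>\<psi>\<in>S - {\<phi>}. \<theta> cs \<psi> = \<zero>))"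

lemma E: "\<phi> \<in> S \<Longrightarrow> vec (E \<phi>)" "\<phi> \<in> S \<Longrightarrow> \<psi> \<in> S \<Longrightarrow> \<theta> (E \<phi>) \<psi> = (if \<phi> = \<psi> then \<one> else \<zero>)"
proof -
  have *: "vec (E \<phi>) \<and> \<theta> (E \<phi>) \<phi> = \<one> \<and> (\<forall>\<psi>\<in>S - {\<phi>}. \<theta> (E \<phi>) \<psi> = \<zero>)" if "\<phi> \<in> S" for \<phi>
  proof -
    have "\<phi> \<in> G" using that S_G by blast
    from someI_ex[OF interpolation[OF S_fin S_G this]] show ?thesis unfolding E_def .
  qed
  show "\<phi> \<in> S \<Longrightarrow> vec (E \<phi>)" using * by blast
  show "\<phi> \<in> S \<Longrightarrow> \<psi> \<in> S \<Longrightarrow> \<theta> (E \<phi>) \<psi> = (if \<phi> = \<psi> then \<one> else \<zero>)" using *[of \<phi>] by auto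
qed

text \<open>The operator \<open>z \<mapsto> \<Sum> c\<^sub>j z x\<^sub>j\<close>.\<close>

definition T :: "'a list \<Rightarrow> 'a \<Rightarrow> 'a" where
  "T cs z = \<theta> cs ((\<otimes>) z)"

lemma T_closed: "vec cs \<Longrightarrow> z \<in> carrier R \<Longrightarrow> T cs z \<in> carrier R"
  unfolding T_def by (rule \<theta>_closed[OF _ flin_rmult])

lemma combine_add_right:
  "length cs = length us \<Longrightarrow> length cs = length vs \<Longrightarrow> set cs \<subseteq> carrier R \<Longrightarrow> set us \<subseteq> carrier R \<Longrightarrow> set vs \<subseteq> carrier R \<Longrightarrow>
   combine cs (map2 (\<oplus>) us vs) = combine cs us \<oplus> combine cs vs"
proof (induction cs us arbitrary: vs rule: list_induct2)
  case (Cons c cs u us)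
  obtain v vs' where v: "vs = v # vs'" using Cons.prems(1) by (cases vs) auto
  have "combine cs us \<in> carrier R" "combine cs vs' \<in> carrier R"
    using Cons.prems v by (auto intro!: combine_in_carrier)
  then show ?case using Cons v by (simp add: r_distr a_ac)
qed simp

lemma T_add: "vec cs \<Longrightarrow> y \<in> carrier R \<Longrightarrow> z \<in> carrier R \<Longrightarrow> T cs (y \<oplus> z) = T cs y \<oplus> T cs z"
proof -
  assume cs: "vec cs" and yz: "y \<in> carrier R" "z \<in> carrier R"
  have "map ((\<otimes>) (y \<oplus> z)) xs = map2 (\<oplus>) (map ((\<otimes>) y) xs) (map ((\<otimes>) z) xs)"
    using yz xs_carrier by (induction xs) (auto simp: l_distr)
  moreover have "set cs \<subseteq> carrier R" using cs by (auto simp: vec_def)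
  ultimately show ?thesis
    unfolding T_def \<theta>_def
    using cs flin_set[OF flin_rmult[OF yz(1)] xs_basis(3)] flin_set[OF flin_rmult[OF yz(2)] xs_basis(3)]
    by (simp add: combine_add_right vec_def)
qed

lemma T_zero: "vec cs \<Longrightarrow> T cs \<zero> = \<zero>"
  using T_add[of cs \<zero> \<zero>] T_closed[of cs \<zero>] by (simp add: add.l_cancel_one')

lemma T_left: "vec cs \<Longrightarrow> k \<in> K \<Longrightarrow> z \<in> carrier R \<Longrightarrow> T cs (k \<otimes> z) = k \<otimes> T cs z"
proof -
  assume cs: "vec cs" and k: "k \<in> K" and z: "z \<in> carrier R"
  have "combine cs (map ((\<otimes>) (k \<otimes> z)) us) = k \<otimes> combine cs (map ((\<otimes>) z) us)"
    if "set cs \<subseteq> K" "set us \<subseteq> carrier R" for us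
    using that
  proof (induction cs us rule: combine.induct)
    case (1 c cs u us)
    have cl: "c \<in> K" "u \<in> carrier R" "combine cs (map ((\<otimes>) z) us) \<in> carrier R"
    proof -
      have "set (map ((\<otimes>) z) us) \<subseteq> carrier R" using 1 z by (auto simp: subset_iff)
      moreover have "set cs \<subseteq> carrier R" using 1 by auto
      ultimately show "combine cs (map ((\<otimes>) z) us) \<in> carrier R" by (rule combine_in_carrier[rotated])
    qed (use 1 in auto)
    have "c \<otimes> (k \<otimes> z \<otimes> u) = (c \<otimes> k) \<otimes> (z \<otimes> u)" using cl k z by (simp add: m_assoc)
    also have "c \<otimes> k = k \<otimes> c" using K_comm cl k by blast
    finally have "c \<otimes> (k \<otimes> z \<otimes> u) = k \<otimes> (c \<otimes> (z \<otimes> u))" using cl k z by (simp add: m_assoc)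
    then show ?case using 1 cl k z by (simp add: r_distr)
  qed (use k in auto)
  then show ?thesis unfolding T_def \<theta>_def using cs xs_carrier by (simp add: vec_def)
qed

lemma T_combine:
  "vec cs \<Longrightarrow> set ks \<subseteq> K \<Longrightarrow> set us \<subseteq> carrier R \<Longrightarrow> T cs (combine ks us) = combine ks (map (T cs) us)"
proof (induction ks us rule: combine.induct)
  case (1 k ks u us)
  have "combine ks us \<in> carrier R" using 1 K_carrier by (intro combine_in_carrier) auto
  then show ?case using 1 by (simp add: T_add T_left)
qed (simp_all add: T_zero)

lemma T_right: "vec cs \<Longrightarrow> y \<in> K \<Longrightarrow> z \<in> carrier R \<Longrightarrow> T cs (z \<otimes> y) = T cs z \<otimes> y"
proof -
  assume cs: "vec cs" and y: "y \<in> K" and z: "z \<in> carrier R"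
  have csc: "set cs \<subseteq> carrier R" using cs by (auto simp: vec_def)
  have "map ((\<otimes>) (z \<otimes> y)) xs = map (\<lambda>u. u \<otimes> y) (map ((\<otimes>) z) xs)"
  proof -
    have "z \<otimes> y \<otimes> x = z \<otimes> x \<otimes> y" if "x \<in> set xs" for x
    proof -
      have "x \<in> K" using that xs_basis(3) by blast
      then have "y \<otimes> x = x \<otimes> y" "x \<in> carrier R" using K_comm y by auto
      then show ?thesis using z y by (simp add: m_assoc)
    qed
    then show ?thesis by simp
  qed
  then have "T cs (z \<otimes> y) = combine cs (map (\<lambda>u. u \<otimes> y) (map ((\<otimes>) z) xs))"
    unfolding T_def \<theta>_def by (simp only:)
  also have "\<dots> = T cs z \<otimes> y"
    unfolding T_def \<theta>_def using csc flin_set[OF flin_rmult[OF z] xs_basis(3)] y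
    by (intro combine_l_distr[symmetric]) auto
  finally show ?thesis .
qed

text \<open>Together with 0, these are the elements that induce \<open>\<phi>\<close> on
  \<open>K\<close> by conjugation: the eigenspace on which \<open>1 \<otimes> y\<close> acts as
  \<open>\<phi> y \<otimes> 1\<close>.\<close>

definition eig :: "('a \<Rightarrow> 'a) \<Rightarrow> 'a set" where
  "eig \<phi> = {z \<in> carrier R. \<forall>y\<in>K. z \<otimes> y = \<phi> y \<otimes> z}"

lemma T_eig: "vec cs \<Longrightarrow> \<phi> \<in> G \<Longrightarrow> z \<in> eig \<phi> \<Longrightarrow> T cs z = \<theta> cs \<phi> \<otimes> z"
proof -
  assume cs: "vec cs" and \<phi>: "\<phi> \<in> G" and z: "z \<in> eig \<phi>"
  have csc: "set cs \<subseteq> carrier R" using cs by (auto simp: vec_def)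
  have zc: "z \<in> carrier R" using z by (simp add: eig_def)
  have "map ((\<otimes>) z) xs = map (\<lambda>u. u \<otimes> z) (map \<phi> xs)"
    using z xs_basis(3) by (auto simp: eig_def)
  then have "T cs z = combine cs (map (\<lambda>u. u \<otimes> z) (map \<phi> xs))"
    unfolding T_def \<theta>_def by (simp only:)
  also have "\<dots> = \<theta> cs \<phi> \<otimes> z"
    unfolding \<theta>_def using csc flin_set[OF flin_G[OF \<phi>] xs_basis(3)] zc
    by (intro combine_l_distr[symmetric]) auto
  finally show ?thesis .
qed

text \<open>Multiplying \<open>E \<phi>\<close> by \<open>1 \<otimes> y\<close> or by
  \<open>\<phi> y \<otimes> 1\<close> gives the same values on \<open>S\<close>, hence the same
  operator.\<close>

lemma T_E_eig:
  assumes \<phi>: "\<phi> \<in> S" and z: "z \<in> carrier R"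
  shows "T (E \<phi>) z \<in> eig \<phi>"
proof -
  have "T (E \<phi>) z \<otimes> y = \<phi> y \<otimes> T (E \<phi>) z" if y: "y \<in> K" for y
  proof -
    have \<phi>G: "\<phi> \<in> G" using \<phi> S_G by blast
    obtain d1 where d1: "vec d1" "\<And>\<psi>. \<psi> \<in> G \<Longrightarrow> \<theta> d1 \<psi> = \<theta> (E \<phi>) \<psi> \<otimes> \<psi> y"
        "\<And>z. z \<in> carrier R \<Longrightarrow> \<theta> d1 ((\<otimes>) z) = \<theta> (E \<phi>) ((\<otimes>) z) \<otimes> y"
      using vec_rmult[OF E(1)[OF \<phi>] y] by blast
    obtain d2 where d2: "vec d2" "\<And>f. flin f \<Longrightarrow> \<theta> d2 f = \<phi> y \<otimes> \<theta> (E \<phi>) f"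
      using vec_scale[OF E(1)[OF \<phi>] G_closed[OF \<phi>G y]] by blast
    have "\<theta> d1 ((\<otimes>) z) = \<theta> d2 ((\<otimes>) z)"
    proof (rule sep_eq[OF d1(1) d2(1) _ flin_rmult[OF z]])
      fix \<psi> assume \<psi>: "\<psi> \<in> S"
      then have \<psi>G: "\<psi> \<in> G" using S_G by blast
      show "\<theta> d1 \<psi> = \<theta> d2 \<psi>"
        using d1(2)[OF \<psi>G] d2(2)[OF flin_G[OF \<psi>G]] E(2)[OF \<phi> \<psi>] G_closed[OF \<psi>G y] G_closed[OF \<phi>G y]
        by (auto split: if_splits)
    qed
    then show ?thesis using d1(3)[OF z] d2(2)[OF flin_rmult[OF z]] by (simp add: T_def)
  qed
  then show ?thesis using T_closed[OF E(1)[OF \<phi>] z] by (simp add: eig_def)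
qed

text \<open>The statement of Skolem and Noether for \<open>\<phi>\<close>: if the projection
  \<open>T (E \<phi>)\<close> were zero, \<open>E \<phi>\<close> would vanish by
  \<open>faithful\<close>, although its value at \<open>\<phi>\<close> is 1.\<close>

lemma eig_nonzero:
  assumes \<phi>: "\<phi> \<in> S"
  shows "\<exists>u. u \<in> eig \<phi> \<and> u \<noteq> \<zero>"
proof (rule ccontr)
  assume "\<not> ?thesis"
  then have "\<theta> (E \<phi>) ((\<otimes>) z) = \<zero>" if "z \<in> carrier R" for z
    using T_E_eig[OF \<phi> that] by (auto simp: T_def)
  from faithful[OF E(1)[OF \<phi>] this] have "set (E \<phi>) \<subseteq> {\<zero>}" .
  from \<theta>_zero[OF this] have "\<theta> (E \<phi>) \<phi> = \<zero>" using flin_G \<phi> S_G by blast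
  then show False using E(2)[OF \<phi> \<phi>] one_not_zero by simp
qed

definition u :: "('a \<Rightarrow> 'a) \<Rightarrow> 'a" where
  "u \<phi> = (SOME u. u \<in> eig \<phi> \<and> u \<noteq> \<zero>)"

lemma u: "\<phi> \<in> S \<Longrightarrow> u \<phi> \<in> eig \<phi>" "\<phi> \<in> S \<Longrightarrow> u \<phi> \<noteq> \<zero>" "\<phi> \<in> S \<Longrightarrow> u \<phi> \<in> carrier R"
  using someI_ex[OF eig_nonzero, of \<phi>] by (auto simp: u_def eig_def)

text \<open>\<open>z\<close> and \<open>u \<phi>\<close> induce the same automorphism, so
  \<open>z\<close> times the inverse of \<open>u \<phi>\<close> centralizes \<open>K\<close> and
  lies in \<open>K\<close>.\<close>

lemma eig_one_dim:
  assumes \<phi>: "\<phi> \<in> S" and z: "z \<in> eig \<phi>"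
  shows "\<exists>k\<in>K. z = k \<otimes> u \<phi>"
proof (intro bexI)
  note u = u[OF \<phi>]
  have \<phi>G: "\<phi> \<in> G" using \<phi> S_G by blast
  have zc: "z \<in> carrier R" using z by (simp add: eig_def)
  show "z \<otimes> inv u \<phi> \<in> K"
  proof (rule K_centralizer)
    fix k assume k: "k \<in> K"
    obtain \<psi> where \<psi>: "\<psi> \<in> G" "\<And>x. x \<in> K \<Longrightarrow> \<phi> (\<psi> x) = x" using G_inv[OF \<phi>G] by blast
    define y where "y = \<psi> k"
    have y: "y \<in> K" "\<phi> y = k" using \<psi> k G_closed by (auto simp: y_def)
    have kc: "k \<in> carrier R" "y \<in> carrier R" using k y by auto
    have "inv u \<phi> \<otimes> k = inv u \<phi> \<otimes> (k \<otimes> u \<phi>) \<otimes> inv u \<phi>" using u kc by (simp add: m_assoc)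
    also have "k \<otimes> u \<phi> = u \<phi> \<otimes> y" using u y by (simp add: eig_def)
    also have "inv u \<phi> \<otimes> (u \<phi> \<otimes> y) \<otimes> inv u \<phi> = y \<otimes> inv u \<phi>" using u kc by (simp flip: m_assoc)
    finally have 1: "inv u \<phi> \<otimes> k = y \<otimes> inv u \<phi>" .
    have "z \<otimes> inv u \<phi> \<otimes> k = (z \<otimes> y) \<otimes> inv u \<phi>" using u kc zc by (simp add: m_assoc 1)
    also have "z \<otimes> y = k \<otimes> z" using z y by (simp add: eig_def)
    finally show "z \<otimes> inv u \<phi> \<otimes> k = k \<otimes> (z \<otimes> inv u \<phi>)" using u kc zc by (simp add: m_assoc)
  qed (use zc u in simp)
  show "z = z \<otimes> inv u \<phi> \<otimes> u \<phi>" using zc u by (simp add: m_assoc)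
qed

text \<open>\<open>T (E \<phi>)\<close> is linear over \<open>K\<close>, fixes
  \<open>u \<phi>\<close> and kills the other \<open>u \<psi>\<close>.\<close>

lemma u_independent:
  "distinct \<phi>s \<Longrightarrow> set \<phi>s \<subseteq> S \<Longrightarrow> independent K (map u \<phi>s)"
proof (induction \<phi>s)
  case (Cons \<phi> \<phi>s)
  have us: "set (map u \<phi>s) \<subseteq> carrier R" using Cons.prems u(3) by auto
  have \<phi>: "\<phi> \<in> S" using Cons.prems by auto
  have "u \<phi> \<notin> Span K (map u \<phi>s)"
  proof
    assume "u \<phi> \<in> Span K (map u \<phi>s)"
    then obtain ks where ks: "set ks \<subseteq> K" "u \<phi> = combine ks (map u \<phi>s)"
      using Span_mem_iff_length_version[OF K_subfield us] by blast
    have zero: "T (E \<phi>) (u \<psi>) = \<zero>" if "\<psi> \<in> set \<phi>s" for \<psi>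
    proof -
      have \<psi>: "\<psi> \<in> S" "\<psi> \<in> G" "\<psi> \<noteq> \<phi>" using that Cons.prems S_G by auto
      then show ?thesis using T_eig[OF E(1)[OF \<phi>] \<psi>(2) u(1)[OF \<psi>(1)]] E(2)[OF \<phi> \<psi>(1)] u(3)[OF \<psi>(1)] by simp
    qed
    have "T (E \<phi>) (u \<phi>) = combine ks (map (T (E \<phi>)) (map u \<phi>s))"
      unfolding ks(2) by (rule T_combine[OF E(1)[OF \<phi>] ks(1) us])
    also have "map (T (E \<phi>)) (map u \<phi>s) = map (\<lambda>_. \<zero>) \<phi>s" using zero by simp
    also have "combine ks (map (\<lambda>_. \<zero>) \<phi>s) = \<zero>"
      using ks(1) by (induction ks \<phi>s rule: list_induct2') auto
    finally have "T (E \<phi>) (u \<phi>) = \<zero>" .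
    moreover have "\<phi> \<in> G" using \<phi> S_G by blast
    ultimately show False
      using T_eig[OF E(1)[OF \<phi>] _ u(1)[OF \<phi>]] E(2)[OF \<phi> \<phi>] u[OF \<phi>] by simp
  qed
  then show ?case using Cons u(3)[OF \<phi>] by (simp add: li_Cons del: Span.simps)
qed simp

text \<open>Subtracting \<open>\<theta> cs \<phi>\<close> times \<open>E \<phi>\<close> removes
  \<open>\<phi>\<close> from the support of \<open>cs\<close>, and the subtracted part maps into the
  line spanned by \<open>u \<phi>\<close>.\<close>

lemma T_in_Span:
  assumes "finite S'" "S' \<subseteq> S" "vec cs" "\<And>\<phi>. \<phi> \<in> S - S' \<Longrightarrow> \<theta> cs \<phi> = \<zero>" "z \<in> carrier R"
    and \<phi>s: "set \<phi>s = S"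
  shows "T cs z \<in> Span K (map u \<phi>s)"
  using assms(1-4)
proof (induction S' arbitrary: cs rule: finite_induct)
  case empty
  then have "set cs \<subseteq> {\<zero>}" by (intro S_sep) auto
  then have "T cs z = \<zero>" unfolding T_def using \<theta>_zero flin_rmult assms(5) by blast
  moreover have "set (map u \<phi>s) \<subseteq> carrier R" using \<phi>s u(3) by auto
  ultimately show ?case using Span_subgroup_props(2)[OF K_subfield] by (simp del: Span.simps)
next
  case (insert \<phi> S')
  have us: "set (map u \<phi>s) \<subseteq> carrier R" using \<phi>s u(3) by auto
  have \<phi>: "\<phi> \<in> S" "\<phi> \<in> G" using insert.prems S_G by auto
  define k where "k = \<theta> cs \<phi>"
  have k: "k \<in> K" unfolding k_def by (rule \<theta>_K[OF insert.prems(2) \<phi>(2)])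
  obtain ds where ds: "vec ds" "\<And>f. flin f \<Longrightarrow> \<theta> ds f = k \<otimes> \<theta> (E \<phi>) f" using vec_scale[OF E(1)[OF \<phi>(1)] k] by blast
  obtain es where es: "vec es" "\<And>f. flin f \<Longrightarrow> \<theta> es f = \<theta> cs f \<ominus> \<theta> ds f" using vec_diff[OF insert.prems(2) ds(1)] by blast
  have "T es z \<in> Span K (map u \<phi>s)"
  proof (rule insert.IH[OF _ es(1)])
    fix \<psi> assume \<psi>: "\<psi> \<in> S - S'"
    then have \<psi>': "\<psi> \<in> S" "\<psi> \<in> G" using S_G by auto
    show "\<theta> es \<psi> = \<zero>"
    proof (cases "\<psi> = \<phi>")
      case True
      then show ?thesis using es(2) ds(2) flin_G[OF \<phi>(2)] E(2)[OF \<phi>(1) \<phi>(1)] k by (simp add: k_def r_right_minus_eq)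
    next
      case False
      then have "\<theta> cs \<psi> = \<zero>" using insert.prems(3) \<psi> by auto
      then show ?thesis using es(2) ds(2) flin_G[OF \<psi>'(2)] E(2)[OF \<phi>(1) \<psi>'(1)] False k by (auto simp: a_minus_def)
    qed
  qed (use insert.prems in auto)
  moreover have "T ds z \<in> Span K (map u \<phi>s)"
  proof -
    obtain l where l: "l \<in> K" "T (E \<phi>) z = l \<otimes> u \<phi>" using eig_one_dim[OF \<phi>(1) T_E_eig[OF \<phi>(1) assms(5)]] by blast
    have "T ds z = (k \<otimes> l) \<otimes> u \<phi>" using ds(2)[OF flin_rmult[OF assms(5)]] l k u(3)[OF \<phi>(1)] by (simp add: T_def m_assoc)
    moreover have "u \<phi> \<in> Span K (map u \<phi>s)" using Span_base_incl[OF K_subfield us] \<phi>(1) \<phi>s by (auto simp del: Span.simps)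
    ultimately show ?thesis using Span_smult_closed[OF K_subfield us, of "k \<otimes> l" "u \<phi>"] k l by (simp del: Span.simps)
  qed
  ultimately have "T es z \<oplus> T ds z \<in> Span K (map u \<phi>s)"
    using Span_subgroup_props(3)[OF K_subfield us] by (simp del: Span.simps)
  moreover have "T es z \<oplus> T ds z = T cs z"
    using es(2)[OF flin_rmult[OF assms(5)]] T_closed[OF insert.prems(2) assms(5)] T_closed[OF ds(1) assms(5)]
    by (simp add: T_def a_minus_def a_assoc l_neg)
  ultimately show ?case by simp
qed

text \<open>The tensor \<open>1 \<otimes> 1\<close> acts as the identity, so \<open>R\<close> is the
  sum of the lines \<open>K u \<phi>\<close>.\<close>

lemma dimension_S: "dimension (card S) K (carrier R)"
proof -
  obtain \<phi>s where \<phi>s: "set \<phi>s = S" "distinct \<phi>s" using finite_distinct_list[OF S_fin] by blast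
  have us: "set (map u \<phi>s) \<subseteq> carrier R" using \<phi>s u(3) by auto
  have ind: "independent K (map u \<phi>s)" using u_independent \<phi>s by simp
  have "Span K (map u \<phi>s) = carrier R"
  proof (intro equalityI)
    show "Span K (map u \<phi>s) \<subseteq> carrier R"
      by (rule Span_in_carrier[OF subfieldE(3)[OF K_subfield] us])
    show "carrier R \<subseteq> Span K (map u \<phi>s)"
    proof
      fix z assume z: "z \<in> carrier R"
      obtain cs where cs: "vec cs" "\<And>f. flin f \<Longrightarrow> \<theta> cs f = f \<one>" using vec_point[of \<one>] by auto
      have "T cs z \<in> Span K (map u \<phi>s)" by (rule T_in_Span[OF S_fin _ cs(1) _ z \<phi>s(1)]) auto
      moreover have "T cs z = z" unfolding T_def using cs(2)[OF flin_rmult[OF z]] z by simp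
      ultimately show "z \<in> Span K (map u \<phi>s)" by simp
    qed
  qed
  from dimensionI[OF K_subfield ind this] show ?thesis
    unfolding length_map distinct_card[OF \<phi>s(2), symmetric] \<phi>s(1) .
qed

text \<open>Where a component of \<open>v\<close> vanishes, adding \<open>u \<phi>\<close> repairs
  it and leaves the other components alone.\<close>

lemma separating_element:
  "finite S' \<Longrightarrow> S' \<subseteq> S \<Longrightarrow> \<exists>v\<in>carrier R. \<forall>\<phi>\<in>S'. T (E \<phi>) v \<noteq> \<zero>"
proof (induction S' rule: finite_induct)
  case (insert \<phi> S')
  then obtain v where v: "v \<in> carrier R" "\<And>\<psi>. \<psi> \<in> S' \<Longrightarrow> T (E \<psi>) v \<noteq> \<zero>" by auto
  have \<phi>: "\<phi> \<in> S" "\<phi> \<in> G" using insert.prems S_G by auto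
  show ?case
  proof (cases "T (E \<phi>) v = \<zero>")
    case True
    have "T (E \<psi>) (v \<oplus> u \<phi>) \<noteq> \<zero>" if \<psi>: "\<psi> \<in> insert \<phi> S'" for \<psi>
    proof -
      have \<psi>S: "\<psi> \<in> S" using \<psi> insert.prems by auto
      have "T (E \<psi>) (v \<oplus> u \<phi>) = T (E \<psi>) v \<oplus> \<theta> (E \<psi>) \<phi> \<otimes> u \<phi>"
        using T_add[OF E(1)[OF \<psi>S] v(1) u(3)[OF \<phi>(1)]] T_eig[OF E(1)[OF \<psi>S] \<phi>(2) u(1)[OF \<phi>(1)]] by simp
      then show ?thesis
        using \<psi> insert.hyps(2) True v(2)[of \<psi>] E(2)[OF \<psi>S \<phi>(1)] u[OF \<phi>(1)] T_closed[OF E(1)[OF \<psi>S] v(1)] by auto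
    qed
    then show ?thesis using v(1) u(3)[OF \<phi>(1)] by (intro bexI[of _ "v \<oplus> u \<phi>"]) auto
  qed (use v in auto)
qed auto

text \<open>Let all components of \<open>v\<close> be nonzero. The component at
  \<open>\<phi>\<close> of \<open>\<Sum> k v x\<close> is \<open>\<theta> ks \<phi>\<close> times
  that of \<open>v\<close>, so a relation has all its \<open>\<theta>\<close> values zero. Hence the
  elements \<open>v x\<close> are independent over \<open>K\<close>, and \<open>[K : F]\<close> is
  at most the dimension of \<open>R\<close> over \<open>K\<close>.\<close>

lemma length_xs_le: "length xs \<le> card S"
proof -
  obtain v where v: "v \<in> carrier R" "\<And>\<phi>. \<phi> \<in> S \<Longrightarrow> T (E \<phi>) v \<noteq> \<zero>" using separating_element[OF S_fin] by blast
  have vx: "set (map ((\<otimes>) v) xs) \<subseteq> carrier R" by (rule flin_set[OF flin_rmult[OF v(1)] xs_basis(3)])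
  have "independent K (map ((\<otimes>) v) xs)"
  proof (rule independent_if_trivial[OF K_subfield vx])
    fix ks assume ks: "set ks \<subseteq> K" "length ks = length (map ((\<otimes>) v) xs)" "combine ks (map ((\<otimes>) v) xs) = \<zero>"
    have vk: "vec ks" using ks by (simp add: vec_def)
    show "set ks \<subseteq> {\<zero>}"
    proof (rule S_sep[OF vk])
      fix \<phi> assume \<phi>: "\<phi> \<in> S"
      have \<phi>G: "\<phi> \<in> G" using \<phi> S_G by blast
      have "\<theta> ks \<phi> \<otimes> T (E \<phi>) v = T ks (T (E \<phi>) v)"
        using T_eig[OF vk \<phi>G T_E_eig[OF \<phi> v(1)]] by simp
      also have "\<dots> = combine ks (map (\<lambda>x. T (E \<phi>) v \<otimes> x) xs)" by (simp add: T_def \<theta>_def)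
      also have "map (\<lambda>x. T (E \<phi>) v \<otimes> x) xs = map (T (E \<phi>)) (map ((\<otimes>) v) xs)"
        using T_right[OF E(1)[OF \<phi>] _ v(1)] xs_basis(3) by auto
      also have "combine ks (map (T (E \<phi>)) (map ((\<otimes>) v) xs)) = T (E \<phi>) \<zero>"
        using T_combine[OF E(1)[OF \<phi>] ks(1) vx] ks(3) by simp
      also have "\<dots> = \<zero>" by (rule T_zero[OF E(1)[OF \<phi>]])
      finally show "\<theta> ks \<phi> = \<zero>"
        using nz_divisors[OF \<theta>_closed[OF vk flin_G[OF \<phi>G]] T_closed[OF E(1)[OF \<phi>] v(1)]] v(2)[OF \<phi>] by blast
    qed
  qed
  from independent_length_le_dimension[OF K_subfield dimension_S this vx] show ?thesis by simp
qed

end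

section \<open>The order of the Galois group\<close>

context galois_subfield
begin

theorem crossed_product_structure:
  assumes D: "dimension D F (carrier R)"
  shows "finite G" "length xs * card G = D" "length xs \<le> card G"
    "\<phi> \<in> G \<Longrightarrow> \<exists>u\<in>carrier R. u \<noteq> \<zero> \<and> (\<forall>y\<in>K. u \<otimes> y = \<phi> y \<otimes> u)"
proof -
  from finite_artin[OF xs_basis(1,3)] obtain S where S: "finite S" "S \<subseteq> G" and sep:
    "\<forall>cs. length cs = length xs \<and> set cs \<subseteq> K \<and> (\<forall>\<phi>\<in>S. combine cs (map \<phi> xs) = \<zero>) \<longrightarrow> set cs \<subseteq> {\<zero>}"
    by (elim exE conjE)
  have compl: "galois_complete R F K G xs S'" if S': "S \<subseteq> S'" "finite S'" "S' \<subseteq> G" for S'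
  proof (rule galois_complete.intro[OF galois_subfield_axioms], unfold_locales)
    fix cs assume "vec cs" and zero: "\<And>\<phi>. \<phi> \<in> S' \<Longrightarrow> \<theta> cs \<phi> = \<zero>"
    then have "length cs = length xs \<and> set cs \<subseteq> K \<and> (\<forall>\<phi>\<in>S. combine cs (map \<phi> xs) = \<zero>)"
      using S'(1) unfolding vec_def \<theta>_def by blast
    then show "set cs \<subseteq> {\<zero>}" by (rule sep[rule_format])
  qed (use S' in auto)
  have "G \<subseteq> S"
  proof
    fix \<phi> assume \<phi>: "\<phi> \<in> G"
    have "galois_complete R F K G xs S" "galois_complete R F K G xs (insert \<phi> S)"
      using S \<phi> by (auto intro!: compl)
    \<comment> \<open>Every finite separating set has as many elements as the dimension of
      \<open>R\<close> over \<open>K\<close>, so it cannot be enlarged.\<close>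
    then have "card (insert \<phi> S) = card S"
      by (intro dimension_is_inj[OF K_subfield]) (rule galois_complete.dimension_S, assumption)+
    then show "\<phi> \<in> S" using S(1) by (metis card_insert_disjoint n_not_Suc_n)
  qed
  then have SG: "S = G" using S by blast
  show "finite G" using S SG by simp
  interpret galois_complete R F K G xs G using compl[of G] S SG by simp
  show "length xs \<le> card G" by (rule length_xs_le)
  have "dimension (length xs) F K" using dimensionI[OF F_subfield xs_basis(1,2)] .
  from telescopic_base[OF F_subfield K_subfield this dimension_S]
  show "length xs * card G = D" using dimension_is_inj[OF F_subfield _ D] by blast
  show "\<exists>u\<in>carrier R. u \<noteq> \<zero> \<and> (\<forall>y\<in>K. u \<otimes> y = \<phi> y \<otimes> u)" if "\<phi> \<in> G"
    using u[OF that] unfolding eig_def by blast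
qed

end

section \<open>The Galois group of a maximal subfield\<close>

lemma ring_iso_cong:
  assumes R: "ring R" and h: "h \<in> ring_iso R S" and eq: "\<And>x. x \<in> carrier R \<Longrightarrow> g x = h x"
  shows "g \<in> ring_iso R S"
proof -
  interpret ring R by fact
  have "bij_betw g (carrier R) (carrier S)"
    using h eq bij_betw_cong[of "carrier R" g h] by (auto simp: ring_iso_def)
  moreover have "g \<in> Ring.ring_hom R S"
    using h by (auto simp: ring_iso_def Ring.ring_hom_def eq Pi_def)
  ultimately show ?thesis by (simp add: ring_iso_def)
qed

text \<open>The elements of \<open>field_auts\<close> have arbitrary values outside
  \<open>K\<close>. Requiring them to be extensional leaves one function for each
  automorphism.\<close>

definition galois_group :: "('a, 'm) ring_scheme \<Rightarrow> 'a set \<Rightarrow> 'a set \<Rightarrow> ('a \<Rightarrow> 'a) monoid" where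
  "galois_group D F K = \<lparr>carrier = field_auts D F K \<inter> extensional K, monoid.mult = compose K, one = (\<lambda>x\<in>K. x)\<rparr>"

locale galois_in_division_ring = division_ring D for D (structure) +
  fixes K
  assumes K_max: "maximal_subfield K D" and galois: "galois_extension D (ring_center D) K"
begin

abbreviation "F \<equiv> ring_center D"
abbreviation "Gal \<equiv> galois_group D F K"

lemma K_sub: "subfield K D" and F_sub_K: "F \<subseteq> K" and K_fin: "finite_dimension F K"
  and fixed_field: "{x \<in> K. \<forall>\<phi>\<in>field_auts D F K. \<phi> x = x} = F"
  using galois by (simp_all only: galois_extension_def)

lemma ring_K: "ring (D\<lparr>carrier := K\<rparr>)"
  by (rule subring_is_ring[OF subfieldE(1)[OF K_sub]])

lemma autsE:
  assumes "\<phi> \<in> field_auts D F K"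
  shows "bij_betw \<phi> K K" "x \<in> K \<Longrightarrow> \<phi> x \<in> K" "x \<in> K \<Longrightarrow> y \<in> K \<Longrightarrow> \<phi> (x \<otimes> y) = \<phi> x \<otimes> \<phi> y"
    "x \<in> K \<Longrightarrow> y \<in> K \<Longrightarrow> \<phi> (x \<oplus> y) = \<phi> x \<oplus> \<phi> y" "\<phi> \<one> = \<one>" "x \<in> F \<Longrightarrow> \<phi> x = x"
proof -
  have iso: "\<phi> \<in> ring_iso (D\<lparr>carrier := K\<rparr>) (D\<lparr>carrier := K\<rparr>)" and fixed: "\<forall>x\<in>F. \<phi> x = x"
    using assms by (simp_all add: field_auts_def)
  note memE = ring_iso_memE[OF iso, simplified]
  show "bij_betw \<phi> K K" by (rule memE(5))
  show "x \<in> K \<Longrightarrow> \<phi> x \<in> K" by (rule memE(1))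
  show "x \<in> K \<Longrightarrow> y \<in> K \<Longrightarrow> \<phi> (x \<otimes> y) = \<phi> x \<otimes> \<phi> y" by (rule memE(2))
  show "x \<in> K \<Longrightarrow> y \<in> K \<Longrightarrow> \<phi> (x \<oplus> y) = \<phi> x \<oplus> \<phi> y" by (rule memE(3))
  show "\<phi> \<one> = \<one>" by (rule memE(4))
  show "x \<in> F \<Longrightarrow> \<phi> x = x" by (rule bspec[OF fixed])
qed

lemma auts_cong:
  assumes "\<phi> \<in> field_auts D F K" "\<And>x. x \<in> K \<Longrightarrow> \<psi> x = \<phi> x"
  shows "\<psi> \<in> field_auts D F K"
proof -
  have iso: "\<phi> \<in> ring_iso (D\<lparr>carrier := K\<rparr>) (D\<lparr>carrier := K\<rparr>)"
    using assms(1) by (simp add: field_auts_def)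
  have "\<psi> \<in> ring_iso (D\<lparr>carrier := K\<rparr>) (D\<lparr>carrier := K\<rparr>)"
    by (rule ring_iso_cong[OF ring_K iso]) (simp add: assms(2))
  moreover have "\<psi> x = x" if "x \<in> F" for x
  proof -
    have "x \<in> K" using that F_sub_K by blast
    then show ?thesis using assms(2)[of x] autsE(6)[OF assms(1) that] by simp
  qed
  ultimately show ?thesis by (simp add: field_auts_def)
qed

lemma auts_id: "(\<lambda>x. x) \<in> field_auts D F K"
  by (auto simp: field_auts_def ring_iso_def Ring.ring_hom_def bij_betw_def inj_on_def)

lemma auts_comp:
  assumes "\<phi> \<in> field_auts D F K" "\<psi> \<in> field_auts D F K"
  shows "\<phi> \<circ> \<psi> \<in> field_auts D F K"
  using ring_iso_set_trans[of \<psi> "D\<lparr>carrier := K\<rparr>" "D\<lparr>carrier := K\<rparr>" \<phi> "D\<lparr>carrier := K\<rparr>"] assms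
  by (auto simp: field_auts_def)

lemma auts_inv:
  assumes \<phi>: "\<phi> \<in> field_auts D F K"
  shows "inv_into K \<phi> \<in> field_auts D F K"
proof -
  have "inv_into K \<phi> \<in> ring_iso (D\<lparr>carrier := K\<rparr>) (D\<lparr>carrier := K\<rparr>)"
    using ring_iso_set_sym[OF ring_K, of \<phi> "D\<lparr>carrier := K\<rparr>"] \<phi> by (auto simp: field_auts_def)
  moreover have "inv_into K \<phi> x = x" if "x \<in> F" for x
  proof -
    have "\<phi> x = x" "x \<in> K" using autsE(6)[OF \<phi>] that F_sub_K by auto
    moreover have "inj_on \<phi> K" using autsE(1)[OF \<phi>] by (rule bij_betw_imp_inj_on)
    ultimately show ?thesis by (metis inv_into_f_f)
  qed
  ultimately show ?thesis by (simp add: field_auts_def)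
qed

lemma carrier_Gal: "\<phi> \<in> carrier Gal \<longleftrightarrow> \<phi> \<in> field_auts D F K \<and> \<phi> \<in> extensional K"
  by (simp add: galois_group_def)

lemma restrict_auts: "\<phi> \<in> field_auts D F K \<Longrightarrow> restrict \<phi> K \<in> carrier Gal"
  unfolding carrier_Gal by (auto intro: auts_cong)

lemma compose_Gal: "\<phi> \<in> carrier Gal \<Longrightarrow> \<psi> \<in> carrier Gal \<Longrightarrow> compose K \<phi> \<psi> \<in> carrier Gal"
proof -
  assume "\<phi> \<in> carrier Gal" "\<psi> \<in> carrier Gal"
  then have "\<phi> \<in> field_auts D F K" "\<psi> \<in> field_auts D F K" by (simp_all add: carrier_Gal)
  then have "compose K \<phi> \<psi> \<in> field_auts D F K"
    by (rule auts_cong[OF auts_comp]) (simp add: compose_eq)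
  then show ?thesis by (simp add: carrier_Gal compose_extensional)
qed

lemma Gal_inverse:
  assumes "\<phi> \<in> carrier Gal"
  shows "\<exists>\<psi>\<in>carrier Gal. (\<forall>x\<in>K. \<phi> (\<psi> x) = x) \<and> (\<forall>x\<in>K. \<psi> (\<phi> x) = x)"
proof (intro bexI conjI ballI)
  have \<phi>: "\<phi> \<in> field_auts D F K" using assms by (simp add: carrier_Gal)
  have bij: "bij_betw \<phi> K K" by (rule autsE(1)[OF \<phi>])
  show "restrict (inv_into K \<phi>) K \<in> carrier Gal" by (rule restrict_auts[OF auts_inv[OF \<phi>]])
  fix x assume x: "x \<in> K"
  show "\<phi> (restrict (inv_into K \<phi>) K x) = x"
    using x bij by (simp add: bij_betw_inv_into_right)
  show "restrict (inv_into K \<phi>) K (\<phi> x) = x"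
    using x bij autsE(2)[OF \<phi> x] by (simp add: bij_betw_inv_into_left)
qed

lemma group_Gal: "group Gal"
proof (rule groupI)
  show "\<phi> \<otimes>\<^bsub>Gal\<^esub> \<psi> \<in> carrier Gal" if "\<phi> \<in> carrier Gal" "\<psi> \<in> carrier Gal" for \<phi> \<psi>
    using compose_Gal[OF that] by (simp add: galois_group_def)
  show "\<one>\<^bsub>Gal\<^esub> \<in> carrier Gal"
    using restrict_auts[OF auts_id] by (simp add: galois_group_def)
  show "\<phi> \<otimes>\<^bsub>Gal\<^esub> \<psi> \<otimes>\<^bsub>Gal\<^esub> \<chi> = \<phi> \<otimes>\<^bsub>Gal\<^esub> (\<psi> \<otimes>\<^bsub>Gal\<^esub> \<chi>)"
    if "\<phi> \<in> carrier Gal" "\<psi> \<in> carrier Gal" "\<chi> \<in> carrier Gal" for \<phi> \<psi> \<chi>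
    using autsE(2)[of \<chi>] that by (auto simp: galois_group_def compose_def intro!: ext)
  show "\<one>\<^bsub>Gal\<^esub> \<otimes>\<^bsub>Gal\<^esub> \<phi> = \<phi>" if "\<phi> \<in> carrier Gal" for \<phi>
    using that autsE(2)[of \<phi>] by (auto simp: galois_group_def compose_def extensional_def intro!: ext)
  show "\<exists>\<psi>\<in>carrier Gal. \<psi> \<otimes>\<^bsub>Gal\<^esub> \<phi> = \<one>\<^bsub>Gal\<^esub>" if "\<phi> \<in> carrier Gal" for \<phi>
  proof -
    from Gal_inverse[OF that] obtain \<psi> where "\<psi> \<in> carrier Gal" "\<forall>x\<in>K. \<psi> (\<phi> x) = x" by blast
    then show ?thesis by (intro bexI[of _ \<psi>]) (auto simp: galois_group_def compose_def intro!: ext)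
  qed
qed

text \<open>\<open>m\<close> is \<open>[K : F]\<close> and \<open>S\<close> a basis of
  \<open>K\<close> over \<open>F\<close>. Only values on \<open>S\<close> are recorded, since
  finitely many elements have a common denominator.\<close>

theorem crossed_product_relations:
  assumes dim: "dimension n F (carrier D)"
  obtains u S m where "finite (carrier Gal)" "m * card (carrier Gal) = n" "m \<le> card (carrier Gal)" "finite S" "S \<subseteq> K"
    "\<And>\<phi>. \<phi> \<in> carrier Gal \<Longrightarrow> u \<phi> \<in> carrier D \<and> u \<phi> \<noteq> \<zero>"
    "\<And>\<phi> \<psi> y. \<phi> \<in> carrier Gal \<Longrightarrow> \<psi> \<in> carrier Gal \<Longrightarrow> y \<in> S \<Longrightarrow> u \<phi> \<otimes> \<psi> y = (\<phi> \<otimes>\<^bsub>Gal\<^esub> \<psi>) y \<otimes> u \<phi>"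
    "\<And>\<phi> y. \<phi> \<in> carrier Gal \<Longrightarrow> y \<in> S \<Longrightarrow> \<phi> y \<in> carrier D"
    "\<And>\<phi> \<psi>. \<phi> \<in> carrier Gal \<Longrightarrow> \<psi> \<in> carrier Gal \<Longrightarrow> (\<And>y. y \<in> S \<Longrightarrow> \<phi> y = \<psi> y) \<Longrightarrow> \<phi> = \<psi>"
proof -
  have F_sf: "subfield F D" by (rule center_subfield)
  from K_fin obtain k where k: "dimension k F K" unfolding finite_dimension_def by blast
  from exists_base[OF F_sf k] obtain xs where xs: "set xs \<subseteq> carrier D" "independent F xs" "Span F xs = K" by blast
  have xsK: "set xs \<subseteq> K" using Span_base_incl[OF F_sf xs(1)] unfolding xs(3) .
  interpret galois_subfield D F K "carrier Gal" xs
  proof (intro galois_subfield.intro division_ring_axioms galois_subfield_axioms.intro refl K_sub F_sub_K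
      compose_Gal restrict_auts auts_id xs(2,3) xsK)
    show "z \<in> K" if "z \<in> carrier D" "\<And>k. k \<in> K \<Longrightarrow> z \<otimes> k = k \<otimes> z" for z
      by (rule maximal_subfield_centralizer[OF K_max that])
    show "\<phi> x \<in> K" if "\<phi> \<in> carrier Gal" "x \<in> K" for \<phi> x
      using that by (simp add: carrier_Gal autsE)
    show "\<phi> (x \<otimes> y) = \<phi> x \<otimes> \<phi> y" "\<phi> (x \<oplus> y) = \<phi> x \<oplus> \<phi> y" if "\<phi> \<in> carrier Gal" "x \<in> K" "y \<in> K" for \<phi> x y
      using that by (simp_all add: carrier_Gal autsE)
    show "\<phi> \<one> = \<one>" if "\<phi> \<in> carrier Gal" for \<phi>
      using that by (simp add: carrier_Gal autsE)
    show "\<phi> x = x" if "\<phi> \<in> carrier Gal" "x \<in> F" for \<phi> x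
      using that by (simp add: carrier_Gal autsE)
    show "\<phi> = \<psi>" if "\<phi> \<in> carrier Gal" "\<psi> \<in> carrier Gal" "\<And>x. x \<in> K \<Longrightarrow> \<phi> x = \<psi> x" for \<phi> \<psi>
      using that by (intro extensionalityI[of \<phi> K \<psi>]) (simp_all add: carrier_Gal)
    show "\<exists>\<psi>\<in>carrier Gal. \<forall>x\<in>K. \<phi> (\<psi> x) = x" if "\<phi> \<in> carrier Gal" for \<phi>
      using Gal_inverse[OF that] by blast
    show "x \<in> F" if x: "x \<in> K" "\<And>\<phi>. \<phi> \<in> carrier Gal \<Longrightarrow> \<phi> x = x" for x
    proof -
      have "\<phi> x = x" if "\<phi> \<in> field_auts D F K" for \<phi>
        using x(2)[OF restrict_auts[OF that]] x(1) by simp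
      then show ?thesis using fixed_field x(1) by blast
    qed
  qed
  note cps = crossed_product_structure[OF dim]
  have "\<forall>\<phi>\<in>carrier Gal. \<exists>u. u \<in> carrier D \<and> u \<noteq> \<zero> \<and> (\<forall>y\<in>K. u \<otimes> y = \<phi> y \<otimes> u)"
    using cps(4) by blast
  from bchoice[OF this] obtain u where "\<forall>\<phi>\<in>carrier Gal. u \<phi> \<in> carrier D \<and> u \<phi> \<noteq> \<zero> \<and> (\<forall>y\<in>K. u \<phi> \<otimes> y = \<phi> y \<otimes> u \<phi>)" ..
  then have u: "\<And>\<phi>. \<phi> \<in> carrier Gal \<Longrightarrow> u \<phi> \<in> carrier D \<and> u \<phi> \<noteq> \<zero> \<and> (\<forall>y\<in>K. u \<phi> \<otimes> y = \<phi> y \<otimes> u \<phi>)"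
    by (rule bspec)
  show thesis
  proof (rule that[of "length xs" "set xs" u])
    show "finite (carrier Gal)" by (rule cps(1))
    show "length xs * card (carrier Gal) = n" "length xs \<le> card (carrier Gal)" by (rule cps)+
    show "set xs \<subseteq> K" by (rule xsK)
    show "u \<phi> \<in> carrier D \<and> u \<phi> \<noteq> \<zero>" if "\<phi> \<in> carrier Gal" for \<phi> using u[OF that] by blast
    show "u \<phi> \<otimes> \<psi> y = (\<phi> \<otimes>\<^bsub>Gal\<^esub> \<psi>) y \<otimes> u \<phi>"
      if "\<phi> \<in> carrier Gal" "\<psi> \<in> carrier Gal" "y \<in> set xs" for \<phi> \<psi> y
    proof -
      have y: "y \<in> K" using that xsK by blast
      then have "\<psi> y \<in> K" by (rule G_closed[OF that(2)])
      then have "u \<phi> \<otimes> \<psi> y = \<phi> (\<psi> y) \<otimes> u \<phi>" using u[OF that(1)] by blast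
      then show ?thesis using y by (simp add: galois_group_def compose_def)
    qed
    show "\<phi> y \<in> carrier D" if "\<phi> \<in> carrier Gal" "y \<in> set xs" for \<phi> y
      by (rule K_carrier[OF G_closed[OF that(1)]]) (use that xsK in auto)
    show "\<phi> = \<psi>" if "\<phi> \<in> carrier Gal" "\<psi> \<in> carrier Gal" "\<And>y. y \<in> set xs \<Longrightarrow> \<phi> y = \<psi> y" for \<phi> \<psi>
    proof (rule G_ext[OF that(1,2)])
      fix x assume "x \<in> K"
      then obtain ls where ls: "set ls \<subseteq> F" "x = combine ls xs"
        using Span_mem_iff_length_version[OF F_sf xs(1), of x] unfolding xs(3) by blast
      have "map \<phi> xs = map \<psi> xs" using that(3) by simp
      then show "\<phi> x = \<psi> x"
        unfolding ls(2) flin_combine[OF flin_G[OF that(1)] ls(1) xsK] flin_combine[OF flin_G[OF that(2)] ls(1) xsK] by (simp only:)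
    qed
  qed simp
qed

end

section \<open>Generic matrices inside a quantum torus\<close>

subsection \<open>Roots of unity\<close>

text \<open>A root \<open>x\<close> of \<open>1 + X + ... + X^(p-1)\<close> is not 1, because
  \<open>p\<close> is not 0 in the field; a root \<open>y\<close> of \<open>x\<close> of degree
  \<open>p^(n-1)\<close> then has order exactly \<open>p^n\<close>.\<close>

lemma primitive_root_exists:
  assumes p: "Factorial_Ring.prime (p::nat)" and nz: "of_nat p \<noteq> (0 :: 'e::alg_closed_field)" and n: "n > 0"
  shows "\<exists>w::'e. w ^ (p ^ n) = 1 \<and> (\<forall>e. w ^ e = 1 \<longrightarrow> p ^ n dvd e)"
proof -
  have p1: "p > 1" using prime_gt_1_nat[OF p] .
  obtain x :: 'e where x: "(\<Sum>k\<le>p - 1. 1 * x ^ k) = 0"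
    using alg_closed[of "p - 1" "\<lambda>_. 1"] p1 by auto
  have sum: "(\<Sum>i<p. x ^ i) = 0"
    using x p1 by (simp flip: lessThan_Suc_atMost)
  have xp: "x ^ p = 1" using power_diff_1_eq[of x p] sum by simp
  have x1: "x \<noteq> 1" using sum nz by auto
  define m where "m = p ^ (n - 1)"
  have pos: "m > 0" using p1 by (simp add: m_def)
  \<comment> \<open>The polynomial is \<open>Y^m - x\<close>.\<close>
  obtain y :: 'e where y: "(\<Sum>k\<le>m. (if k = 0 then - x else if k = m then 1 else 0) * y ^ k) = 0"
    using alg_closed[of m "\<lambda>k. if k = 0 then - x else if k = m then 1 else 0"] pos by auto
  have "(\<Sum>k\<le>m. (if k = 0 then - x else if k = m then 1 else 0) * y ^ k)
      = (\<Sum>k\<in>{0, m}. (if k = 0 then - x else if k = m then 1 else 0) * y ^ k)"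
    by (rule sum.mono_neutral_right) auto
  also have "\<dots> = y ^ m - x" using pos by simp
  finally have yx: "y ^ (p ^ (n - 1)) = x" using y by (simp add: m_def)
  have pn: "p ^ n = p ^ (n - 1) * p" using n by (metis power_minus_mult)
  have "y ^ (p ^ n) = 1" unfolding pn power_mult yx by (rule xp)
  moreover have "p ^ n dvd e" if e: "y ^ e = 1" for e
  proof (cases "e = 0")
    case False
    \<comment> \<open>\<open>y\<close> to the power \<open>gcd e (p ^ n) = p ^ j\<close> is 1. For
      \<open>j < n\<close> this power of \<open>p\<close> divides \<open>p ^ (n - 1)\<close>, which
      would give \<open>x = 1\<close>.\<close>
    obtain a b where ab: "e * a = p ^ n * b + gcd e (p ^ n)" using bezout_nat[OF False, of "p ^ n"] by blast
    have "y ^ (e * a) = 1" by (simp add: power_mult e)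
    then have g: "y ^ gcd e (p ^ n) = 1"
      unfolding ab power_add power_mult \<open>y ^ (p ^ n) = 1\<close> by simp
    obtain j where j: "j \<le> n" "gcd e (p ^ n) = p ^ j"
      using divides_primepow_nat[OF p, of "gcd e (p ^ n)" n] by auto
    have "j = n"
    proof (rule ccontr)
      assume "j \<noteq> n"
      then have "n - 1 = j + (n - 1 - j)" using j by simp
      then have "p ^ (n - 1) = p ^ j * p ^ (n - 1 - j)" by (metis power_add)
      then have "x = 1" using yx g j by (simp add: power_mult)
      then show False using x1 by simp
    qed
    then show ?thesis using j by (metis gcd_dvd1)
  qed simp
  ultimately show ?thesis by blast
qed

subsection \<open>Polynomial matrices\<close>

definition fm_map :: "('a \<Rightarrow> 'b) \<Rightarrow> 'a fm \<Rightarrow> 'b fm" where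
  "fm_map f A = Mk (\<lambda>i j. f (ent A i j))"

lemma ent_fm_map [simp]: "ent (fm_map f A) i j = f (ent A i j)"
  by (simp add: fm_map_def)

context semiring_hom_fun
begin

lemma fm_map_fmats: "A \<in> fmats d \<Longrightarrow> fm_map \<phi> A \<in> fmats d"
  by (auto simp: fmats_def)

lemma fm_map_add: "fm_map \<phi> (A + B) = fm_map \<phi> A + fm_map \<phi> B"
  by (rule fm_eqI) (simp add: hom_add)

lemma fm_map_mult: "fm_map \<phi> (mm d A B) = mm d (fm_map \<phi> A) (fm_map \<phi> B)"
  by (rule fm_eqI) (simp add: ent_mm hom_sum hom_mult)

lemma fm_map_scal: "fm_map \<phi> (scal d c) = scal d (\<phi> c)"
  by (rule fm_eqI) (simp add: ent_scal)

end

lemma fm_map_uminus: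
  fixes \<phi> :: "'a::comm_ring_1 \<Rightarrow> 'b::comm_ring_1"
  assumes "semiring_hom_fun \<phi>"
  shows "fm_map \<phi> (- A) = - fm_map \<phi> A"
proof -
  interpret semiring_hom_fun \<phi> by fact
  have "\<phi> (- a) = - \<phi> a" for a
    using hom_add[of a "- a"] by (simp add: eq_neg_iff_add_eq_0 add.commute)
  then show ?thesis by (intro fm_eqI) simp
qed

definition emb :: "'k::field generic_poly \<Rightarrow> 'k generic_fun" where
  "emb p = Fract p 1"

lemma emb_hom: "semiring_hom_fun (emb :: 'k::field generic_poly \<Rightarrow> _)"
  by standard (simp_all add: emb_def Zero_fract_def One_fract_def)

lemma emb_inject: "emb p = emb q \<longleftrightarrow> p = q"
  by (simp add: emb_def eq_fract)

definition pvar :: "nat \<Rightarrow> nat \<Rightarrow> nat \<Rightarrow> 'k::field generic_poly" where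
  "pvar i j r = Poly_Mapping.single (Poly_Mapping.single (i, j, r) 1) 1"

definition pgen :: "nat \<Rightarrow> nat \<Rightarrow> 'k::field generic_poly fm" where
  "pgen d r = Mk (\<lambda>i j. if i < d \<and> j < d then pvar i j r else 0)"

text \<open>Polynomial preimages under \<open>emb\<close> for all elements of the generic algebra,
  in a form suited to induction. A larger set of matrices is harmless here, so the index
  \<open>r\<close> is unrestricted.\<close>

inductive_set poly_B :: "nat \<Rightarrow> 'k::field generic_poly fm set" for d where
  one: "scal d 1 \<in> poly_B d"
| const: "scal d (Poly_Mapping.single 0 c) \<in> poly_B d"
| gen: "pgen d r \<in> poly_B d"
| uminus: "A \<in> poly_B d \<Longrightarrow> - A \<in> poly_B d"
| add: "A \<in> poly_B d \<Longrightarrow> B \<in> poly_B d \<Longrightarrow> A + B \<in> poly_B d"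
| mult: "A \<in> poly_B d \<Longrightarrow> B \<in> poly_B d \<Longrightarrow> mm d A B \<in> poly_B d"

definition to_fm :: "nat \<Rightarrow> 'a::zero mat \<Rightarrow> 'a fm" where
  "to_fm d A = Mk (\<lambda>i j. if i < d \<and> j < d then A $$ (i, j) else 0)"

lemma ent_to_fm: "ent (to_fm d A) i j = (if i < d \<and> j < d then A $$ (i, j) else 0)"
  by (simp add: to_fm_def)

lemma to_fm_fmats [simp]: "to_fm d A \<in> fmats d"
  by (auto simp: fmats_def ent_to_fm)

lemma to_fm_inject: "A \<in> carrier_mat d d \<Longrightarrow> B \<in> carrier_mat d d \<Longrightarrow> to_fm d A = to_fm d B \<longleftrightarrow> A = B"
proof
  assume AB: "A \<in> carrier_mat d d" "B \<in> carrier_mat d d" "to_fm d A = to_fm d B"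
  show "A = B"
  proof (rule eq_matI)
    fix i j assume "i < dim_row B" "j < dim_col B"
    then have "i < d" "j < d" using AB by auto
    then show "A $$ (i, j) = B $$ (i, j)" using arg_cong[OF AB(3), of "\<lambda>C. ent C i j"] by (simp add: ent_to_fm)
  qed (use AB in auto)
qed simp

lemma to_fm_add: "A \<in> carrier_mat d d \<Longrightarrow> B \<in> carrier_mat d d \<Longrightarrow> to_fm d (A + B) = to_fm d A + to_fm d (B :: 'a::comm_monoid_add mat)"
  by (rule fmats_eqI[of _ d]) (auto simp: ent_to_fm)

lemma to_fm_mult: "A \<in> carrier_mat d d \<Longrightarrow> B \<in> carrier_mat d d \<Longrightarrow> to_fm d (A * B) = mm d (to_fm d A) (to_fm d (B :: 'a::semiring_0 mat))"
  by (rule fmats_eqI[of _ d]) (auto simp: ent_to_fm ent_mm scalar_prod_def atLeast0LessThan)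

lemma to_fm_one: "to_fm d (1\<^sub>m d) = scal d 1"
  by (rule fmats_eqI[of _ d]) (auto simp: ent_to_fm ent_scal)

lemma to_fm_zero: "to_fm d (0\<^sub>m d d) = (0 :: 'a::comm_monoid_add fm)"
  by (rule fmats_eqI[of _ d]) (auto simp: ent_to_fm)

lemma to_fm_smult_one: "to_fm d (c \<cdot>\<^sub>m 1\<^sub>m d) = scal d (c :: 'a::semiring_1)"
  by (rule fmats_eqI[of _ d]) (auto simp: ent_to_fm ent_scal)

lemma to_fm_a_inv:
  assumes A: "A \<in> carrier_mat d d"
  shows "to_fm d (a_inv (ring_mat TYPE('a::comm_ring_1) d b) A) = - to_fm d A"
proof -
  interpret ring "ring_mat TYPE('a) d b" by (rule ring_mat)
  have "a_inv (ring_mat TYPE('a) d b) A \<in> carrier_mat d d" "a_inv (ring_mat TYPE('a) d b) A + A = 0\<^sub>m d d"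
    using a_inv_closed[of A] l_neg[of A] A by (simp_all add: ring_mat_def)
  then show ?thesis
    using to_fm_add[of "a_inv (ring_mat TYPE('a) d b) A" d A] A by (simp add: to_fm_zero eq_neg_iff_add_eq_0)
qed

definition gen_B :: "nat \<Rightarrow> 'k::field generic_fun fm set" where
  "gen_B d = to_fm d ` carrier (generic_matrix_algebra TYPE('k) d)"

lemma generators_carrier:
  "range (\<lambda>c. gen_const c \<cdot>\<^sub>m 1\<^sub>m d) \<union> generic_matrix d ` {2..} \<subseteq> carrier (generic_mat_ring TYPE('k::field) d)"
  by (auto simp: ring_mat_def generic_matrix_def)

lemma generic_algebra_ring: "ring (generic_matrix_algebra TYPE('k::field) d)"
  and generic_algebra_carrier: "carrier (generic_matrix_algebra TYPE('k::field) d) \<subseteq> carrier_mat d d"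
proof -
  interpret ring "generic_mat_ring TYPE('k) d" by (rule ring_mat)
  show "ring (generic_matrix_algebra TYPE('k) d)"
    unfolding generic_matrix_algebra_def
    by (rule subring_is_ring[OF generate_ring_is_subring[OF generators_carrier]])
  show "carrier (generic_matrix_algebra TYPE('k) d) \<subseteq> carrier_mat d d"
    using generate_ring_in_carrier[OF generators_carrier[of d]]
    by (auto simp: generic_matrix_algebra_def ring_mat_def)
qed

lemma gen_B_fmats: "b \<in> gen_B d \<Longrightarrow> b \<in> fmats d"
  by (auto simp: gen_B_def)

lemma gen_B_poly:
  assumes "b \<in> gen_B d"
  shows "\<exists>P\<in>poly_B d. b = fm_map emb P"
proof -
  interpret ring "generic_mat_ring TYPE('a) d" by (rule ring_mat)
  interpret emb: semiring_hom_fun "emb :: 'a generic_poly \<Rightarrow> _" by (rule emb_hom)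
  from assms obtain A where A: "b = to_fm d A"
    "A \<in> generate_ring (generic_mat_ring TYPE('a) d) (range (\<lambda>c. gen_const c \<cdot>\<^sub>m 1\<^sub>m d) \<union> generic_matrix d ` {2..})"
    by (auto simp: gen_B_def generic_matrix_algebra_def)
  have carr: "C \<in> carrier_mat d d" if "C \<in> generate_ring (generic_mat_ring TYPE('a) d) (range (\<lambda>c. gen_const c \<cdot>\<^sub>m 1\<^sub>m d) \<union> generic_matrix d ` {2..})" for C
    using generate_ring_in_carrier[OF generators_carrier that] by (simp add: ring_mat_def)
  show ?thesis
    unfolding A(1) using A(2)
  proof (induction A rule: generate_ring.induct)
    case one
    have "to_fm d \<one>\<^bsub>generic_mat_ring TYPE('a) d\<^esub> = fm_map emb (scal d 1)"
      by (simp add: ring_mat_def to_fm_one emb.fm_map_scal)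
    then show ?case using poly_B.one by metis
  next
    case (incl C)
    then consider c where "C = gen_const c \<cdot>\<^sub>m 1\<^sub>m d" | r where "C = generic_matrix d r" by auto
    then show ?case
    proof cases
      case 1
      have "to_fm d C = fm_map emb (scal d (Poly_Mapping.single 0 c))"
        by (simp add: 1 to_fm_smult_one emb.fm_map_scal) (simp add: emb_def gen_const_def)
      then show ?thesis using poly_B.const by metis
    next
      case 2
      have "to_fm d C = fm_map emb (pgen d r)"
        by (rule fm_eqI) (auto simp: 2 ent_to_fm generic_matrix_def pgen_def pvar_def emb_def gen_var_def Zero_fract_def)
      then show ?thesis using poly_B.gen by metis
    qed
  next
    case (a_inv C)
    then obtain P where "P \<in> poly_B d" "to_fm d C = fm_map emb P" by blast
    then show ?case
      using to_fm_a_inv[OF carr[OF a_inv.hyps]] fm_map_uminus[OF emb_hom] poly_B.uminus by metis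
  next
    case (eng_add C E)
    then obtain P P' where "P \<in> poly_B d" "to_fm d C = fm_map emb P" "P' \<in> poly_B d" "to_fm d E = fm_map emb P'" by blast
    moreover have "to_fm d (C \<oplus>\<^bsub>generic_mat_ring TYPE('a) d\<^esub> E) = to_fm d C + to_fm d E"
      using to_fm_add[OF carr carr] eng_add.hyps by (simp add: ring_mat_def)
    ultimately show ?case using emb.fm_map_add poly_B.add by metis
  next
    case (eng_mult C E)
    then obtain P P' where "P \<in> poly_B d" "to_fm d C = fm_map emb P" "P' \<in> poly_B d" "to_fm d E = fm_map emb P'" by blast
    moreover have "to_fm d (C \<otimes>\<^bsub>generic_mat_ring TYPE('a) d\<^esub> E) = mm d (to_fm d C) (to_fm d E)"
      using to_fm_mult[OF carr carr] eng_mult.hyps by (simp add: ring_mat_def)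
    ultimately show ?case using emb.fm_map_mult poly_B.mult by metis
  qed
qed

subsection \<open>The embedding\<close>

lemma gen_const_hom: "semiring_hom_fun (gen_const :: 'k::field \<Rightarrow> _)"
proof -
  have "semiring_hom_fun (\<lambda>c::'k. Poly_Mapping.single (0 :: nat \<times> nat \<times> nat \<Rightarrow>\<^sub>0 nat) c)"
    by standard (simp_all add: single_add mult_single)
  from semiring_hom_fun_comp[OF this emb_hom] show ?thesis
    by (simp add: gen_const_def[abs_def] emb_def[abs_def])
qed

text \<open>Writing the embedding as an evaluation makes it comparable with the lift through
  \<open>poly_ev_hom\<close>.\<close>

lemma emb_eq_poly_ev: "emb p = poly_ev gen_const (\<lambda>(i, j, r). gen_var i j r) p"
proof (induction p rule: pm_induct)
  case (single m c)
  interpret c: semiring_hom_fun "gen_const :: 'a \<Rightarrow> _" by (rule gen_const_hom)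
  interpret emb: semiring_hom_fun "emb :: 'a generic_poly \<Rightarrow> _" by (rule emb_hom)
  have mon: "emb (Poly_Mapping.single m (1::'a)) = mon_ev (\<lambda>(i, j, r). gen_var i j r) m" for m
  proof (induction m rule: pm_induct)
    case (single v n)
    obtain i j r where v: "v = (i, j, r)" by (metis prod_cases3)
    have "emb (Poly_Mapping.single (Poly_Mapping.single v n) 1 :: 'a generic_poly) = gen_var i j r ^ n"
    proof (induction n)
      case (Suc n)
      have "(Poly_Mapping.single (Poly_Mapping.single v (Suc n)) 1 :: 'a generic_poly) =
          Poly_Mapping.single (Poly_Mapping.single v 1) 1 * Poly_Mapping.single (Poly_Mapping.single v n) 1"
        by (simp add: mult_single single_add[symmetric])
      moreover have "emb (Poly_Mapping.single (Poly_Mapping.single v 1) 1 :: 'a generic_poly) = gen_var i j r"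
        by (simp add: emb_def gen_var_def v)
      ultimately show ?case using Suc by (simp add: emb.hom_mult)
    qed simp
    then show ?case by (simp add: v)
  next
    case (add m m')
    have "(Poly_Mapping.single (m + m') 1 :: 'a generic_poly) = Poly_Mapping.single m 1 * Poly_Mapping.single m' 1"
      by (simp add: mult_single)
    then show ?case using add by (simp add: emb.hom_mult mon_ev_add)
  qed
  have "emb (Poly_Mapping.single m c) = emb (Poly_Mapping.single 0 c) * emb (Poly_Mapping.single m 1)"
    unfolding emb.hom_mult[symmetric] by (simp add: mult_single)
  also have "\<dots> = gen_const c * mon_ev (\<lambda>(i, j, r). gen_var i j r) m"
    unfolding mon by (simp add: emb_def gen_const_def)
  finally show ?case by (simp only: c.poly_ev_single)
next
  case (add p q)
  interpret c: semiring_hom_fun "gen_const :: 'a \<Rightarrow> _" by (rule gen_const_hom)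
  interpret emb: semiring_hom_fun "emb :: 'a generic_poly \<Rightarrow> _" by (rule emb_hom)
  show ?case using add by (simp add: emb.hom_add c.poly_ev_add)
qed

lemma to_ac_hom: "semiring_hom_fun (to_ac :: 'f::field \<Rightarrow> _)"
  by standard simp_all

text \<open>The generic matrices lift to elements of the quantum torus that become generic again at \<open>t = 1\<close>.\<close>

locale generic_torus = quantum_torus d N m h w
  for d N m h and w :: "'k::field generic_fun alg_closure"
begin

definition lift_gen :: "nat \<Rightarrow> expo \<Rightarrow>\<^sub>0 'k generic_fun alg_closure" where
  "lift_gen r = (SOME f. \<forall>i<d. \<forall>j<d. aug (ent (rep f) i j) = to_ac (gen_var i j r))"

lemma lift_gen: "i < d \<Longrightarrow> j < d \<Longrightarrow> aug (ent (rep (lift_gen r)) i j) = to_ac (gen_var i j r)"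
  unfolding lift_gen_def using someI_ex[OF matrix_rep[of "\<lambda>i j. to_ac (gen_var i j r)"]] by blast

definition lift_const :: "'k \<Rightarrow> expo \<Rightarrow>\<^sub>0 'k generic_fun alg_closure" where
  "lift_const c = Poly_Mapping.single 0 (to_ac (gen_const c))"

text \<open>A variable that occurs in the generic matrices of size \<open>d\<close> becomes the
  corresponding entry of a lifted matrix. The other variables stay constants of the torus, so that
  setting \<open>t = 1\<close> recovers every variable.\<close>

definition lift_var :: "nat \<times> nat \<times> nat \<Rightarrow> expo \<Rightarrow>\<^sub>0 'k generic_fun alg_closure" where
  "lift_var = (\<lambda>(i, j, r). if i < d \<and> j < d then ent (rep (lift_gen r)) i j
     else Poly_Mapping.single 0 (to_ac (gen_var i j r)))"

definition lift :: "'k generic_poly \<Rightarrow> expo \<Rightarrow>\<^sub>0 'k generic_fun alg_closure" where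
  "lift = poly_ev lift_const lift_var"

lemma lift_const_hom: "semiring_hom_fun lift_const"
proof -
  interpret semiring_hom_fun "gen_const :: 'k \<Rightarrow> _" by (rule gen_const_hom)
  show ?thesis
    by standard (simp_all add: lift_const_def hom_add hom_mult single_add mult_single)
qed

lemma lift_hom: "semiring_hom_fun lift"
  unfolding lift_def by (rule semiring_hom_fun.semiring_hom_poly_ev[OF lift_const_hom])

text \<open>Setting \<open>t = 1\<close> undoes the lift on constants and variables, hence on all
  polynomials; this is why the lift is injective.\<close>

lemma aug_lift: "aug (lift p) = to_ac (emb p)"
proof -
  have aug_single: "aug (Poly_Mapping.single g c) = c" for g c by (simp add: aug_def)
  have "aug (lift p) = poly_ev (\<lambda>c. aug (lift_const c)) (\<lambda>v. aug (lift_var v)) p"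
    unfolding lift_def by (rule poly_ev_hom[OF lift_const_hom aug_hom])
  also have "(\<lambda>c. aug (lift_const c)) = (\<lambda>c. to_ac (gen_const c))"
    by (simp add: lift_const_def aug_single)
  also have "(\<lambda>v. aug (lift_var v)) = (\<lambda>v. to_ac ((\<lambda>(i, j, r). gen_var i j r) v))"
    by (auto simp: lift_var_def aug_single lift_gen)
  also have "poly_ev (\<lambda>c. to_ac (gen_const c)) (\<lambda>v. to_ac ((\<lambda>(i, j, r). gen_var i j r) v)) p = to_ac (emb p)"
    unfolding emb_eq_poly_ev by (rule poly_ev_hom[OF gen_const_hom to_ac_hom, symmetric])
  finally show ?thesis .
qed

lemma lift_inject: "lift p = lift q \<longleftrightarrow> p = q"
proof
  assume "lift p = lift q"
  then have "to_ac (emb p) = to_ac (emb q)" by (metis aug_lift)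
  then show "p = q" by (simp add: emb_inject)
qed simp

text \<open>By construction generic matrices go to matrices of the form \<open>rep f\<close>, and
  these are closed under the ring operations.\<close>

lemma lift_matrix: "P \<in> poly_B d \<Longrightarrow> \<exists>f. fm_map lift P = rep f"
proof (induction rule: poly_B.induct)
  interpret lift: semiring_hom_fun lift by (rule lift_hom)
  interpret const: semiring_hom_fun lift_const by (rule lift_const_hom)
  {
    case one
    have "fm_map lift (scal d 1) = rep (Poly_Mapping.single 0 1)"
      unfolding rep_scal by (simp add: lift.fm_map_scal)
    then show ?case ..
  next
    case (const c)
    have "lift (Poly_Mapping.single 0 c) = lift_const c"
      unfolding lift_def by (simp add: const.poly_ev_single)
    then have "fm_map lift (scal d (Poly_Mapping.single 0 c)) = rep (lift_const c)"
      unfolding lift_const_def rep_scal by (simp add: lift.fm_map_scal)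
    then show ?case ..
  next
    case (gen r)
    have "lift (pvar i j r) = lift_var (i, j, r)" for i j
      unfolding lift_def pvar_def by (simp add: const.poly_ev_single)
    then have "fm_map lift (pgen d r) = rep (lift_gen r)"
    proof (intro fmats_eqI[of _ d])
      show "fm_map lift (pgen d r) \<in> fmats d"
        by (rule lift.fm_map_fmats) (auto simp: pgen_def fmats_def)
    qed (simp_all add: pgen_def lift_var_def)
    then show ?case ..
  next
    case (uminus A)
    then obtain f where "fm_map lift A = rep f" by blast
    then show ?case
      by (intro exI[of _ "- f"]) (simp add: fm_map_uminus[OF lift_hom] rep_uminus)
  next
    case (add A B)
    then obtain f g where "fm_map lift A = rep f" "fm_map lift B = rep g" by blast
    then show ?case by (intro exI[of _ "f + g"]) (simp add: lift.fm_map_add rep_add)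
  next
    case (mult A B)
    then obtain f g where "fm_map lift A = rep f" "fm_map lift B = rep g" by blast
    then show ?case by (intro exI[of _ "tw f g"]) (simp add: lift.fm_map_mult rep_tw)
  }
qed

text \<open>The twisted polynomial that represents \<open>b\<close>. The polynomial matrix behind it
  is unique because \<open>emb\<close> is injective, and \<open>rep\<close> is injective too, so the
  choice is harmless.\<close>

definition code :: "'k generic_fun fm \<Rightarrow> expo \<Rightarrow>\<^sub>0 'k generic_fun alg_closure" where
  "code b = (SOME f. \<exists>P\<in>poly_B d. b = fm_map emb P \<and> rep f = fm_map lift P)"

lemma code_ex: "b \<in> gen_B d \<Longrightarrow> \<exists>P\<in>poly_B d. b = fm_map emb P \<and> rep (code b) = fm_map lift P"
proof -
  assume "b \<in> gen_B d"
  then obtain P where P: "P \<in> poly_B d" "b = fm_map emb P" using gen_B_poly by blast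
  then obtain f where "fm_map lift P = rep f" using lift_matrix by blast
  then have "\<exists>f. \<exists>P\<in>poly_B d. b = fm_map emb P \<and> rep f = fm_map lift P"
    using P by (intro exI[of _ f] bexI[of _ P]) simp_all
  from someI_ex[OF this] show ?thesis unfolding code_def .
qed

lemma fm_map_emb_inject: "fm_map emb P = fm_map emb P' \<longleftrightarrow> P = P'"
  by (auto simp: fm_eq_iff emb_inject)

lemma code_mult:
  assumes "b \<in> gen_B d" "c \<in> gen_B d" "mm d b c \<in> gen_B d"
  shows "code (mm d b c) = tw (code b) (code c)"
proof -
  interpret lift: semiring_hom_fun lift by (rule lift_hom)
  interpret emb: semiring_hom_fun "emb :: 'k generic_poly \<Rightarrow> _" by (rule emb_hom)
  obtain P where P: "b = fm_map emb P" "rep (code b) = fm_map lift P" using code_ex[OF assms(1)] by blast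
  obtain P' where P': "c = fm_map emb P'" "rep (code c) = fm_map lift P'" using code_ex[OF assms(2)] by blast
  obtain P'' where P'': "mm d b c = fm_map emb P''" "rep (code (mm d b c)) = fm_map lift P''" using code_ex[OF assms(3)] by blast
  have "P'' = mm d P P'"
    using P''(1) unfolding P(1) P'(1) emb.fm_map_mult[symmetric] fm_map_emb_inject ..
  then have "rep (code (mm d b c)) = rep (tw (code b) (code c))"
    by (simp add: P''(2) rep_tw P(2) P'(2) lift.fm_map_mult)
  then show ?thesis by (simp add: rep_inject)
qed

lemma code_inject:
  assumes "b \<in> gen_B d" "c \<in> gen_B d"
  shows "code b = code c \<longleftrightarrow> b = c"
proof
  obtain P where P: "b = fm_map emb P" "rep (code b) = fm_map lift P" using code_ex[OF assms(1)] by blast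
  obtain P' where P': "c = fm_map emb P'" "rep (code c) = fm_map lift P'" using code_ex[OF assms(2)] by blast
  assume "code b = code c"
  then have "fm_map lift P = fm_map lift P'" using P P' by simp
  then have "P = P'" by (auto simp: fm_eq_iff lift_inject)
  then show "b = c" by (simp add: P P')
qed simp

lemma code_zero: "b \<in> gen_B d \<Longrightarrow> code b = 0 \<longleftrightarrow> b = 0"
proof -
  assume b: "b \<in> gen_B d"
  interpret lift: semiring_hom_fun lift by (rule lift_hom)
  interpret emb: semiring_hom_fun "emb :: 'k generic_poly \<Rightarrow> _" by (rule emb_hom)
  obtain P where P: "b = fm_map emb P" "rep (code b) = fm_map lift P" using code_ex[OF b] by blast
  have "code b = 0 \<longleftrightarrow> fm_map lift P = 0" using P(2) rep_eq_0_iff by metis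
  also have "\<dots> \<longleftrightarrow> P = 0"
    using lift_inject[of _ 0] by (simp add: fm_eq_iff)
  also have "\<dots> \<longleftrightarrow> b = 0"
    unfolding P(1) using emb_inject[of "_ :: 'k generic_poly" 0] by (simp add: fm_eq_iff)
  finally show ?thesis .
qed

text \<open>The absence of zero divisors is inherited from the multiplicativity of leading terms in
  the torus.\<close>

lemma gen_B_no_zero_divisors:
  fixes b c :: "'k generic_fun fm"
  assumes "b \<in> gen_B d" "c \<in> gen_B d" "mm d b c \<in> gen_B d" "mm d b c = 0"
  shows "b = 0 \<or> c = 0"
  using code_mult[OF assms(1-3)] code_zero assms by (metis tw_eq_0_iff)

end

section \<open>The generic matrix algebra\<close>

text \<open>Specializing the generic matrix with index \<open>2 + a\<close> to the matrix unit
  numbered \<open>a\<close> turns the matrix of all entries into the identity, so its determinant is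
  a nonzero polynomial. The shift by 2 reflects that generic matrices are numbered from 2.\<close>

lemma generic_basis_invertible:
  assumes d: "d > 0"
  defines "M \<equiv> mat (d * d) (d * d) (\<lambda>(a, e). gen_var (e div d) (e mod d) (2 + a) :: 'k::field generic_fun)"
  obtains W where "W \<in> carrier_mat (d * d) (d * d)" "W * M = 1\<^sub>m (d * d)" "M * W = 1\<^sub>m (d * d)"
proof -
  define M0 where "M0 = mat (d * d) (d * d) (\<lambda>(a, e). pvar (e div d) (e mod d) (2 + a) :: 'k generic_poly)"
  define ev where "ev = poly_ev (\<lambda>c::'k. c) (\<lambda>(i, j, r). if r = 2 + (i * d + j) then 1 else 0)"
  have id: "semiring_hom_fun (\<lambda>c::'k. c)" by standard simp_all
  interpret ev: semiring_hom_fun ev unfolding ev_def by (rule semiring_hom_fun.semiring_hom_poly_ev[OF id])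
  interpret emb: semiring_hom_fun "emb :: 'k generic_poly \<Rightarrow> _" by (rule emb_hom)
  interpret ev': comm_ring_hom ev by unfold_locales (simp_all add: ev.hom_add ev.hom_mult)
  interpret emb': comm_ring_hom "emb :: 'k generic_poly \<Rightarrow> _" by unfold_locales (simp_all add: emb.hom_add emb.hom_mult)
  have "map_mat ev M0 = 1\<^sub>m (d * d)"
  proof (rule eq_matI)
    fix a e assume ae: "a < dim_row (1\<^sub>m (d * d) :: 'k mat)" "e < dim_col (1\<^sub>m (d * d) :: 'k mat)"
    have "ev (pvar (e div d) (e mod d) (2 + a)) = (if 2 + a = 2 + e then 1 else 0)"
      unfolding ev_def pvar_def by (subst semiring_hom_fun.poly_ev_single[OF id]) simp
    then show "map_mat ev M0 $$ (a, e) = 1\<^sub>m (d * d) $$ (a, e)"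
      using ae by (simp add: M0_def)
  qed (simp_all add: M0_def)
  then have "ev (det M0) = 1" using ev'.hom_det[of M0] by simp
  then have "det M0 \<noteq> 0" by auto
  moreover have "M = map_mat emb M0"
    by (rule eq_matI) (simp_all add: M_def M0_def emb_def gen_var_def pvar_def)
  ultimately have "det M \<noteq> 0"
    using emb'.hom_det[of M0] emb_inject[of "det M0" 0] by simp
  moreover have M: "M \<in> carrier_mat (d * d) (d * d)" by (simp add: M_def)
  ultimately have "M \<in> Units (ring_mat TYPE('k generic_fun) (d * d) ())" by (rule det_non_zero_imp_unit[rotated])
  then show ?thesis using that by (auto simp: Units_def ring_mat_def)
qed

lemma to_fm_generic_matrix: "ent (to_fm d (generic_matrix d r)) i j = (if i < d \<and> j < d then gen_var i j r else 0)"
  by (simp add: ent_to_fm generic_matrix_def)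

lemma gen_B_closed:
  fixes b c :: "'k::field generic_fun fm"
  shows "scal d 1 \<in> (gen_B d :: 'k generic_fun fm set)"
    and "b \<in> gen_B d \<Longrightarrow> c \<in> gen_B d \<Longrightarrow> b + c \<in> gen_B d"
    and "b \<in> gen_B d \<Longrightarrow> - b \<in> gen_B d"
    and "b \<in> gen_B d \<Longrightarrow> c \<in> gen_B d \<Longrightarrow> mm d b c \<in> gen_B d"
    and "r \<ge> 2 \<Longrightarrow> to_fm d (generic_matrix d r) \<in> (gen_B d :: 'k generic_fun fm set)"
proof -
  let ?A = "generic_matrix_algebra TYPE('k) d"
  interpret ring ?A by (rule generic_algebra_ring)
  have carr: "A \<in> carrier_mat d d" if "A \<in> carrier ?A" for A
    using that generic_algebra_carrier by blast
  have ops: "monoid.mult ?A = (*)" "ring.add ?A = (+)" "monoid.one ?A = 1\<^sub>m d" "ring.zero ?A = 0\<^sub>m d d"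
    by (simp_all add: generic_matrix_algebra_def ring_mat_def)
  show "scal d 1 \<in> (gen_B d :: 'k generic_fun fm set)"
    using imageI[OF one_closed, of "to_fm d"] unfolding gen_B_def ops to_fm_one .
  show "b + c \<in> gen_B d" if "b \<in> gen_B d" "c \<in> gen_B d"
  proof -
    from that obtain A C where A: "A \<in> carrier ?A" "b = to_fm d A" and C: "C \<in> carrier ?A" "c = to_fm d C"
      unfolding gen_B_def by (elim imageE) blast
    have "b + c = to_fm d (A + C)" unfolding A(2) C(2) by (rule to_fm_add[OF carr[OF A(1)] carr[OF C(1)], symmetric])
    moreover have "A + C \<in> carrier ?A" using a_closed[OF A(1) C(1)] unfolding ops .
    ultimately show ?thesis by (simp add: gen_B_def)
  qed
  show "mm d b c \<in> gen_B d" if "b \<in> gen_B d" "c \<in> gen_B d"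
  proof -
    from that obtain A C where A: "A \<in> carrier ?A" "b = to_fm d A" and C: "C \<in> carrier ?A" "c = to_fm d C"
      unfolding gen_B_def by (elim imageE) blast
    have "mm d b c = to_fm d (A * C)" unfolding A(2) C(2) by (rule to_fm_mult[OF carr[OF A(1)] carr[OF C(1)], symmetric])
    moreover have "A * C \<in> carrier ?A" using m_closed[OF A(1) C(1)] unfolding ops .
    ultimately show ?thesis by (simp add: gen_B_def)
  qed
  show "- b \<in> gen_B d" if "b \<in> gen_B d"
  proof -
    from that obtain A where A: "A \<in> carrier ?A" "b = to_fm d A" unfolding gen_B_def by (elim imageE) blast
    have "to_fm d (\<ominus>\<^bsub>?A\<^esub> A) + to_fm d A = 0"
      using arg_cong[OF l_neg[OF A(1)], of "to_fm d"] unfolding ops to_fm_add[OF carr[OF a_inv_closed[OF A(1)]] carr[OF A(1)]] to_fm_zero .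
    then have "- b = to_fm d (\<ominus>\<^bsub>?A\<^esub> A)" unfolding A(2) by (rule Groups.minus_unique[OF trans[OF Groups.ab_semigroup_add_class.add.commute]])
    then show ?thesis using A by (simp add: gen_B_def)
  qed
  show "to_fm d (generic_matrix d r) \<in> (gen_B d :: 'k generic_fun fm set)" if "r \<ge> 2"
    unfolding gen_B_def using that
    by (auto simp: generic_matrix_algebra_def intro!: imageI generate_ring.incl)
qed

lemma sum_div_mod:
  assumes "i < d" "j < (d::nat)"
  shows "i * d + j < d * d" "(i * d + j) div d = i" "(i * d + j) mod d = j"
proof -
  have "i * d + j < (i + 1) * d" using assms by simp
  also have "\<dots> \<le> d * d" using assms by (intro mult_right_mono) auto
  finally show "i * d + j < d * d" .
qed (use assms in auto)

text \<open>The position \<open>(i, j)\<close> is encoded as \<open>i * d + j\<close>. The inverse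
  of the matrix of entries yields the coefficients for spanning as well as independence; the torus
  excludes zero divisors.\<close>

lemma (in generic_torus) gen_B_matrix_domain:
  "matrix_domain d (d * d) (gen_B d :: 'k generic_fun fm set) (\<lambda>a. to_fm d (generic_matrix d (2 + a)))"
proof
  define M where "M = mat (d * d) (d * d) (\<lambda>(a, e). gen_var (e div d) (e mod d) (2 + a) :: 'k generic_fun)"
  obtain W where W: "W \<in> carrier_mat (d * d) (d * d)" "W * M = 1\<^sub>m (d * d)" "M * W = 1\<^sub>m (d * d)"
    unfolding M_def by (rule generic_basis_invertible[OF d_pos])
  have WM: "(\<Sum>a<d * d. W $$ (e, a) * M $$ (a, e')) = (if e = e' then 1 else 0)" if "e < d * d" "e' < d * d" for e e'
    using arg_cong[OF W(2), of "\<lambda>A. A $$ (e, e')"] that W(1) by (simp add: M_def scalar_prod_def atLeast0LessThan)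
  have MW: "(\<Sum>e<d * d. M $$ (a, e) * W $$ (e, a')) = (if a = a' then 1 else 0)" if "a < d * d" "a' < d * d" for a a'
    using arg_cong[OF W(3), of "\<lambda>A. A $$ (a, a')"] that W(1) by (simp add: M_def scalar_prod_def atLeast0LessThan)
  have entM: "ent (to_fm d (generic_matrix d (2 + a))) (e div d) (e mod d) = M $$ (a, e)" if "a < d * d" "e < d * d" for a e
  proof -
    have "e div d < d" "e mod d < d" using that d_pos by (auto simp: less_mult_imp_div_less)
    then show ?thesis using that by (simp add: to_fm_generic_matrix M_def)
  qed
  show "\<exists>c. z = (\<Sum>a<d * d. smul (c a) (to_fm d (generic_matrix d (2 + a))))"
    if z: "z \<in> fmats d" for z :: "'k generic_fun fm"
  proof (intro exI fmats_eqI[OF z])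
    define v where "v e = ent z (e div d) (e mod d)" for e
    fix i j assume ij: "i < d" "j < d"
    let ?e = "i * d + j"
    note e = sum_div_mod[OF ij]
    have "ent (\<Sum>a<d * d. smul (\<Sum>e<d * d. v e * W $$ (e, a)) (to_fm d (generic_matrix d (2 + a)))) i j
        = (\<Sum>a<d * d. \<Sum>e<d * d. v e * (W $$ (e, a) * M $$ (a, ?e)))"
      unfolding ent_sum ent_smul using entM[of _ ?e] e by (intro sum.cong refl) (simp add: sum_distrib_right mult.assoc)
    also have "\<dots> = (\<Sum>e<d * d. \<Sum>a<d * d. v e * (W $$ (e, a) * M $$ (a, ?e)))"
      by (rule sum.swap)
    also have "\<dots> = (\<Sum>e<d * d. if e = ?e then v e else 0)"
      unfolding sum_distrib_left[symmetric] using WM e(1) by (intro sum.cong refl) simp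
    also have "\<dots> = ent z i j" using e by (simp add: v_def)
    finally show "ent z i j = ent (\<Sum>a<d * d. smul (\<Sum>e<d * d. v e * W $$ (e, a)) (to_fm d (generic_matrix d (2 + a)))) i j" ..
  qed auto
  show "c b = 0" if c: "(\<Sum>a<d * d. smul (c a) (to_fm d (generic_matrix d (2 + a)))) = 0" and b: "b < d * d"
    for c :: "nat \<Rightarrow> 'k generic_fun" and b
  proof -
    have zero: "(\<Sum>a<d * d. c a * M $$ (a, e)) = 0" if "e < d * d" for e
    proof -
      have "(\<Sum>a<d * d. c a * M $$ (a, e)) = ent (\<Sum>a<d * d. smul (c a) (to_fm d (generic_matrix d (2 + a)))) (e div d) (e mod d)"
        unfolding ent_sum ent_smul using entM that by (intro sum.cong refl) simp
      then show ?thesis unfolding c by simp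
    qed
    have "c b = (\<Sum>a<d * d. if a = b then c a else 0)" using b by simp
    also have "\<dots> = (\<Sum>a<d * d. \<Sum>e<d * d. c a * (M $$ (a, e) * W $$ (e, b)))"
      unfolding sum_distrib_left[symmetric] using MW b by (intro sum.cong refl) simp
    also have "\<dots> = (\<Sum>e<d * d. \<Sum>a<d * d. c a * (M $$ (a, e) * W $$ (e, b)))"
      by (rule sum.swap)
    also have "\<dots> = (\<Sum>e<d * d. (\<Sum>a<d * d. c a * M $$ (a, e)) * W $$ (e, b))"
      by (simp add: sum_distrib_right mult.assoc)
    also have "\<dots> = 0" using zero by simp
    finally show ?thesis .
  qed
  show "a = 0 \<or> b = 0" if "a \<in> gen_B d" "b \<in> gen_B d" "mm d a b = 0" for a b :: "'k generic_fun fm"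
    using gen_B_no_zero_divisors[OF that(1,2) _ that(3)] gen_B_closed(4)[OF that(1,2)] by blast
  show "to_fm d (generic_matrix d (2 + n)) \<in> (gen_B d :: 'k generic_fun fm set)" for n
    by (rule gen_B_closed(5)) simp
qed (use d_pos gen_B_closed(1-4) gen_B_fmats in auto)

section \<open>Central localization as a tensor product\<close>

lemma free_pair_ring_simps [simp]:
  "carrier (free_pair_ring A C) = {f. Poly_Mapping.keys f \<subseteq> carrier A \<times> carrier C}"
  "monoid.one (free_pair_ring A C) = frag_of (\<one>\<^bsub>A\<^esub>, \<one>\<^bsub>C\<^esub>)"
  "ring.zero (free_pair_ring A C) = 0"
  "ring.add (free_pair_ring A C) = (+)"
  by (auto simp: free_pair_ring_def)

lemma free_pair_mult_simps [simp]:
  "frag_of (a, b) \<otimes>\<^bsub>free_pair_ring A C\<^esub> frag_of (a', b') = frag_of (a \<otimes>\<^bsub>A\<^esub> a', b \<otimes>\<^bsub>C\<^esub> b')"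
  "0 \<otimes>\<^bsub>free_pair_ring A C\<^esub> f = 0" "f \<otimes>\<^bsub>free_pair_ring A C\<^esub> 0 = 0"
  by (simp_all add: free_pair_ring_def frag_extend_eq_0 split: prod.split)

text \<open>Additivity in the first factor is built into \<open>frag_extend\<close>; in the second
  factor it takes an induction over the first.\<close>

lemma free_pair_mult_diff:
  "(f - g) \<otimes>\<^bsub>free_pair_ring A C\<^esub> h = f \<otimes>\<^bsub>free_pair_ring A C\<^esub> h - g \<otimes>\<^bsub>free_pair_ring A C\<^esub> h"
  "h \<otimes>\<^bsub>free_pair_ring A C\<^esub> (f - g) = h \<otimes>\<^bsub>free_pair_ring A C\<^esub> f - h \<otimes>\<^bsub>free_pair_ring A C\<^esub> g"
proof -
  show "(f - g) \<otimes>\<^bsub>free_pair_ring A C\<^esub> h = f \<otimes>\<^bsub>free_pair_ring A C\<^esub> h - g \<otimes>\<^bsub>free_pair_ring A C\<^esub> h"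
    by (simp add: free_pair_ring_def frag_extend_diff)
  show "h \<otimes>\<^bsub>free_pair_ring A C\<^esub> (f - g) = h \<otimes>\<^bsub>free_pair_ring A C\<^esub> f - h \<otimes>\<^bsub>free_pair_ring A C\<^esub> g"
    using subset_UNIV[of "Poly_Mapping.keys h"]
  proof (induction h rule: frag_induction)
    case (diff a b)
    then show ?case by (simp add: free_pair_ring_def frag_extend_diff)
  qed (auto simp: free_pair_ring_def frag_extend_diff)
qed

lemma free_pair_mult_add:
  "(f + g) \<otimes>\<^bsub>free_pair_ring A C\<^esub> h = f \<otimes>\<^bsub>free_pair_ring A C\<^esub> h + g \<otimes>\<^bsub>free_pair_ring A C\<^esub> h"
  "h \<otimes>\<^bsub>free_pair_ring A C\<^esub> (f + g) = h \<otimes>\<^bsub>free_pair_ring A C\<^esub> f + h \<otimes>\<^bsub>free_pair_ring A C\<^esub> g"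
  using free_pair_mult_diff(1)[where f = "f + g" and g = g and h = h and A = A and C = C]
    free_pair_mult_diff(2)[where f = "f + g" and g = g and h = h and A = A and C = C]
  by (simp_all add: algebra_simps)

lemma keys_diff_subset: "Poly_Mapping.keys f \<subseteq> S \<Longrightarrow> Poly_Mapping.keys g \<subseteq> S \<Longrightarrow> Poly_Mapping.keys (f - g :: _ \<Rightarrow>\<^sub>0 int) \<subseteq> S"
  using keys_diff[of f g] by blast

lemma free_pair_ring_ring:
  assumes A: "monoid A" and C: "monoid C"
  shows "ring (free_pair_ring A C)"
proof -
  interpret A: monoid A by fact
  interpret C: monoid C by fact
  let ?P = "free_pair_ring A C" and ?S = "carrier A \<times> carrier C"
  have closed: "Poly_Mapping.keys (f \<otimes>\<^bsub>?P\<^esub> g) \<subseteq> ?S"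
    if f: "Poly_Mapping.keys f \<subseteq> ?S" and g: "Poly_Mapping.keys g \<subseteq> ?S" for f g
    using f
  proof (induction f rule: frag_induction)
    case (one x)
    show ?case using g
    proof (induction g rule: frag_induction)
      case (one y)
      show ?case using \<open>x \<in> ?S\<close> \<open>y \<in> ?S\<close> by (cases x; cases y) auto
    qed (simp_all add: free_pair_mult_diff keys_diff_subset)
  qed (simp_all add: free_pair_mult_diff keys_diff_subset)
  have assoc: "(f \<otimes>\<^bsub>?P\<^esub> g) \<otimes>\<^bsub>?P\<^esub> h = f \<otimes>\<^bsub>?P\<^esub> (g \<otimes>\<^bsub>?P\<^esub> h)"
    if f: "Poly_Mapping.keys f \<subseteq> ?S" and g: "Poly_Mapping.keys g \<subseteq> ?S" and h: "Poly_Mapping.keys h \<subseteq> ?S" for f g h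
    using f
  proof (induction f rule: frag_induction)
    case (one x)
    show ?case using g
    proof (induction g rule: frag_induction)
      case (one y)
      show ?case using h
      proof (induction h rule: frag_induction)
        case (one z)
        show ?case using \<open>x \<in> ?S\<close> \<open>y \<in> ?S\<close> \<open>z \<in> ?S\<close>
          by (cases x; cases y; cases z) (auto simp: A.m_assoc C.m_assoc)
      qed (simp_all add: free_pair_mult_diff)
    qed (simp_all add: free_pair_mult_diff)
  qed (simp_all add: free_pair_mult_diff)
  have unit: "frag_of (\<one>\<^bsub>A\<^esub>, \<one>\<^bsub>C\<^esub>) \<otimes>\<^bsub>?P\<^esub> f = f \<and> f \<otimes>\<^bsub>?P\<^esub> frag_of (\<one>\<^bsub>A\<^esub>, \<one>\<^bsub>C\<^esub>) = f"
    if f: "Poly_Mapping.keys f \<subseteq> ?S" for f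
    using f
  proof (induction f rule: frag_induction)
    case (one x)
    then show ?case by (cases x) auto
  qed (simp_all add: free_pair_mult_diff)
  show ?thesis
  proof (rule ringI)
    show "abelian_group ?P"
    proof (rule abelian_groupI)
      show "\<exists>g\<in>carrier ?P. g \<oplus>\<^bsub>?P\<^esub> f = \<zero>\<^bsub>?P\<^esub>" if "f \<in> carrier ?P" for f
        using that by (intro bexI[of _ "- f"]) auto
      show "f \<oplus>\<^bsub>?P\<^esub> g \<in> carrier ?P" if "f \<in> carrier ?P" "g \<in> carrier ?P" for f g
        using that Poly_Mapping.keys_add[of f g] by auto
    qed (auto simp: ac_simps)
    show "monoid ?P"
      using closed assoc unit by (intro monoidI) auto
  qed (simp_all add: free_pair_mult_add)
qed

text \<open>\<open>\<theta>\<close> identifies the ring \<open>A\<close>, from which the tensor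
  product is built, with the matrices \<open>B\<close> over the ambient field.\<close>

locale central_localization = matrix_domain d N B x + A: ring A
  for d N and B :: "'f::field fm set" and x :: "nat \<Rightarrow> 'f fm" and A :: "'a ring" +
  fixes \<theta> :: "'a \<Rightarrow> 'f fm"
  assumes \<theta>_inj: "inj_on \<theta> (carrier A)"
    and \<theta>_image: "\<theta> ` carrier A = B"
    and \<theta>_mult: "a \<in> carrier A \<Longrightarrow> b \<in> carrier A \<Longrightarrow> \<theta> (a \<otimes>\<^bsub>A\<^esub> b) = mm d (\<theta> a) (\<theta> b)"
    and \<theta>_add: "a \<in> carrier A \<Longrightarrow> b \<in> carrier A \<Longrightarrow> \<theta> (a \<oplus>\<^bsub>A\<^esub> b) = \<theta> a + \<theta> b"
    and \<theta>_one: "\<theta> \<one>\<^bsub>A\<^esub> = scal d 1"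
    and \<theta>_zero: "\<theta> \<zero>\<^bsub>A\<^esub> = 0"
begin

section \<open>The center and its scalars\<close>

definition Z :: "'a ring" where
  "Z = A\<lparr>carrier := ring_center A\<rparr>"

lemma Z_simps [simp]:
  "carrier Z = ring_center A" "monoid.mult Z = monoid.mult A" "ring.add Z = ring.add A" "monoid.one Z = monoid.one A" "ring.zero Z = ring.zero A"
  by (simp_all add: Z_def)

definition val :: "'a \<Rightarrow> 'f" where
  "val z = ent (\<theta> z) 0 0"

lemma \<theta>_B: "a \<in> carrier A \<Longrightarrow> \<theta> a \<in> B"
  using \<theta>_image by blast

lemma B_E: "b \<in> B \<Longrightarrow> \<exists>a\<in>carrier A. \<theta> a = b"
  unfolding \<theta>_image[symmetric] by (elim imageE) blast

lemma \<theta>_eq: "a \<in> carrier A \<Longrightarrow> b \<in> carrier A \<Longrightarrow> \<theta> a = \<theta> b \<longleftrightarrow> a = b"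
  using \<theta>_inj by (rule inj_on_eq_iff)

lemma val_scal: "\<theta> z = scal d c \<Longrightarrow> val z = c"
  using d_pos by (simp add: val_def ent_scal)

lemma center_carrier: "z \<in> ring_center A \<Longrightarrow> z \<in> carrier A"
  by (simp add: ring_center_def)

text \<open>Commuting with \<open>B\<close> extends to commuting with \<open>Q\<close> by cancelling
  a scalar denominator, and the center of \<open>Q\<close> consists of scalars.\<close>

lemma \<theta>_center: "z \<in> ring_center A \<Longrightarrow> \<theta> z = scal d (val z)"
proof -
  assume z: "z \<in> ring_center A"
  have B: "mm d (\<theta> z) b = mm d b (\<theta> z)" if "b \<in> B" for b
  proof -
    from B_E[OF that] obtain a where a: "a \<in> carrier A" "b = \<theta> a" by metis
    then have "z \<otimes>\<^bsub>A\<^esub> a = a \<otimes>\<^bsub>A\<^esub> z" using z by (simp add: ring_center_def)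
    then show ?thesis using \<theta>_mult[of z a] \<theta>_mult[of a z] z a by (simp add: ring_center_def)
  qed
  have "mm d (\<theta> z) y = mm d y (\<theta> z)" if "y \<in> Q" for y
  proof -
    from that obtain s where s: "s \<noteq> 0" "scal d s \<in> B" "smul s y \<in> B" by (rule Q_E)
    have "smul s (mm d (\<theta> z) y) = smul s (mm d y (\<theta> z))"
      using B[OF s(3)] by (simp add: mm_smul_left mm_smul_right)
    then show ?thesis using s(1) by (simp add: fm_eq_iff)
  qed
  then have "\<theta> z \<in> ring_center QR"
    using B_Q[OF \<theta>_B[OF center_carrier[OF z]]] by (simp add: ring_center_def)
  then obtain c where "\<theta> z = scal d c" unfolding center_QR scalars_def by blast
  then show ?thesis using val_scal by metis
qed

lemma center_if_scal: "z \<in> carrier A \<Longrightarrow> \<theta> z = scal d c \<Longrightarrow> z \<in> ring_center A"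
proof -
  assume z: "z \<in> carrier A" "\<theta> z = scal d c"
  have "z \<otimes>\<^bsub>A\<^esub> a = a \<otimes>\<^bsub>A\<^esub> z" if a: "a \<in> carrier A" for a
  proof -
    have "\<theta> (z \<otimes>\<^bsub>A\<^esub> a) = \<theta> (a \<otimes>\<^bsub>A\<^esub> z)"
      using B_fmats[OF \<theta>_B[OF a]] by (simp add: \<theta>_mult z a mm_scal_left mm_scal_right)
    then show ?thesis using a z by (simp add: \<theta>_eq)
  qed
  then show ?thesis using z by (simp add: ring_center_def)
qed

lemma center_ex: "scal d c \<in> B \<Longrightarrow> \<exists>z\<in>ring_center A. val z = c"
  using center_if_scal val_scal by (elim B_E[THEN bexE]) (rule bexI)

lemma val_inject: "y \<in> ring_center A \<Longrightarrow> z \<in> ring_center A \<Longrightarrow> val y = val z \<longleftrightarrow> y = z"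
  using \<theta>_center \<theta>_eq center_carrier by metis

lemma val_mult: "y \<in> ring_center A \<Longrightarrow> z \<in> ring_center A \<Longrightarrow> y \<otimes>\<^bsub>A\<^esub> z \<in> ring_center A \<and> val (y \<otimes>\<^bsub>A\<^esub> z) = val y * val z"
proof -
  assume yz: "y \<in> ring_center A" "z \<in> ring_center A"
  have "\<theta> (y \<otimes>\<^bsub>A\<^esub> z) = scal d (val y * val z)"
    using yz by (simp add: \<theta>_mult center_carrier \<theta>_center mult.commute)
  then show ?thesis using yz center_if_scal val_scal center_carrier by blast
qed

lemma val_add: "y \<in> ring_center A \<Longrightarrow> z \<in> ring_center A \<Longrightarrow> y \<oplus>\<^bsub>A\<^esub> z \<in> ring_center A \<and> val (y \<oplus>\<^bsub>A\<^esub> z) = val y + val z"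
proof -
  assume yz: "y \<in> ring_center A" "z \<in> ring_center A"
  have "\<theta> (y \<oplus>\<^bsub>A\<^esub> z) = scal d (val y + val z)"
    using yz by (simp add: \<theta>_add center_carrier \<theta>_center scal_add)
  then show ?thesis using yz center_if_scal val_scal center_carrier by blast
qed

lemma val_one: "\<one>\<^bsub>A\<^esub> \<in> ring_center A" "val \<one>\<^bsub>A\<^esub> = 1"
  using center_if_scal[OF A.one_closed \<theta>_one] val_scal[OF \<theta>_one] by simp_all

lemma val_zero: "\<zero>\<^bsub>A\<^esub> \<in> ring_center A" "val \<zero>\<^bsub>A\<^esub> = 0"
proof -
  have "\<theta> \<zero>\<^bsub>A\<^esub> = scal d 0" by (simp add: \<theta>_zero)
  from center_if_scal[OF A.zero_closed this] val_scal[OF this]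
  show "\<zero>\<^bsub>A\<^esub> \<in> ring_center A" "val \<zero>\<^bsub>A\<^esub> = 0" .
qed

section \<open>The fraction field of the center\<close>

definition Z0 :: "'a set" where "Z0 = ring_center A - {\<zero>\<^bsub>A\<^esub>}"

lemma Z0_iff: "z \<in> Z0 \<longleftrightarrow> z \<in> ring_center A \<and> val z \<noteq> 0"
  using val_inject[of z "\<zero>\<^bsub>A\<^esub>"] val_zero by (auto simp: Z0_def)

lemma Z0_mult: "s \<in> Z0 \<Longrightarrow> t \<in> Z0 \<Longrightarrow> s \<otimes>\<^bsub>A\<^esub> t \<in> Z0"
  using val_mult by (auto simp: Z0_iff)

lemma one_Z0: "\<one>\<^bsub>A\<^esub> \<in> Z0"
  using val_one by (simp add: Z0_iff)

abbreviation fc :: "'a \<Rightarrow> 'a \<Rightarrow> ('a \<times> 'a) set" where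
  "fc \<equiv> frac_class Z"

text \<open>A class of fractions is determined by the quotient of scalars in the ambient field, so
  arithmetic of classes becomes arithmetic there.\<close>

lemma frac_class_val:
  assumes "a \<in> ring_center A" "s \<in> Z0"
  shows "fc a s = {(b, t). b \<in> ring_center A \<and> t \<in> Z0 \<and> val b / val t = val a / val s}"
proof -
  have "a \<otimes>\<^bsub>A\<^esub> t = b \<otimes>\<^bsub>A\<^esub> s \<longleftrightarrow> val b / val t = val a / val s" if "b \<in> ring_center A" "t \<in> Z0" for b t
  proof -
    have "a \<otimes>\<^bsub>A\<^esub> t = b \<otimes>\<^bsub>A\<^esub> s \<longleftrightarrow> val a * val t = val b * val s"
      using val_inject[of "a \<otimes>\<^bsub>A\<^esub> t" "b \<otimes>\<^bsub>A\<^esub> s"] val_mult[of a t] val_mult[of b s] assms that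
      by (auto simp: Z0_iff)
    then show ?thesis using assms that by (auto simp: Z0_iff field_simps)
  qed
  then show ?thesis
    using assms by (auto simp: frac_class_def frac_rel_def Z0_def)
qed

abbreviation Fr :: "('a \<times> 'a) set ring" where
  "Fr \<equiv> fraction_field Z"

definition fval :: "('a \<times> 'a) set \<Rightarrow> 'f" where
  "fval q = (SOME c. \<exists>(b, t)\<in>q. c = val b / val t)"

lemma fval_frac_class: "a \<in> ring_center A \<Longrightarrow> s \<in> Z0 \<Longrightarrow> fval (fc a s) = val a / val s"
  unfolding fval_def by (rule some_equality) (auto simp: frac_class_val)

lemma Fr_carrierE:
  assumes "q \<in> carrier Fr"
  obtains a s where "a \<in> ring_center A" "s \<in> Z0" "q = fc a s"
  using assms by (auto simp: fraction_field_def quotient_def frac_class_def Z0_def)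

lemma frac_class_Fr: "a \<in> ring_center A \<Longrightarrow> s \<in> Z0 \<Longrightarrow> fc a s \<in> carrier Fr"
  by (auto simp: fraction_field_def quotient_def frac_class_def Z0_def)

lemma frac_class_eq:
  "a \<in> ring_center A \<Longrightarrow> s \<in> Z0 \<Longrightarrow> b \<in> ring_center A \<Longrightarrow> t \<in> Z0 \<Longrightarrow> fc a s = fc b t \<longleftrightarrow> val a / val s = val b / val t"
  using fval_frac_class[of a s] fval_frac_class[of b t] by (auto simp: frac_class_val)

lemma fval_inject: "q \<in> carrier Fr \<Longrightarrow> r \<in> carrier Fr \<Longrightarrow> fval q = fval r \<longleftrightarrow> q = r"
  by (elim Fr_carrierE) (simp add: fval_frac_class frac_class_eq)

lemma frac_class_mem:
  "a \<in> ring_center A \<Longrightarrow> s \<in> Z0 \<Longrightarrow> (b, t) \<in> fc a s \<Longrightarrow> b \<in> ring_center A \<and> t \<in> Z0 \<and> val b / val t = val a / val s"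
  by (simp add: frac_class_val)

lemma frac_class_self: "a \<in> ring_center A \<Longrightarrow> s \<in> Z0 \<Longrightarrow> (a, s) \<in> fc a s"
  by (simp add: frac_class_val)

text \<open>The product is a union over all pairs of representatives. Each pair gives the same
  class, and there is at least one pair.\<close>

lemma frac_mult:
  assumes "a \<in> ring_center A" "s \<in> Z0" "b \<in> ring_center A" "t \<in> Z0"
  shows "fc a s \<otimes>\<^bsub>Fr\<^esub> fc b t = fc (a \<otimes>\<^bsub>A\<^esub> b) (s \<otimes>\<^bsub>A\<^esub> t)"
proof -
  have eq: "fc (a' \<otimes>\<^bsub>A\<^esub> b') (s' \<otimes>\<^bsub>A\<^esub> t') = fc (a \<otimes>\<^bsub>A\<^esub> b) (s \<otimes>\<^bsub>A\<^esub> t)"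
    if "(a', s') \<in> fc a s" "(b', t') \<in> fc b t" for a' s' b' t'
  proof -
    note m = frac_class_mem[OF assms(1,2) that(1)] frac_class_mem[OF assms(3,4) that(2)]
    have "val a' / val s' * (val b' / val t') = val a / val s * (val b / val t)" using m by simp
    then have quo: "val a' * val b' / (val s' * val t') = val a * val b / (val s * val t)"
      unfolding times_divide_times_eq .
    have Z: "s \<in> ring_center A" "t \<in> ring_center A" "s' \<in> ring_center A" "t' \<in> ring_center A"
      using assms m by (simp_all add: Z0_iff)
    show ?thesis
      using assms m Z by (subst frac_class_eq) (simp_all only: val_mult Z0_mult quo)
  qed
  have "fc a s \<otimes>\<^bsub>Fr\<^esub> fc b t = (\<Union>(a', s')\<in>fc a s. \<Union>(b', t')\<in>fc b t. fc (a' \<otimes>\<^bsub>A\<^esub> b') (s' \<otimes>\<^bsub>A\<^esub> t'))"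
    by (simp add: fraction_field_def)
  also have "\<dots> = (\<Union>_\<in>fc a s. \<Union>_\<in>fc b t. fc (a \<otimes>\<^bsub>A\<^esub> b) (s \<otimes>\<^bsub>A\<^esub> t))"
    by (intro SUP_cong refl) (auto simp: eq)
  also have "\<dots> = fc (a \<otimes>\<^bsub>A\<^esub> b) (s \<otimes>\<^bsub>A\<^esub> t)"
    using frac_class_self[OF assms(1,2)] frac_class_self[OF assms(3,4)] by auto
  finally show ?thesis .
qed

lemma frac_add:
  assumes "a \<in> ring_center A" "s \<in> Z0" "b \<in> ring_center A" "t \<in> Z0"
  shows "fc a s \<oplus>\<^bsub>Fr\<^esub> fc b t = fc (a \<otimes>\<^bsub>A\<^esub> t \<oplus>\<^bsub>A\<^esub> b \<otimes>\<^bsub>A\<^esub> s) (s \<otimes>\<^bsub>A\<^esub> t)"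
proof -
  have val_num: "val (a \<otimes>\<^bsub>A\<^esub> t \<oplus>\<^bsub>A\<^esub> b \<otimes>\<^bsub>A\<^esub> s) / val (s \<otimes>\<^bsub>A\<^esub> t) = val a / val s + val b / val t"
    "a \<otimes>\<^bsub>A\<^esub> t \<oplus>\<^bsub>A\<^esub> b \<otimes>\<^bsub>A\<^esub> s \<in> ring_center A"
    if "a \<in> ring_center A" "s \<in> Z0" "b \<in> ring_center A" "t \<in> Z0" for a s b t
    using that val_mult val_add by (auto simp: Z0_iff add_frac_eq)
  have eq: "fc (a' \<otimes>\<^bsub>A\<^esub> t' \<oplus>\<^bsub>A\<^esub> b' \<otimes>\<^bsub>A\<^esub> s') (s' \<otimes>\<^bsub>A\<^esub> t') = fc (a \<otimes>\<^bsub>A\<^esub> t \<oplus>\<^bsub>A\<^esub> b \<otimes>\<^bsub>A\<^esub> s) (s \<otimes>\<^bsub>A\<^esub> t)"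
    if "(a', s') \<in> fc a s" "(b', t') \<in> fc b t" for a' s' b' t'
  proof -
    note m = frac_class_mem[OF assms(1,2) that(1)] frac_class_mem[OF assms(3,4) that(2)]
    show ?thesis
      using assms m Z0_mult val_num by (subst frac_class_eq) auto
  qed
  have "fc a s \<oplus>\<^bsub>Fr\<^esub> fc b t = (\<Union>(a', s')\<in>fc a s. \<Union>(b', t')\<in>fc b t. fc (a' \<otimes>\<^bsub>A\<^esub> t' \<oplus>\<^bsub>A\<^esub> b' \<otimes>\<^bsub>A\<^esub> s') (s' \<otimes>\<^bsub>A\<^esub> t'))"
    by (simp add: fraction_field_def)
  also have "\<dots> = (\<Union>_\<in>fc a s. \<Union>_\<in>fc b t. fc (a \<otimes>\<^bsub>A\<^esub> t \<oplus>\<^bsub>A\<^esub> b \<otimes>\<^bsub>A\<^esub> s) (s \<otimes>\<^bsub>A\<^esub> t))"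
    by (intro SUP_cong refl) (auto simp: eq)
  also have "\<dots> = fc (a \<otimes>\<^bsub>A\<^esub> t \<oplus>\<^bsub>A\<^esub> b \<otimes>\<^bsub>A\<^esub> s) (s \<otimes>\<^bsub>A\<^esub> t)"
    using frac_class_self[OF assms(1,2)] frac_class_self[OF assms(3,4)] by auto
  finally show ?thesis .
qed

lemma fval_mult: "q \<in> carrier Fr \<Longrightarrow> r \<in> carrier Fr \<Longrightarrow> q \<otimes>\<^bsub>Fr\<^esub> r \<in> carrier Fr \<and> fval (q \<otimes>\<^bsub>Fr\<^esub> r) = fval q * fval r"
  by (elim Fr_carrierE) (use val_mult Z0_mult in \<open>auto simp: frac_mult fval_frac_class frac_class_Fr Z0_iff\<close>)

lemma fval_add:
  assumes "q \<in> carrier Fr" "r \<in> carrier Fr"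
  shows "q \<oplus>\<^bsub>Fr\<^esub> r \<in> carrier Fr \<and> fval (q \<oplus>\<^bsub>Fr\<^esub> r) = fval q + fval r"
proof -
  obtain a s where q: "a \<in> ring_center A" "s \<in> Z0" "q = fc a s" using assms(1) by (rule Fr_carrierE)
  obtain b t where r: "b \<in> ring_center A" "t \<in> Z0" "r = fc b t" using assms(2) by (rule Fr_carrierE)
  have num: "a \<otimes>\<^bsub>A\<^esub> t \<oplus>\<^bsub>A\<^esub> b \<otimes>\<^bsub>A\<^esub> s \<in> ring_center A"
    "val (a \<otimes>\<^bsub>A\<^esub> t \<oplus>\<^bsub>A\<^esub> b \<otimes>\<^bsub>A\<^esub> s) / val (s \<otimes>\<^bsub>A\<^esub> t) = val a / val s + val b / val t"
    using q r val_mult val_add by (auto simp: Z0_iff add_frac_eq)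
  show ?thesis
    using q r num by (simp add: frac_add fval_frac_class frac_class_Fr Z0_mult)
qed

lemma fval_one: "\<one>\<^bsub>Fr\<^esub> = fc \<one>\<^bsub>A\<^esub> \<one>\<^bsub>A\<^esub>" "\<one>\<^bsub>Fr\<^esub> \<in> carrier Fr" "fval \<one>\<^bsub>Fr\<^esub> = 1"
proof -
  show one: "\<one>\<^bsub>Fr\<^esub> = fc \<one>\<^bsub>A\<^esub> \<one>\<^bsub>A\<^esub>" by (simp add: fraction_field_def)
  show "\<one>\<^bsub>Fr\<^esub> \<in> carrier Fr" "fval \<one>\<^bsub>Fr\<^esub> = 1"
    unfolding one using val_one one_Z0 by (simp_all add: frac_class_Fr fval_frac_class)
qed

lemma monoid_Fr: "monoid Fr"
proof (rule monoidI)
  fix q r s assume qrs: "q \<in> carrier Fr" "r \<in> carrier Fr" "s \<in> carrier Fr"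
  then have "q \<otimes>\<^bsub>Fr\<^esub> r \<otimes>\<^bsub>Fr\<^esub> s \<in> carrier Fr" "q \<otimes>\<^bsub>Fr\<^esub> (r \<otimes>\<^bsub>Fr\<^esub> s) \<in> carrier Fr" by (simp_all add: fval_mult)
  from fval_inject[OF this] show "q \<otimes>\<^bsub>Fr\<^esub> r \<otimes>\<^bsub>Fr\<^esub> s = q \<otimes>\<^bsub>Fr\<^esub> (r \<otimes>\<^bsub>Fr\<^esub> s)"
    using qrs by (simp add: fval_mult mult.assoc)
next
  fix q assume q: "q \<in> carrier Fr"
  then have "\<one>\<^bsub>Fr\<^esub> \<otimes>\<^bsub>Fr\<^esub> q \<in> carrier Fr" "q \<otimes>\<^bsub>Fr\<^esub> \<one>\<^bsub>Fr\<^esub> \<in> carrier Fr" by (simp_all add: fval_mult fval_one(2))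
  from fval_inject[OF this(1) q] fval_inject[OF this(2) q]
  show "\<one>\<^bsub>Fr\<^esub> \<otimes>\<^bsub>Fr\<^esub> q = q" "q \<otimes>\<^bsub>Fr\<^esub> \<one>\<^bsub>Fr\<^esub> = q"
    using q by (simp_all add: fval_mult fval_one(2,3))
qed (simp_all add: fval_mult fval_one(2))

section \<open>Evaluation of formal tensors\<close>

abbreviation P :: "('a \<times> ('a \<times> 'a) set \<Rightarrow>\<^sub>0 int) ring" where
  "P \<equiv> free_pair_ring A Fr"

abbreviation relations :: "('a \<times> ('a \<times> 'a) set \<Rightarrow>\<^sub>0 int) set" where
  "relations \<equiv> tensor_relations Z A (\<lambda>r. r) Fr (\<lambda>r. fc r \<one>\<^bsub>Z\<^esub>)"

abbreviation NN :: "('a \<times> ('a \<times> 'a) set \<Rightarrow>\<^sub>0 int) set" where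
  "NN \<equiv> generate (free_Abelian_group (carrier A \<times> carrier Fr)) relations"

text \<open>A formal sum of tensors \<open>b \<otimes> q\<close> is sent to the matrix
  \<open>\<Sum> q b\<close>, with integer multiplicities. The kernel of this map will be the
  subgroup of tensor relations.\<close>

definition ev :: "('a \<times> ('a \<times> 'a) set \<Rightarrow>\<^sub>0 int) \<Rightarrow> 'f fm" where
  "ev = pm_ext (\<lambda>(b, q) n. smul (of_int n * fval q) (\<theta> b))"

lemma ev_of [simp]: "ev (frag_of (b, q)) = smul (fval q) (\<theta> b)"
  by (simp add: ev_def pm_ext_single split: prod.split)

lemma ev_add: "ev (f + g) = ev f + ev g"
  unfolding ev_def by (rule pm_ext_add) (auto simp: distrib_right smul_add_left split: prod.split)

lemma ev_zero [simp]: "ev 0 = 0"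
  by (simp add: ev_def)

lemma ev_diff: "ev (f - g) = ev f - ev g"
  using ev_add[of "f - g" g] by (simp add: algebra_simps)

lemma ev_uminus: "ev (- f) = - ev f"
  using ev_diff[of 0 f] by simp

lemma ev_mult:
  assumes f: "f \<in> carrier P" and g: "g \<in> carrier P"
  shows "ev (f \<otimes>\<^bsub>P\<^esub> g) = mm d (ev f) (ev g)"
proof -
  have f': "Poly_Mapping.keys f \<subseteq> carrier A \<times> carrier Fr" and g': "Poly_Mapping.keys g \<subseteq> carrier A \<times> carrier Fr"
    using f g by simp_all
  show ?thesis using f'
  proof (induction f rule: frag_induction)
    case (one x)
    show ?case using g'
    proof (induction g rule: frag_induction)
      case (one y)
      obtain b q b' q' where "x = (b, q)" "y = (b', q')" by (cases x, cases y) blast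
      then show ?case using \<open>x \<in> _\<close> \<open>y \<in> _\<close>
        by (simp add: \<theta>_mult fval_mult mm_smul_left mm_smul_right smul_smul mult.commute)
    qed (simp_all add: free_pair_mult_diff ev_diff mm_diff_right)
  qed (simp_all add: free_pair_mult_diff ev_diff mm_diff_left)
qed

lemma ev_closed:
  assumes "f \<in> carrier P" shows "ev f \<in> Q"
proof -
  have f': "Poly_Mapping.keys f \<subseteq> carrier A \<times> carrier Fr" using assms by simp
  then show ?thesis
  proof (induction f rule: frag_induction)
    case (one x)
    obtain b q where x: "x = (b, q)" by (cases x)
    obtain a s where q: "a \<in> ring_center A" "s \<in> Z0" "q = fc a s" using one x by (auto elim: Fr_carrierE)
    have b: "\<theta> b \<in> B" using one x \<theta>_B by simp
    have s: "scal d (val s) \<in> B" "scal d (val a) \<in> B" "val s \<noteq> 0"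
      using q \<theta>_center \<theta>_B[OF center_carrier] by (metis Z0_iff)+
    show ?case
      unfolding x ev_of q(3) fval_frac_class[OF q(1,2)]
      by (rule Q_I[OF _ s(3,1)]) (use s b B_fmats[OF b] scal_B_mult[OF s(2) b] in \<open>simp_all add: smul_smul\<close>)
  next
    case zero
    show ?case using B_Q[OF B_zero] by simp
  next
    case (diff f g)
    then show ?case using Q_add[OF _ Q_uminus] by (simp add: ev_diff)
  qed
qed

text \<open>If the scalar \<open>c\<close> clears the denominator of \<open>z\<close>, then
  \<open>z\<close> is the value of \<open>c z \<otimes> 1 / c\<close>.\<close>

lemma ev_surj: "ev ` carrier P = Q"
proof (intro equalityI subsetI)
  fix z assume z: "z \<in> Q"
  obtain c where c: "c \<noteq> 0" "scal d c \<in> B" "smul c z \<in> B" using Q_E[OF z] .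
  obtain s where s: "s \<in> ring_center A" "val s = c" using center_ex[OF c(2)] by blast
  obtain b where b: "b \<in> carrier A" "\<theta> b = smul c z" using B_E[OF c(3)] by metis
  have s0: "s \<in> Z0" using s c by (simp add: Z0_iff)
  have "ev (frag_of (b, fc \<one>\<^bsub>A\<^esub> s)) = z"
    using s0 s c by (simp add: fval_frac_class val_one b smul_smul)
  moreover have "frag_of (b, fc \<one>\<^bsub>A\<^esub> s) \<in> carrier P" using b(1) s0 by (simp add: frac_class_Fr val_one)
  ultimately show "z \<in> ev ` carrier P" by (metis imageI)
qed (auto simp: ev_closed simp del: free_pair_ring_simps)

lemma ev_ring_hom: "ring_hom_ring P QR ev"
proof (rule ring_hom_ringI)
  show "ring P" by (rule free_pair_ring_ring[OF A.monoid_axioms monoid_Fr])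
  show "ring QR" by (rule ring_QR)
  show "ev \<one>\<^bsub>P\<^esub> = \<one>\<^bsub>QR\<^esub>" using fval_one by (simp add: \<theta>_one del: free_pair_ring_simps(2)) (simp add: fval_frac_class val_one one_Z0 \<theta>_one)
qed (simp_all add: ev_closed[simplified] ev_mult[simplified] ev_add)

lemma relations_carrier: "relations \<subseteq> carrier (free_Abelian_group (carrier A \<times> carrier Fr))"
proof -
  have fcr: "fc r \<one>\<^bsub>A\<^esub> \<otimes>\<^bsub>Fr\<^esub> b \<in> carrier Fr" if "r \<in> ring_center A" "b \<in> carrier Fr" for r b
    using fval_mult[OF frac_class_Fr[OF that(1) one_Z0] that(2)] by blast
  have *: "Poly_Mapping.keys (frag_of u - frag_of v) \<subseteq> carrier A \<times> carrier Fr"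
    if "u \<in> carrier A \<times> carrier Fr" "v \<in> carrier A \<times> carrier Fr" for u v
    by (intro keys_diff_subset; use that in simp)
  have **: "Poly_Mapping.keys (frag_of u - frag_of v - frag_of w) \<subseteq> carrier A \<times> carrier Fr"
    if "u \<in> carrier A \<times> carrier Fr" "v \<in> carrier A \<times> carrier Fr" "w \<in> carrier A \<times> carrier Fr" for u v w
    by (rule keys_diff_subset[OF *[OF that(1,2)]]) (use that(3) in simp)
  show ?thesis
    unfolding tensor_relations_def Z_simps
    by (rule subsetI, unfold carrier_free_Abelian_group_iff, elim UnE CollectE exE conjE; hypsubst; (rule ** | rule *))
       (simp_all add: fval_add fcr center_carrier)
qed

lemma NN_subgroup: "subgroup NN (free_Abelian_group (carrier A \<times> carrier Fr))"
  by (rule group.generate_is_subgroup[OF group_free_Abelian_group relations_carrier])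

lemma NN_add: "f \<in> NN \<Longrightarrow> g \<in> NN \<Longrightarrow> f + g \<in> NN"
  using subgroup.m_closed[OF NN_subgroup, of f g] by simp

lemma NN_carrier: "f \<in> NN \<Longrightarrow> f \<in> carrier P"
  using subgroup.mem_carrier[OF NN_subgroup, of f] by (simp only: carrier_free_Abelian_group_iff free_pair_ring_simps mem_Collect_eq)

lemma NN_uminus: "f \<in> NN \<Longrightarrow> - f \<in> NN"
  using subgroup.m_inv_closed[OF NN_subgroup, of f] NN_carrier[of f] by simp

lemma NN_diff: "f \<in> NN \<Longrightarrow> g \<in> NN \<Longrightarrow> f - g \<in> NN"
  using NN_add[OF _ NN_uminus, of f g] by simp

lemma relations_in_NN:
  "a \<in> carrier A \<Longrightarrow> a' \<in> carrier A \<Longrightarrow> q \<in> carrier Fr \<Longrightarrow> frag_of (a \<oplus>\<^bsub>A\<^esub> a', q) - frag_of (a, q) - frag_of (a', q) \<in> NN"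
  "a \<in> carrier A \<Longrightarrow> q \<in> carrier Fr \<Longrightarrow> r \<in> ring_center A \<Longrightarrow> frag_of (a \<otimes>\<^bsub>A\<^esub> r, q) - frag_of (a, fc r \<one>\<^bsub>A\<^esub> \<otimes>\<^bsub>Fr\<^esub> q) \<in> NN"
  unfolding tensor_relations_def Z_simps by (rule generate.incl, blast)+

lemma NN_ev:
  assumes "f \<in> NN" shows "ev f = 0"
  using assms
proof (induction f rule: generate.induct)
  case (inv h)
  then have "h \<in> carrier (free_Abelian_group (carrier A \<times> carrier Fr))" using relations_carrier by blast
  moreover have "ev h = 0"
    using inv unfolding tensor_relations_def
    by (auto simp: ev_diff \<theta>_add smul_add smul_add_left fval_add \<theta>_mult \<theta>_center center_carrier frac_class_Fr one_Z0
        fval_mult fval_frac_class val_one mm_scal_right B_fmats \<theta>_B smul_smul mult.commute)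
  ultimately show ?case by (simp add: ev_uminus)
next
  case (incl h)
  then show ?case
    unfolding tensor_relations_def
    by (auto simp: ev_diff \<theta>_add smul_add smul_add_left fval_add \<theta>_mult \<theta>_center center_carrier frac_class_Fr one_Z0
        fval_mult fval_frac_class val_one mm_scal_right B_fmats \<theta>_B smul_smul mult.commute)
qed (simp_all add: ev_add)

lemma frag_of_zero_NN: "q \<in> carrier Fr \<Longrightarrow> frag_of (\<zero>\<^bsub>A\<^esub>, q) \<in> NN"
  using NN_uminus[OF relations_in_NN(1)[of "\<zero>\<^bsub>A\<^esub>" "\<zero>\<^bsub>A\<^esub>" q]] by simp

lemma move_scalar:
  assumes "b \<in> carrier A" "r \<in> ring_center A" "s \<in> Z0"
  shows "frag_of (b \<otimes>\<^bsub>A\<^esub> r, fc \<one>\<^bsub>A\<^esub> s) - frag_of (b, fc r s) \<in> NN"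
proof -
  have "fc r \<one>\<^bsub>A\<^esub> \<otimes>\<^bsub>Fr\<^esub> fc \<one>\<^bsub>A\<^esub> s = fc r s"
    using assms center_carrier by (simp add: frac_mult val_one one_Z0 Z0_iff)
  then show ?thesis
    using relations_in_NN(2)[OF assms(1) frac_class_Fr[OF val_one(1) assms(3)] assms(2)] by simp
qed

text \<open>Modulo the relations every element is a single tensor with numerator one in the second factor.\<close>

lemma common_denominator:
  assumes "f \<in> carrier P"
  shows "\<exists>b\<in>carrier A. \<exists>s\<in>Z0. f - frag_of (b, fc \<one>\<^bsub>A\<^esub> s) \<in> NN"
proof -
  have f': "Poly_Mapping.keys f \<subseteq> carrier A \<times> carrier Fr" using assms by simp
  then show ?thesis
  proof (induction f rule: frag_induction)
    case zero
    show ?case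
      using NN_uminus[OF frag_of_zero_NN[OF frac_class_Fr[OF val_one(1) one_Z0]]] one_Z0
      by (intro bexI[of _ "\<zero>\<^bsub>A\<^esub>"] bexI[of _ "\<one>\<^bsub>A\<^esub>"]) simp_all
  next
    case (one x)
    obtain b q where x: "x = (b, q)" by (cases x)
    obtain r s where q: "r \<in> ring_center A" "s \<in> Z0" "q = fc r s" using one x by (auto elim: Fr_carrierE)
    have b: "b \<in> carrier A" using one x by simp
    show ?case
      using NN_uminus[OF move_scalar[OF b q(1,2)]] b q center_carrier
      by (intro bexI[of _ "b \<otimes>\<^bsub>A\<^esub> r"] bexI[of _ s]) (simp_all add: x)
  next
    case (diff f g)
    then obtain b s c t where b: "b \<in> carrier A" "s \<in> Z0" "f - frag_of (b, fc \<one>\<^bsub>A\<^esub> s) \<in> NN"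
      and c: "c \<in> carrier A" "t \<in> Z0" "g - frag_of (c, fc \<one>\<^bsub>A\<^esub> t) \<in> NN" by blast
    have st: "s \<in> ring_center A" "t \<in> ring_center A" using b c by (simp_all add: Z0_iff)
    define q where "q = fc \<one>\<^bsub>A\<^esub> (s \<otimes>\<^bsub>A\<^esub> t)"
    have qF: "q \<in> carrier Fr" using Z0_mult[OF b(2) c(2)] by (simp add: q_def frac_class_Fr val_one)
    have ft: "fc t (s \<otimes>\<^bsub>A\<^esub> t) = fc \<one>\<^bsub>A\<^esub> s" and fs: "fc s (s \<otimes>\<^bsub>A\<^esub> t) = fc \<one>\<^bsub>A\<^esub> t"
      using b(2) c(2) st Z0_mult[OF b(2) c(2)] val_mult[OF st]
      by (simp_all add: frac_class_eq val_one Z0_iff)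
    have bt: "b \<otimes>\<^bsub>A\<^esub> t \<in> carrier A" and cs: "c \<otimes>\<^bsub>A\<^esub> s \<in> carrier A"
      using b c st center_carrier by simp_all
    \<comment> \<open>Over the common denominator \<open>s t\<close> the difference of the two
      tensors has this numerator; the additivity relation for \<open>e\<close> plus
      \<open>c s\<close> completes the step.\<close>
    define e where "e = b \<otimes>\<^bsub>A\<^esub> t \<ominus>\<^bsub>A\<^esub> c \<otimes>\<^bsub>A\<^esub> s"
    have e: "e \<in> carrier A" using bt cs by (simp add: e_def)
    have eq: "e \<oplus>\<^bsub>A\<^esub> c \<otimes>\<^bsub>A\<^esub> s = b \<otimes>\<^bsub>A\<^esub> t"
      unfolding e_def using bt cs by (simp add: A.minus_eq A.a_assoc A.l_neg)
    have 1: "frag_of (b \<otimes>\<^bsub>A\<^esub> t, q) - frag_of (b, fc \<one>\<^bsub>A\<^esub> s) \<in> NN"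
      using move_scalar[OF b(1) st(2) Z0_mult[OF b(2) c(2)]] unfolding ft q_def .
    have 2: "frag_of (c \<otimes>\<^bsub>A\<^esub> s, q) - frag_of (c, fc \<one>\<^bsub>A\<^esub> t) \<in> NN"
      using move_scalar[OF c(1) st(1) Z0_mult[OF b(2) c(2)]] unfolding fs q_def .
    have 3: "frag_of (b \<otimes>\<^bsub>A\<^esub> t, q) - frag_of (e, q) - frag_of (c \<otimes>\<^bsub>A\<^esub> s, q) \<in> NN"
      using relations_in_NN(1)[OF e cs qF] unfolding eq .
    have "f - g - frag_of (e, q) \<in> NN"
      using NN_add[OF NN_diff[OF NN_diff[OF b(3) c(3)] NN_diff[OF 1 2]] 3] by (simp add: algebra_simps)
    then show ?case using e Z0_mult[OF b(2) c(2)] unfolding q_def by blast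
  qed
qed

text \<open>Modulo relations an element is \<open>b \<otimes> 1 / s\<close>. Its value is a nonzero
  multiple of \<open>\<theta> b\<close>, so it vanishes only for \<open>b = 0\<close>, and then the
  tensor is itself a relation.\<close>

lemma kernel_ev: "a_kernel P QR ev = NN"
proof (intro equalityI subsetI)
  fix f assume "f \<in> NN"
  then show "f \<in> a_kernel P QR ev"
    using NN_ev NN_carrier unfolding a_kernel_def' by auto
next
  fix f assume "f \<in> a_kernel P QR ev"
  then have f: "f \<in> carrier P" "ev f = 0" unfolding a_kernel_def' by auto
  obtain b s where b: "b \<in> carrier A" "s \<in> Z0" "f - frag_of (b, fc \<one>\<^bsub>A\<^esub> s) \<in> NN"
    using common_denominator[OF f(1)] by blast
  have "smul (1 / val s) (\<theta> b) = 0"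
    using NN_ev[OF b(3)] f(2) b(2) by (simp add: ev_diff fval_frac_class val_one)
  then have "\<theta> b = 0" using b(2) by (simp add: smul_eq_0_iff Z0_iff)
  then have "b = \<zero>\<^bsub>A\<^esub>" using \<theta>_eq[OF b(1) A.zero_closed] by (simp add: \<theta>_zero)
  then have "frag_of (b, fc \<one>\<^bsub>A\<^esub> s) \<in> NN"
    using frag_of_zero_NN[OF frac_class_Fr[OF val_one(1) b(2)]] by simp
  from NN_add[OF b(3) this] show "f \<in> NN" by simp
qed

text \<open>\<open>ev\<close> is constant on each coset of its kernel, so the image of a coset is a
  singleton.\<close>

definition tensor_iso :: "('a \<times> ('a \<times> 'a) set \<Rightarrow>\<^sub>0 int) set \<Rightarrow> 'f fm" where
  "tensor_iso U = the_elem (ev ` U)"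

theorem tensor_iso: "tensor_iso \<in> ring_iso (tensor_algebra Z A (\<lambda>r. r) Fr (\<lambda>r. fc r \<one>\<^bsub>Z\<^esub>)) QR"
  using ring_hom_ring.FactRing_iso_set[OF ev_ring_hom] ev_surj
  unfolding kernel_ev tensor_algebra_def tensor_iso_def[abs_def] by simp

end

section \<open>Transport along ring isomorphisms\<close>

lemma ring_iso_inj: "f \<in> ring_iso S R \<Longrightarrow> inj_on f (carrier S)"
  and ring_iso_surj: "f \<in> ring_iso S R \<Longrightarrow> f ` carrier S = carrier R"
  by (simp_all add: ring_iso_def bij_betw_def)

lemma ring_iso_center:
  assumes S: "ring S" and f: "f \<in> ring_iso S R"
  shows "f ` ring_center S = ring_center R"
proof (intro equalityI subsetI)
  interpret S: ring S by fact
  fix w assume "w \<in> f ` ring_center S"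
  then obtain z where z: "w = f z" "z \<in> carrier S" "\<And>a. a \<in> carrier S \<Longrightarrow> z \<otimes>\<^bsub>S\<^esub> a = a \<otimes>\<^bsub>S\<^esub> z"
    unfolding ring_center_def by blast
  have "w \<otimes>\<^bsub>R\<^esub> a = a \<otimes>\<^bsub>R\<^esub> w" if a: "a \<in> carrier R" for a
  proof -
    from a obtain b where b: "b \<in> carrier S" "a = f b" unfolding ring_iso_surj[OF f, symmetric] by (elim imageE) simp
    show ?thesis
      using arg_cong[OF z(3)[OF b(1)], of f] unfolding ring_iso_memE(2)[OF f z(2) b(1)] ring_iso_memE(2)[OF f b(1) z(2)] b z(1) .
  qed
  then show "w \<in> ring_center R" using ring_iso_memE(1)[OF f z(2)] by (simp add: ring_center_def z(1))
next
  interpret S: ring S by fact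
  fix w assume "w \<in> ring_center R"
  then have w: "w \<in> carrier R" "\<And>a. a \<in> carrier R \<Longrightarrow> w \<otimes>\<^bsub>R\<^esub> a = a \<otimes>\<^bsub>R\<^esub> w"
    unfolding ring_center_def by blast+
  from w(1) obtain z where z: "z \<in> carrier S" "w = f z" unfolding ring_iso_surj[OF f, symmetric] by (elim imageE) simp
  have "z \<otimes>\<^bsub>S\<^esub> a = a \<otimes>\<^bsub>S\<^esub> z" if a: "a \<in> carrier S" for a
  proof (rule inj_onD[OF ring_iso_inj[OF f]])
    show "f (z \<otimes>\<^bsub>S\<^esub> a) = f (a \<otimes>\<^bsub>S\<^esub> z)"
      using w(2)[OF ring_iso_memE(1)[OF f a]] unfolding ring_iso_memE(2)[OF f z(1) a] ring_iso_memE(2)[OF f a z(1)] z(2) .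
  qed (use a z in auto)
  then have "z \<in> ring_center S" using z by (simp add: ring_center_def)
  then show "w \<in> f ` ring_center S" unfolding z(2) by (rule imageI)
qed

lemma ring_iso_zero: "ring S \<Longrightarrow> ring R \<Longrightarrow> f \<in> ring_iso S R \<Longrightarrow> f \<zero>\<^bsub>S\<^esub> = \<zero>\<^bsub>R\<^esub>"
  using ring_hom_zero[of f S R] by (simp add: ring_iso_def)

lemma division_ring_iff: "division_ring D \<longleftrightarrow> skew_field D"
  by (simp add: division_ring_def division_ring_axioms_def skew_field_def)

lemma skew_field_ring_iso:
  assumes S: "ring S" and f: "f \<in> ring_iso S R" and R: "skew_field R"
  shows "skew_field S"
proof -
  interpret S: ring S by fact
  interpret R: division_ring R using R by (simp add: division_ring_iff)
  note f0 = ring_iso_zero[OF S R.ring_axioms f]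
  have "u \<noteq> \<zero>\<^bsub>S\<^esub>" if u: "u \<in> Units S" for u
  proof
    assume "u = \<zero>\<^bsub>S\<^esub>"
    then have "\<one>\<^bsub>S\<^esub> = \<zero>\<^bsub>S\<^esub>" using S.Units_l_inv[OF u] S.Units_inv_closed[OF u] by simp
    then show False using R.one_not_zero f0 ring_iso_memE(4)[OF f] by simp
  qed
  moreover have "u \<in> Units S" if u: "u \<in> carrier S" "u \<noteq> \<zero>\<^bsub>S\<^esub>" for u
  proof -
    have "f u \<noteq> \<zero>\<^bsub>R\<^esub>" using inj_onD[OF ring_iso_inj[OF f], of u "\<zero>\<^bsub>S\<^esub>"] u f0 by auto
    then have fu: "f u \<in> Units R" using R.Units_eq ring_iso_memE(1)[OF f u(1)] by simp
    have "inv\<^bsub>R\<^esub> (f u) \<in> carrier R" using R.Units_inv_closed[OF fu] .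
    then obtain v where v: "v \<in> carrier S" "inv\<^bsub>R\<^esub> (f u) = f v" unfolding ring_iso_surj[OF f, symmetric] by (elim imageE) simp
    have "f (v \<otimes>\<^bsub>S\<^esub> u) = f \<one>\<^bsub>S\<^esub>" "f (u \<otimes>\<^bsub>S\<^esub> v) = f \<one>\<^bsub>S\<^esub>"
      using R.Units_l_inv[OF fu] R.Units_r_inv[OF fu] u v
      by (simp_all add: ring_iso_memE(2)[OF f] ring_iso_memE(4)[OF f])
    then have "v \<otimes>\<^bsub>S\<^esub> u = \<one>\<^bsub>S\<^esub>" "u \<otimes>\<^bsub>S\<^esub> v = \<one>\<^bsub>S\<^esub>"
      using u v by (auto intro: inj_onD[OF ring_iso_inj[OF f]])
    then show ?thesis using u v unfolding Units_def by blast
  qed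
  ultimately show ?thesis
    using S S.Units_closed unfolding skew_field_def by blast
qed

lemma dimension_ring_iso:
  assumes S: "ring S" and f: "f \<in> ring_iso S R" and R: "skew_field R"
    and dim: "ring.dimension R n (ring_center R) (carrier R)"
  shows "ring.dimension S n (ring_center S) (carrier S)"
proof -
  interpret R: division_ring R using R by (simp add: division_ring_iff)
  interpret S: division_ring S using skew_field_ring_iso[OF S f R] by (simp add: division_ring_iff)
  define g where "g = inv_into (carrier S) f"
  have g: "g \<in> ring_iso R S" unfolding g_def by (rule ring_iso_set_sym[OF S f])
  have "g \<in> Ring.ring_hom R S" using g by (simp add: ring_iso_def)
  then interpret g: ring_hom_ring R S g by (rule ring_hom_ringI2[OF R.ring_axioms S.ring_axioms])
  have "S.dimension n (g ` ring_center R) (g ` carrier R)"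
    by (rule g.inj_hom_dimension[OF R.center_subfield S.one_not_zero ring_iso_inj[OF g] dim])
  then show ?thesis
    unfolding ring_iso_center[OF R.ring_axioms g] ring_iso_surj[OF g] .
qed

context central_localization
begin

abbreviation T where "T \<equiv> tensor_algebra Z A (\<lambda>r. r) Fr (\<lambda>r. fc r \<one>\<^bsub>Z\<^esub>)"

lemma tensor_ring: "ring T"
  using ideal.quotient_is_ring[OF ring_hom_ring.kernel_is_ideal[OF ev_ring_hom]]
  unfolding kernel_ev tensor_algebra_def .

lemma tensor_skew_field: "skew_field T"
  by (rule skew_field_ring_iso[OF tensor_ring tensor_iso skew_field_QR])

lemma tensor_dimension: "ring.dimension T N (ring_center T) (carrier T)"
  by (rule dimension_ring_iso[OF tensor_ring tensor_iso skew_field_QR]) (simp add: center_QR dimension_QR)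

end

section \<open>Clearing denominators\<close>

lemma (in matrix_domain) common_scalar:
  assumes "finite E" "E \<subseteq> Q"
  shows "\<exists>s. s \<noteq> 0 \<and> scal d s \<in> B \<and> (\<forall>z\<in>E. smul s z \<in> B)"
  using assms
proof (induction E rule: finite_induct)
  case empty
  then show ?case using B_one by (intro exI[of _ 1]) simp
next
  case (insert y E)
  then obtain s where s: "s \<noteq> 0" "scal d s \<in> B" "\<forall>z\<in>E. smul s z \<in> B" by auto
  have "y \<in> Q" using insert by simp
  then obtain t where t: "t \<noteq> 0" "scal d t \<in> B" "smul t y \<in> B" by (rule Q_E)
  have "smul (s * t) z \<in> B" if "z \<in> insert y E" for z
  proof (cases "z = y")
    case True
    show ?thesis using scal_B_mult[OF s(2) t(3)] unfolding True by (simp add: smul_smul)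
  next
    case False
    then have "smul s z \<in> B" using that s(3) by simp
    from scal_B_mult[OF t(2) this] show ?thesis by (simp add: smul_smul mult.commute)
  qed
  then show ?case using s t scal_B_times[OF s(2) t(2)] by (intro exI[of _ "s * t"]) simp
qed

text \<open>One scalar \<open>s\<close> clears the denominators of the finitely many elements
  involved. Each relation has two factors on either side, so scaling all of them by \<open>s\<close>
  preserves it.\<close>

theorem (in central_localization) galois_maximal_subfield_relations:
  assumes K: "maximal_subfield K T" "galois_extension T (ring_center T) K"
  obtains G :: "(('a \<times> ('a \<times> 'a) set \<Rightarrow>\<^sub>0 int) set \<Rightarrow> ('a \<times> ('a \<times> 'a) set \<Rightarrow>\<^sub>0 int) set) monoid"
    and u v and S :: "('a \<times> ('a \<times> 'a) set \<Rightarrow>\<^sub>0 int) set set" and m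
  where "group G" "finite (carrier G)" "m * card (carrier G) = N" "m \<le> card (carrier G)"
    "\<And>\<phi>. \<phi> \<in> carrier G \<Longrightarrow> u \<phi> \<in> B \<and> u \<phi> \<noteq> 0"
    "\<And>\<phi> y. \<phi> \<in> carrier G \<Longrightarrow> y \<in> S \<Longrightarrow> v \<phi> y \<in> B"
    "\<And>\<phi> \<psi> y. \<phi> \<in> carrier G \<Longrightarrow> \<psi> \<in> carrier G \<Longrightarrow> y \<in> S \<Longrightarrow> mm d (u \<phi>) (v \<psi> y) = mm d (v (\<phi> \<otimes>\<^bsub>G\<^esub> \<psi>) y) (u \<phi>)"
    "\<And>\<phi> \<psi>. \<phi> \<in> carrier G \<Longrightarrow> \<psi> \<in> carrier G \<Longrightarrow> (\<And>y. y \<in> S \<Longrightarrow> v \<phi> y = v \<psi> y) \<Longrightarrow> \<phi> = \<psi>"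
proof -
  interpret galois_in_division_ring T K
    using K tensor_skew_field
    by (simp add: galois_in_division_ring_def galois_in_division_ring_axioms_def division_ring_iff)
  show thesis
  proof (rule crossed_product_relations[OF tensor_dimension])
    fix u S m assume uS: "finite (carrier Gal)" "m * card (carrier Gal) = N" "m \<le> card (carrier Gal)" "finite S" "S \<subseteq> K"
      "\<And>\<phi>. \<phi> \<in> carrier Gal \<Longrightarrow> u \<phi> \<in> carrier T \<and> u \<phi> \<noteq> \<zero>\<^bsub>T\<^esub>"
      "\<And>\<phi> \<psi> y. \<phi> \<in> carrier Gal \<Longrightarrow> \<psi> \<in> carrier Gal \<Longrightarrow> y \<in> S \<Longrightarrow> u \<phi> \<otimes>\<^bsub>T\<^esub> \<psi> y = (\<phi> \<otimes>\<^bsub>Gal\<^esub> \<psi>) y \<otimes>\<^bsub>T\<^esub> u \<phi>"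
      "\<And>\<phi> y. \<phi> \<in> carrier Gal \<Longrightarrow> y \<in> S \<Longrightarrow> \<phi> y \<in> carrier T"
      "\<And>\<phi> \<psi>. \<phi> \<in> carrier Gal \<Longrightarrow> \<psi> \<in> carrier Gal \<Longrightarrow> (\<And>y. y \<in> S \<Longrightarrow> \<phi> y = \<psi> y) \<Longrightarrow> \<phi> = \<psi>"
    let ?f = tensor_iso
    note f = tensor_iso
    define E where "E = ?f ` (u ` carrier Gal \<union> (\<lambda>(\<phi>, y). \<phi> y) ` (carrier Gal \<times> S))"
    have fin: "finite E" unfolding E_def using uS(1,4) by blast
    have EQ: "E \<subseteq> Q"
      unfolding E_def using uS(6,8) ring_iso_memE(1)[OF f] by auto
    obtain s where s: "s \<noteq> 0" "scal d s \<in> B" "\<And>z. z \<in> E \<Longrightarrow> smul s z \<in> B"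
      using common_scalar[OF fin EQ] by metis
    have smul_inj: "smul s a = smul s b \<longleftrightarrow> a = b" for a b :: "'f fm"
      using s(1) by (simp add: fm_eq_iff)
    interpret Gal: group Gal by (rule group_Gal)
    show thesis
    proof (rule that[OF group_Gal uS(1-3), of "\<lambda>\<phi>. smul s (?f (u \<phi>))" S "\<lambda>\<phi> y. smul s (?f (\<phi> y))"])
      show "smul s (?f (u \<phi>)) \<in> B \<and> smul s (?f (u \<phi>)) \<noteq> 0" if \<phi>: "\<phi> \<in> carrier Gal" for \<phi>
      proof
        have "?f (u \<phi>) \<in> E" unfolding E_def using \<phi> by (intro imageI UnI1)
        then show "smul s (?f (u \<phi>)) \<in> B" by (rule s(3))
        have "?f (u \<phi>) \<noteq> ?f \<zero>\<^bsub>T\<^esub>"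
          using inj_onD[OF ring_iso_inj[OF f], of "u \<phi>" "\<zero>\<^bsub>T\<^esub>"] uS(6)[OF \<phi>] zero_closed by blast
        then show "smul s (?f (u \<phi>)) \<noteq> 0"
          using ring_iso_zero[OF tensor_ring ring_QR f] s(1) by (simp add: smul_eq_0_iff)
      qed
      show "smul s (?f (\<phi> y)) \<in> B" if "\<phi> \<in> carrier Gal" "y \<in> S" for \<phi> y
      proof (rule s(3))
        have "(\<phi>, y) \<in> carrier Gal \<times> S" using that by simp
        then show "?f (\<phi> y) \<in> E" unfolding E_def by (intro imageI UnI2 image_eqI[of _ _ "(\<phi>, y)"]) simp_all
      qed
      show "mm d (smul s (?f (u \<phi>))) (smul s (?f (\<psi> y))) = mm d (smul s (?f ((\<phi> \<otimes>\<^bsub>Gal\<^esub> \<psi>) y))) (smul s (?f (u \<phi>)))"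
        if "\<phi> \<in> carrier Gal" "\<psi> \<in> carrier Gal" "y \<in> S" for \<phi> \<psi> y
      proof -
        have c: "u \<phi> \<in> carrier T" "\<psi> y \<in> carrier T" "(\<phi> \<otimes>\<^bsub>Gal\<^esub> \<psi>) y \<in> carrier T"
          using uS(6)[OF that(1)] uS(8)[OF that(2,3)] uS(8)[OF Gal.m_closed[OF that(1,2)] that(3)] by simp_all
        have "mm d (?f (u \<phi>)) (?f (\<psi> y)) = mm d (?f ((\<phi> \<otimes>\<^bsub>Gal\<^esub> \<psi>) y)) (?f (u \<phi>))"
          using arg_cong[OF uS(7)[OF that], of ?f]
          unfolding ring_iso_memE(2)[OF f c(1,2)] ring_iso_memE(2)[OF f c(3,1)] QR_simps .
        then show ?thesis by (simp add: mm_smul_left mm_smul_right)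
      qed
      show "\<phi> = \<psi>" if "\<phi> \<in> carrier Gal" "\<psi> \<in> carrier Gal" and eq: "\<And>y. y \<in> S \<Longrightarrow> smul s (?f (\<phi> y)) = smul s (?f (\<psi> y))" for \<phi> \<psi>
      proof (rule uS(9)[OF that(1,2)])
        fix y assume y: "y \<in> S"
        show "\<phi> y = \<psi> y"
          by (rule inj_onD[OF ring_iso_inj[OF f] _ uS(8)[OF that(1) y] uS(8)[OF that(2) y]]) (rule eq[OF y, unfolded smul_inj])
      qed
    qed
  qed
qed

section \<open>Elementary abelian groups and the torus of rank two\<close>

text \<open>If two of the vectors are proportional the cross product vanishes, but then they already satisfy a
  relation.\<close>

lemma planar_relation:
  fixes v :: "nat \<Rightarrow> nat \<Rightarrow> int"
  obtains c :: "nat \<Rightarrow> int" where "\<And>k. k < 2 \<Longrightarrow> c 0 * v 0 k + c 1 * v 1 k + c 2 * v 2 k = 0" "c 0 \<noteq> 0 \<or> c 1 \<noteq> 0 \<or> c 2 \<noteq> 0"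
proof -
  define x where "x i j = v i 0 * v j 1 - v i 1 * v j 0" for i j
  have two: "k = 0 \<or> k = 1" if "k < 2" for k :: nat using that by auto
  consider "x 0 1 \<noteq> 0" | "x 0 1 = 0" "v 0 0 \<noteq> 0" | "x 0 1 = 0" "v 0 1 \<noteq> 0" | "v 0 0 = 0" "v 0 1 = 0" by blast
  then show ?thesis
  proof cases
    case 1
    show ?thesis
    proof (rule that[of "\<lambda>i. if i = 0 then x 1 2 else if i = 1 then x 2 0 else x 0 1"])
      fix k :: nat assume "k < 2"
      then show "(if (0::nat) = 0 then x 1 2 else if (0::nat) = 1 then x 2 0 else x 0 1) * v 0 k
        + (if (1::nat) = 0 then x 1 2 else if (1::nat) = 1 then x 2 0 else x 0 1) * v 1 k
        + (if (2::nat) = 0 then x 1 2 else if (2::nat) = 1 then x 2 0 else x 0 1) * v 2 k = 0"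
        by (auto dest!: two simp: x_def algebra_simps)
    qed (use 1 in simp)
  next
    case 2
    show ?thesis
      by (rule that[of "\<lambda>i. if i = 0 then v 1 0 else if i = 1 then - v 0 0 else 0"])
         (use 2 in \<open>auto dest!: two simp: x_def algebra_simps\<close>)
  next
    case 3
    show ?thesis
      by (rule that[of "\<lambda>i. if i = 0 then v 1 1 else if i = 1 then - v 0 1 else 0"])
         (use 3 in \<open>auto dest!: two simp: x_def algebra_simps\<close>)
  next
    case 4
    show ?thesis
      by (rule that[of "\<lambda>i. if i = 0 then 1 else 0"]) (use 4 in \<open>auto dest!: two\<close>)
  qed
qed

text \<open>Dividing an integer relation by the greatest common divisor of its coefficients leaves
  one whose coefficients are not all divisible by \<open>p\<close>. Reduction modulo
  \<open>p ^ n\<close> makes them natural numbers and preserves this, since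
  \<open>n > 0\<close>.\<close>

lemma planar_relation_mod:
  fixes v :: "nat \<Rightarrow> nat \<Rightarrow> nat" and p n :: nat
  assumes p: "Factorial_Ring.prime p" and n: "n > 0"
  obtains c :: "nat \<Rightarrow> nat" where
    "\<And>k. k < 2 \<Longrightarrow> (c 0 * v 0 k + c 1 * v 1 k + c 2 * v 2 k) mod p ^ n = 0"
    "\<not> p dvd c 0 \<or> \<not> p dvd c 1 \<or> \<not> p dvd c 2"
proof -
  from planar_relation[of "\<lambda>i k. int (v i k)"] obtain c :: "nat \<Rightarrow> int"
    where c: "\<And>k. k < 2 \<Longrightarrow> c 0 * int (v 0 k) + c 1 * int (v 1 k) + c 2 * int (v 2 k) = 0"
    "c 0 \<noteq> 0 \<or> c 1 \<noteq> 0 \<or> c 2 \<noteq> 0" by metis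
  define g where "g = gcd (c 0) (gcd (c 1) (c 2))"
  have g0: "g \<noteq> 0" using c(2) by (auto simp: g_def)
  define e where "e i = c i div g" for i
  have ge: "c i = g * e i" if "i \<in> {0, 1, 2}" for i
  proof -
    have "g dvd c 0" "g dvd c 1" "g dvd c 2" unfolding g_def by (meson gcd_dvd1 gcd_dvd2 dvd_trans)+
    then show ?thesis using that by (auto simp: e_def)
  qed
  have ge': "c 0 = g * e 0" "c 1 = g * e 1" "c 2 = g * e 2" by (rule ge, simp)+
  have "g = gcd (g * e 0) (gcd (g * e 1) (g * e 2))" unfolding ge'[symmetric] by (rule g_def)
  also have "\<dots> = \<bar>g\<bar> * gcd (e 0) (gcd (e 1) (e 2))" by (simp add: gcd_mult_left abs_mult)
  finally have gcd1: "gcd (e 0) (gcd (e 1) (e 2)) = 1"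
    using g0 by (auto simp: g_def)
  have rel: "e 0 * int (v 0 k) + e 1 * int (v 1 k) + e 2 * int (v 2 k) = 0" if "k < 2" for k
  proof -
    have "g * (e 0 * int (v 0 k) + e 1 * int (v 1 k) + e 2 * int (v 2 k)) = 0"
      using c(1)[OF that] ge[of 0] ge[of 1] ge[of 2] by (simp add: algebra_simps)
    then show ?thesis using g0 by simp
  qed
  define q where "q = int (p ^ n)"
  have q: "q > 0" using prime_gt_0_nat[OF p] by (simp add: q_def)
  define f where "f i = nat (e i mod q)" for i
  have fi: "int (f i) = e i mod q" for i using q by (simp add: f_def)
  show ?thesis
  proof (rule that[of f])
    fix k :: nat assume k: "k < 2"
    have q': "int p ^ n = q" by (simp add: q_def)
    have "int ((f 0 * v 0 k + f 1 * v 1 k + f 2 * v 2 k) mod p ^ n)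
        = (e 0 * int (v 0 k) + e 1 * int (v 1 k) + e 2 * int (v 2 k)) mod q"
      by (simp add: zmod_int fi q') (intro mod_add_cong mod_mult_cong; simp)
    then show "(f 0 * v 0 k + f 1 * v 1 k + f 2 * v 2 k) mod p ^ n = 0" using rel[OF k] by simp
  next
    show "\<not> p dvd f 0 \<or> \<not> p dvd f 1 \<or> \<not> p dvd f 2"
    proof (rule ccontr)
      assume "\<not> ?thesis"
      then have "int p dvd int (f i)" if "i \<in> {0, 1, 2}" for i using that by auto
      moreover have "int p dvd q" using n by (simp add: q_def)
      ultimately have "int p dvd e i" if "i \<in> {0, 1, 2}" for i using that by (metis fi dvd_mod_iff)
      then have "int p dvd 1" unfolding gcd1[symmetric] by (intro gcd_greatest) simp_all
      then show False using prime_gt_1_nat[OF p] by simp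
    qed
  qed
qed

lemma (in comm_group) solve_power:
  assumes p: "Factorial_Ring.prime p" and ex: "\<And>x. x \<in> carrier G \<Longrightarrow> x [^] p = \<one>"
    and xy: "x \<in> carrier G" "y \<in> carrier G" "y \<otimes> x [^] c = \<one>" and c: "\<not> p dvd (c::nat)"
  shows "\<exists>e::nat. x = y [^] e"
proof -
  have "gcd c p = 1" using prime_imp_coprime[OF p c] by (simp add: coprime_iff_gcd_eq_1 gcd.commute)
  moreover have "c \<noteq> 0" using c by (metis dvd_0_right)
  ultimately obtain e b where e: "c * e = p * b + 1" using bezout_nat[of c p] by auto
  \<comment> \<open>\<open>e\<close> inverts \<open>c\<close> modulo \<open>p\<close>, and
    \<open>p - 1\<close> replaces the factor -1, so \<open>c * e' + 1\<close> is a multiple of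
    \<open>p\<close>. Raising the given relation to the power \<open>e'\<close> and multiplying by
    \<open>x\<close> then expresses \<open>x\<close> through \<open>y\<close>.\<close>
  define e' where "e' = (p - 1) * e"
  define j where "j = (p - 1) * b + 1"
  obtain r where r: "p = Suc r" using prime_gt_0_nat[OF p] gr0_implies_Suc by blast
  have j: "c * e' + 1 = p * j"
    using arg_cong[OF e, of "\<lambda>x. r * x"] by (simp add: e'_def j_def r algebra_simps)
  have "\<one> = (y \<otimes> x [^] c) [^] e'" using xy by simp
  also have "\<dots> = y [^] e' \<otimes> x [^] (c * e')"
    using xy(1,2) by (simp add: pow_mult_distrib m_comm nat_pow_pow)
  finally have "x = y [^] e' \<otimes> x [^] (c * e') \<otimes> x" using xy by simp
  also have "\<dots> = y [^] e' \<otimes> x [^] (c * e' + 1)"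
    using xy(1,2) by (simp add: m_assoc)
  also have "x [^] (c * e' + 1) = (x [^] p) [^] j" unfolding j using xy(1) by (simp add: nat_pow_pow)
  also have "\<dots> = \<one>" using ex xy(1) by simp
  finally show ?thesis using xy(2) by auto
qed

text \<open>A larger group would contain \<open>x\<close>, \<open>y\<close>, \<open>z\<close>, each
  outside the subgroup generated by the previous ones. In a relation between them an exponent prime
  to \<open>p\<close> would express the last such element through the earlier ones.\<close>

lemma (in comm_group) planar_exponent_card:
  assumes p: "Factorial_Ring.prime p" and ex: "\<And>x. x \<in> carrier G \<Longrightarrow> x [^] p = \<one>"
    and fin: "finite (carrier G)"
    and rel: "\<And>x y z. x \<in> carrier G \<Longrightarrow> y \<in> carrier G \<Longrightarrow> z \<in> carrier G \<Longrightarrow>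
      \<exists>a b c :: nat. x [^] a \<otimes> y [^] b \<otimes> z [^] c = \<one> \<and> (\<not> p dvd a \<or> \<not> p dvd b \<or> \<not> p dvd c)"
  shows "card (carrier G) \<le> p ^ 2"
proof (rule ccontr)
  assume "\<not> ?thesis"
  then have big: "card (carrier G) > p ^ 2" by simp
  have p1: "p > 1" using prime_gt_1_nat[OF p] .
  have red: "x [^] k = x [^] (k mod p)" if "x \<in> carrier G" for x and k :: nat
  proof -
    have "x [^] k = x [^] (p * (k div p) + k mod p)" by simp
    also have "\<dots> = (x [^] p) [^] (k div p) \<otimes> x [^] (k mod p)"
      using that by (simp add: nat_pow_mult nat_pow_pow del: mult_div_mod_eq)
    also have "\<dots> = x [^] (k mod p)" using that by (simp add: ex)
    finally show ?thesis .
  qed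
  have mult: "x [^] k = \<one>" if "x \<in> carrier G" "p dvd k" for x and k :: nat
    using red[OF that(1), of k] that(2) by simp
  have new: "\<exists>z\<in>carrier G. z \<notin> W" if "finite W" "card W \<le> p ^ 2" for W
  proof (rule ccontr)
    assume "\<not> ?thesis"
    then have "carrier G \<subseteq> W" by blast
    from card_mono[OF that(1) this] show False using that(2) big by simp
  qed
  obtain x where x: "x \<in> carrier G" "x \<notin> {\<one>}" using new[of "{\<one>}"] p1 by auto
  define W1 where "W1 = (\<lambda>i. x [^] i) ` {..<p}"
  have "card W1 \<le> p" using card_image_le[of "{..<p}" "\<lambda>i. x [^] i"] by (simp add: W1_def)
  also have "p \<le> p ^ 2" using p1 by (simp add: power2_eq_square)
  finally obtain y where y: "y \<in> carrier G" "y \<notin> W1" using new[of W1] by (auto simp: W1_def)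
  define W2 where "W2 = (\<lambda>(i, j). x [^] i \<otimes> y [^] j) ` ({..<p} \<times> {..<p})"
  have "card W2 \<le> p ^ 2"
    using card_image_le[of "{..<p} \<times> {..<p}" "\<lambda>(i, j). x [^] i \<otimes> y [^] j"]
    by (simp add: W2_def power2_eq_square card_cartesian_product)
  then obtain z where z: "z \<in> carrier G" "z \<notin> W2" using new[of W2] by (auto simp: W2_def)
  have y_new: "y \<noteq> x [^] i" for i :: nat
  proof
    assume "y = x [^] i"
    then have "y = x [^] (i mod p)" using red[OF x(1)] by metis
    then show False using y(2) p1 by (auto simp: W1_def)
  qed
  have z_new: "z \<noteq> x [^] i \<otimes> y [^] j" for i j :: nat
  proof
    assume "z = x [^] i \<otimes> y [^] j"
    then have "z = x [^] (i mod p) \<otimes> y [^] (j mod p)" using red[OF x(1), of i] red[OF y(1), of j] by simp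
    moreover have "(i mod p, j mod p) \<in> {..<p} \<times> {..<p}" using p1 by simp
    ultimately have "z \<in> W2" unfolding W2_def by (intro image_eqI[of _ _ "(i mod p, j mod p)"]) simp_all
    then show False using z(2) by simp
  qed
  obtain a b c :: nat where abc: "x [^] a \<otimes> y [^] b \<otimes> z [^] c = \<one>" "\<not> p dvd a \<or> \<not> p dvd b \<or> \<not> p dvd c"
    using rel[OF x(1) y(1) z(1)] by blast
  have "p dvd c"
  proof (rule ccontr)
    assume c: "\<not> p dvd c"
    obtain e where "z = (x [^] a \<otimes> y [^] b) [^] (e::nat)"
      using solve_power[OF p ex z(1) _ abc(1) c] x(1) y(1) by auto
    then have "z = x [^] (a * e) \<otimes> y [^] (b * e)"
      using x(1) y(1) by (simp add: pow_mult_distrib m_comm nat_pow_pow)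
    then show False using z_new by blast
  qed
  then have ab: "x [^] a \<otimes> y [^] b = \<one>" using abc(1) mult[OF z(1)] x(1) y(1) by simp
  have "p dvd b"
  proof (rule ccontr)
    assume b: "\<not> p dvd b"
    obtain e where "y = (x [^] a) [^] (e::nat)"
      using solve_power[OF p ex y(1) _ ab b] x(1) by auto
    then show False using y_new[of "a * e"] x(1) by (simp add: nat_pow_pow)
  qed
  then have a: "\<one> \<otimes> x [^] a = \<one>" using ab mult[OF y(1)] x(1) by simp
  have "\<not> p dvd a" using abc(2) \<open>p dvd b\<close> \<open>p dvd c\<close> by simp
  then obtain e where "x = \<one> [^] (e::nat)" using solve_power[OF p ex x(1) one_closed a] by blast
  then show False using x(2) by simp
qed

section \<open>Crossed product relations inside a quantum torus\<close>

lemma lookup_sum_list: "Poly_Mapping.lookup (sum_list xs) k = (\<Sum>x\<leftarrow>xs. Poly_Mapping.lookup x k)"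
  by (induction xs) (simp_all add: lookup_add)

text \<open>\<open>v g y\<close> plays the part of the conjugate of a generator \<open>y\<close>
  under \<open>g\<close>, up to a common central factor; conjugation by \<open>u g\<close> permutes
  these conjugates, and together they determine the group element.\<close>

locale crossed_torus = generic_torus d N m h w + group G
  for d N m h and w :: "'k::field generic_fun alg_closure" and G :: "'g monoid" (structure) +
  fixes u :: "'g \<Rightarrow> 'k generic_fun fm" and v :: "'g \<Rightarrow> 's \<Rightarrow> 'k generic_fun fm" and S :: "'s set"
  assumes card_nz: "of_nat (card (carrier G)) \<noteq> (0 :: 'k generic_fun alg_closure)"
    and u_B: "g \<in> carrier G \<Longrightarrow> u g \<in> gen_B d" and u_nz: "g \<in> carrier G \<Longrightarrow> u g \<noteq> 0"
    and v_B: "g \<in> carrier G \<Longrightarrow> y \<in> S \<Longrightarrow> v g y \<in> gen_B d"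
    and uv: "g \<in> carrier G \<Longrightarrow> k \<in> carrier G \<Longrightarrow> y \<in> S \<Longrightarrow> mm d (u g) (v k y) = mm d (v (g \<otimes> k) y) (u g)"
    and v_sep: "g \<in> carrier G \<Longrightarrow> k \<in> carrier G \<Longrightarrow> (\<And>y. y \<in> S \<Longrightarrow> v g y = v k y) \<Longrightarrow> g = k"
begin

definition wprod :: "'g list \<Rightarrow> 'k generic_fun fm" where
  "wprod gs = foldr (\<lambda>g. mm d (u g)) gs (scal d 1)"

definition gprod :: "'g list \<Rightarrow> 'g" where
  "gprod gs = foldr (\<otimes>) gs \<one>"

definition deg :: "'g \<Rightarrow> expo" where
  "deg g = lead (code (u g))"

lemma wprod_simps [simp]: "wprod [] = scal d 1" "wprod (g # gs) = mm d (u g) (wprod gs)"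
  by (simp_all add: wprod_def)

lemma gprod_simps [simp]: "gprod [] = \<one>" "gprod (g # gs) = g \<otimes> gprod gs"
  by (simp_all add: gprod_def)

lemma gprod_closed [simp]: "set gs \<subseteq> carrier G \<Longrightarrow> gprod gs \<in> carrier G"
  by (induction gs) auto

lemma gprod_append: "set gs \<subseteq> carrier G \<Longrightarrow> set hs \<subseteq> carrier G \<Longrightarrow> gprod (gs @ hs) = gprod gs \<otimes> gprod hs"
  by (induction gs) (auto simp: m_assoc)

lemma gprod_replicate: "g \<in> carrier G \<Longrightarrow> gprod (replicate k g) = g [^] k"
  by (induction k) (simp_all add: nat_pow_Suc2[symmetric])

lemma one_nz: "scal d 1 \<noteq> (0 :: 'k generic_fun fm)"
  using scal_inject[OF d_pos, of "1 :: 'k generic_fun" 0] by simp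

lemma wprod_B: "set gs \<subseteq> carrier G \<Longrightarrow> wprod gs \<in> gen_B d \<and> wprod gs \<noteq> 0"
proof (induction gs)
  case Nil
  show ?case using gen_B_closed(1) one_nz by simp
next
  case (Cons g gs)
  then have g: "u g \<in> gen_B d" "u g \<noteq> 0" and gs: "wprod gs \<in> gen_B d" "wprod gs \<noteq> 0" using u_B u_nz by simp_all
  have "mm d (u g) (wprod gs) \<in> gen_B d" using g(1) gs(1) by (rule gen_B_closed(4))
  moreover have "mm d (u g) (wprod gs) \<noteq> 0"
    using gen_B_no_zero_divisors[OF g(1) gs(1) calculation] g(2) gs(2) by blast
  ultimately show ?case by simp
qed

lemma code_mm: "a \<in> gen_B d \<Longrightarrow> b \<in> gen_B d \<Longrightarrow> code (mm d a b) = tw (code a) (code b)"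
  by (rule code_mult[OF _ _ gen_B_closed(4)])

lemma lead_mm:
  assumes "a \<in> gen_B d" "a \<noteq> 0" "b \<in> gen_B d" "b \<noteq> 0"
  shows "lead (code (mm d a b)) = lead (code a) + lead (code b)"
  unfolding code_mm[OF assms(1,3)] by (rule tw_lead(3)) (use assms in \<open>simp_all add: code_zero\<close>)

lemma lead_wprod: "set gs \<subseteq> carrier G \<Longrightarrow> lead (code (wprod gs)) = (\<Sum>g\<leftarrow>gs. deg g)"
proof (induction gs)
  case Nil
  \<comment> \<open>From \<open>1 = 1 * 1\<close> the leading exponent of 1 equals its own double,
    hence it is 0.\<close>
  have "mm d (scal d 1) (scal d 1) = (scal d 1 :: 'k generic_fun fm)" by simp
  then show ?case
    using lead_mm[OF gen_B_closed(1) one_nz gen_B_closed(1) one_nz] by simp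
next
  case (Cons g gs)
  then show ?case using lead_mm[of "u g" "wprod gs"] u_B[of g] u_nz[of g] wprod_B[of gs] by (simp add: deg_def)
qed

lemma wprod_v:
  assumes "set gs \<subseteq> carrier G" "k \<in> carrier G" "y \<in> S"
  shows "mm d (wprod gs) (v k y) = mm d (v (gprod gs \<otimes> k) y) (wprod gs)"
  using assms(1)
proof (induction gs)
  case Nil
  then show ?case using gen_B_fmats[OF v_B[OF assms(2,3)]] assms(2) by (simp add: mm_scal_left mm_scal_right)
next
  case (Cons g gs)
  have gs: "g \<in> carrier G" "gprod gs \<otimes> k \<in> carrier G" using Cons.prems assms(2) by simp_all
  have "mm d (wprod (g # gs)) (v k y) = mm d (u g) (mm d (wprod gs) (v k y))" by (simp add: mm_assoc)
  also have "mm d (wprod gs) (v k y) = mm d (v (gprod gs \<otimes> k) y) (wprod gs)" using Cons by simp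
  also have "mm d (u g) (mm d (v (gprod gs \<otimes> k) y) (wprod gs)) = mm d (mm d (u g) (v (gprod gs \<otimes> k) y)) (wprod gs)"
    by (simp add: mm_assoc)
  also have "mm d (u g) (v (gprod gs \<otimes> k) y) = mm d (v (g \<otimes> (gprod gs \<otimes> k)) y) (u g)" by (rule uv[OF gs assms(3)])
  also have "g \<otimes> (gprod gs \<otimes> k) = gprod (g # gs) \<otimes> k"
    using Cons.prems assms(2) by (simp add: m_assoc)
  finally show ?case by (simp add: mm_assoc)
qed

text \<open>Let \<open>\<gamma>\<close> be the quotient of the two group elements. Conjugation by
  the quotient of the two words moves \<open>v (\<gamma> ^ i) y\<close> to
  \<open>v (\<gamma> ^ (i + 1)) y\<close>; by similarity of the leading exponents
  \<open>periodic_conjugation_trivial\<close> applies, so \<open>\<gamma>\<close> fixes every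
  generator.\<close>

theorem word_eq:
  assumes gs: "set gs \<subseteq> carrier G" and hs: "set hs \<subseteq> carrier G"
    and deg: "\<And>k. k < 2 * m \<Longrightarrow> (\<Sum>g\<leftarrow>gs. Poly_Mapping.lookup (deg g) k) mod N = (\<Sum>g\<leftarrow>hs. Poly_Mapping.lookup (deg g) k) mod N"
  shows "gprod gs = gprod hs"
proof -
  define \<alpha> where "\<alpha> = gprod gs"
  define \<rho> where "\<rho> = gprod hs"
  define \<gamma> where "\<gamma> = \<alpha> \<otimes> inv \<rho>"
  have c: "\<alpha> \<in> carrier G" "\<rho> \<in> carrier G" "\<gamma> \<in> carrier G"
    using gs hs by (simp_all add: \<alpha>_def \<rho>_def \<gamma>_def)
  have sim: "similar (lead (code (wprod gs))) (lead (code (wprod hs)))"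
    by (rule similarI) (use deg in \<open>simp add: lead_wprod gs hs lookup_sum_list comp_def\<close>)
  have "v \<gamma> y = v \<one> y" if y: "y \<in> S" for y
  proof -
    define z where "z i = code (v (\<gamma> [^] i) y)" for i :: nat
    \<comment> \<open>Halfway between \<open>z i\<close> and \<open>z (Suc i)\<close>: the conjugate
      after undoing the second word and before applying the first.\<close>
    define z' where "z' i = code (v (inv \<rho> \<otimes> \<gamma> [^] i) y)" for i :: nat
    have "z 1 = z 0"
    proof (rule periodic_conjugation_trivial)
      show "code (wprod gs) \<noteq> 0" "code (wprod hs) \<noteq> 0"
        using wprod_B[OF gs] wprod_B[OF hs] by (simp_all add: code_zero)
      show "similar (lead (code (wprod gs))) (lead (code (wprod hs)))" by (rule sim)
      fix i :: nat
      have i: "inv \<rho> \<otimes> \<gamma> [^] i \<in> carrier G" "\<gamma> [^] i \<in> carrier G" "\<gamma> [^] Suc i \<in> carrier G" using c by simp_all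
      have "\<rho> \<otimes> (inv \<rho> \<otimes> \<gamma> [^] i) = \<gamma> [^] i" using c by (simp add: m_assoc[symmetric])
      then have "mm d (wprod hs) (v (inv \<rho> \<otimes> \<gamma> [^] i) y) = mm d (v (\<gamma> [^] i) y) (wprod hs)"
        using wprod_v[OF hs i(1) y] by (simp add: \<rho>_def)
      from arg_cong[OF this, of code] show "tw (z i) (code (wprod hs)) = tw (code (wprod hs)) (z' i)"
        using wprod_B[OF hs] v_B[OF i(1) y] v_B[OF i(2) y] by (simp add: code_mm z_def z'_def)
      have "\<alpha> \<otimes> (inv \<rho> \<otimes> \<gamma> [^] i) = \<gamma> \<otimes> \<gamma> [^] i" using c by (simp add: \<gamma>_def m_assoc)
      also have "\<dots> = \<gamma> [^] Suc i" using c(3) by (rule nat_pow_Suc2[symmetric])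
      finally have "mm d (wprod gs) (v (inv \<rho> \<otimes> \<gamma> [^] i) y) = mm d (v (\<gamma> [^] Suc i) y) (wprod gs)"
        using wprod_v[OF gs i(1) y] unfolding \<alpha>_def by simp
      from arg_cong[OF this, of code] show "tw (code (wprod gs)) (z' i) = tw (z (Suc i)) (code (wprod gs))"
        using wprod_B[OF gs] v_B[OF i(1) y] v_B[OF i(3) y] by (simp add: code_mm z_def z'_def del: nat_pow_Suc)
    next
      show "z (card (carrier G)) = z 0"
        using pow_order_eq_1[OF c(3)] by (simp add: z_def Coset.order_def)
      show "of_nat (card (carrier G)) \<noteq> (0 :: 'k generic_fun alg_closure)" by (rule card_nz)
    qed
    then show ?thesis
      using code_inject[OF v_B[OF c(3) y] v_B[OF one_closed y]] c(3) by (simp add: z_def)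
  qed
  then have "\<gamma> = \<one>" using v_sep[OF c(3) one_closed] by blast
  then have "\<alpha> \<otimes> inv \<rho> \<otimes> \<rho> = \<one> \<otimes> \<rho>" by (simp add: \<gamma>_def)
  then show ?thesis using c by (simp add: m_assoc \<alpha>_def \<rho>_def)
qed

text \<open>The leading exponents of \<open>N\<close> copies of \<open>g\<close> are divisible by
  \<open>N\<close>, just as for the empty word.\<close>

lemma exponent: "g \<in> carrier G \<Longrightarrow> g [^] N = \<one>"
  using subsetI[of "set (replicate N g)" "carrier G"] word_eq[of "replicate N g" "[]"] by (simp add: gprod_replicate sum_list_replicate)

text \<open>Leading exponents are added, so they forget the order of the letters.\<close>

lemma commutative: "g \<in> carrier G \<Longrightarrow> k \<in> carrier G \<Longrightarrow> g \<otimes> k = k \<otimes> g"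
  using word_eq[of "[g, k]" "[k, g]"] by (simp add: add.commute)

end

section \<open>The universal division algebra\<close>

lemma of_nat_alg_closure_nonzero:
  assumes "Factorial_Ring.prime p" "CHAR('k::field) \<noteq> p"
  shows "of_nat p \<noteq> (0 :: 'k generic_fun alg_closure)"
proof -
  have "\<not> CHAR('k) dvd p"
  proof
    assume "CHAR('k) dvd p"
    then have "CHAR('k) = 1 \<or> CHAR('k) = p" using assms(1) unfolding prime_nat_iff by blast
    then show False using assms(2) CHAR_not_1[where 'a = 'k] by simp
  qed
  then have k: "of_nat p \<noteq> (0 :: 'k)" by (simp add: of_nat_eq_0_iff_char_dvd)
  interpret c: semiring_hom_fun "gen_const :: 'k \<Rightarrow> 'k generic_fun" by (rule gen_const_hom)
  have gc: "gen_const (of_nat i) = (of_nat i :: 'k generic_fun)" for i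
    by (induction i) (simp_all add: c.hom_0 c.hom_1 c.hom_add)
  have "Poly_Mapping.single 0 (of_nat p) \<noteq> (0 :: 'k generic_poly)"
    using k by (metis lookup_single_eq lookup_zero)
  then have "emb (Poly_Mapping.single 0 (of_nat p)) \<noteq> emb (0 :: 'k generic_poly)"
    by (simp only: emb_inject not_False_eq_True)
  then have "gen_const (of_nat p :: 'k) \<noteq> 0"
    unfolding semiring_hom_fun.hom_0[OF emb_hom] by (simp only: gen_const_def emb_def not_False_eq_True)
  then have "of_nat p \<noteq> (0 :: 'k generic_fun)" unfolding gc .
  then show ?thesis by (metis to_ac_of_nat to_ac_eq_0_iff)
qed

text \<open>The indexing \<open>h\<close> is any bijection between two sets with \<open>d\<close>
  elements.\<close>

lemma generic_torus_exists:
  assumes p: "Factorial_Ring.prime p" "CHAR('k::field) \<noteq> p" and a: "a > 0" and d: "d = (p ^ a) ^ m"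
  shows "\<exists>h (w :: 'k generic_fun alg_closure). generic_torus d (p ^ a) m h w"
proof -
  note nz = of_nat_alg_closure_nonzero[OF p]
  obtain w :: "'k generic_fun alg_closure" where w: "w ^ (p ^ a) = 1" "\<And>e. w ^ e = 1 \<Longrightarrow> p ^ a dvd e"
    using primitive_root_exists[OF p(1) nz a] by blast
  have "card {..<d} = card (PiE {..<m} (\<lambda>_. {..<p ^ a}))"
    by (simp add: card_PiE d)
  then obtain h where "bij_betw h {..<d} (PiE {..<m} (\<lambda>_. {..<p ^ a}))"
    using finite_same_card_bij[of "{..<d}" "PiE {..<m} (\<lambda>_. {..<p ^ a})"] by (auto simp: finite_PiE)
  then have "generic_torus d (p ^ a) m h w"
    using w nz prime_gt_0_nat[OF p(1)] by (simp add: generic_torus_def quantum_torus_def)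
  then show ?thesis by blast
qed

theorem theorem4:
  fixes p n :: nat
  assumes "Factorial_Ring.prime p" and "CHAR('k::field) \<noteq> p" and "n \<ge> 3"
  shows "noncrossed_product (universal_division_algebra TYPE('k) (p ^ n))"
proof -
  define d where "d = p ^ n"
  have p1: "p > 1" using prime_gt_1_nat[OF assms(1)] .
  note nz = of_nat_alg_closure_nonzero[OF assms(1,2)]
  \<comment> \<open>With \<open>N = p\<close> and \<open>m = n\<close> the torus yields
    commutativity and exponent \<open>p\<close> of the Galois group.\<close>
  obtain h1 and w1 :: "'k generic_fun alg_closure" where "generic_torus d (p ^ 1) n h1 w1"
    using generic_torus_exists[OF assms(1,2), of 1 d n] by (auto simp: d_def)
  then have t1: "generic_torus d p n h1 w1" by simp
  \<comment> \<open>With \<open>N = p ^ n\<close> and \<open>m = 1\<close> only two coordinates of a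
    leading exponent matter.\<close>
  obtain h2 and w2 :: "'k generic_fun alg_closure" where t2: "generic_torus d (p ^ n) 1 h2 w2"
    using generic_torus_exists[OF assms(1,2), of n d 1] assms(3) by (auto simp: d_def)
  let ?A = "generic_matrix_algebra TYPE('k) d"
  have ops: "monoid.mult ?A = (*)" "ring.add ?A = (+)" "monoid.one ?A = 1\<^sub>m d" "ring.zero ?A = 0\<^sub>m d d"
    by (simp_all add: generic_matrix_algebra_def ring_mat_def)
  have carr: "M \<in> carrier_mat d d" if "M \<in> carrier ?A" for M
    using that generic_algebra_carrier by (rule set_mp[rotated])
  interpret loc: central_localization d "d * d" "gen_B d :: 'k generic_fun fm set"
      "\<lambda>a. to_fm d (generic_matrix d (2 + a))" ?A "to_fm d"
  proof (intro central_localization.intro central_localization_axioms.intro generic_algebra_ring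
      generic_torus.gen_B_matrix_domain[OF t1])
    show "inj_on (to_fm d) (carrier ?A)"
      by (rule inj_onI) (simp add: to_fm_inject carr)
    show "to_fm d ` carrier ?A = gen_B d" by (simp add: gen_B_def)
  qed (simp_all add: ops to_fm_mult to_fm_add to_fm_one to_fm_zero carr)
  have Z: "generic_center TYPE('k) d = loc.Z"
    by (simp add: generic_center_def loc.Z_def)
  have UD: "universal_division_algebra TYPE('k) (p ^ n) = loc.T"
    unfolding universal_division_algebra_def Let_def d_def[symmetric] Z ..
  interpret T: ring loc.T by (rule loc.tensor_ring)
  have "fin_dim_division_algebra loc.T"
    unfolding fin_dim_division_algebra_def T.finite_dimension_def
    using loc.tensor_skew_field loc.tensor_dimension by blast
  moreover have False if K: "maximal_subfield K loc.T" "galois_extension loc.T (ring_center loc.T) K" for K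
  proof (rule loc.galois_maximal_subfield_relations[OF K])
    fix G :: "(('k generic_fun mat \<times> ('k generic_fun mat \<times> 'k generic_fun mat) set \<Rightarrow>\<^sub>0 int) set \<Rightarrow>
        ('k generic_fun mat \<times> ('k generic_fun mat \<times> 'k generic_fun mat) set \<Rightarrow>\<^sub>0 int) set) monoid"
      and u :: "_ \<Rightarrow> 'k generic_fun fm" and v :: "_ \<Rightarrow> _ \<Rightarrow> 'k generic_fun fm" and S :: "('k generic_fun mat \<times> ('k generic_fun mat \<times> 'k generic_fun mat) set \<Rightarrow>\<^sub>0 int) set set" and m
    assume G: "group G" "finite (carrier G)" "m * card (carrier G) = d * d" "m \<le> card (carrier G)"
      and u: "\<And>g. g \<in> carrier G \<Longrightarrow> u g \<in> gen_B d \<and> u g \<noteq> 0"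
      and v: "\<And>g y. g \<in> carrier G \<Longrightarrow> y \<in> S \<Longrightarrow> v g y \<in> gen_B d"
      and uv: "\<And>g k y. g \<in> carrier G \<Longrightarrow> k \<in> carrier G \<Longrightarrow> y \<in> S \<Longrightarrow> mm d (u g) (v k y) = mm d (v (g \<otimes>\<^bsub>G\<^esub> k) y) (u g)"
      and sep: "\<And>g k. g \<in> carrier G \<Longrightarrow> k \<in> carrier G \<Longrightarrow> (\<And>y. y \<in> S \<Longrightarrow> v g y = v k y) \<Longrightarrow> g = k"
    \<comment> \<open>Here \<open>m\<close> is the degree of the subfield, and the total dimension
      is \<open>d^2 = p ^ (2 * n)\<close>. So \<open>|G|\<close> is a power of \<open>p\<close>,
      invertible in the field of coefficients.\<close>
    have "card (carrier G) dvd p ^ (2 * n)"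
      unfolding mult_2 power_add d_def[symmetric] G(3)[symmetric] by simp
    then obtain r where r: "card (carrier G) = p ^ r"
      using divides_primepow_nat[OF assms(1)] by blast
    \<comment> \<open>\<open>d^2 = m |G|\<close> and \<open>m \<le> |G|\<close> give
      \<open>d \<le> |G|\<close>.\<close>
    have "(p ^ n)\<^sup>2 \<le> (card (carrier G))\<^sup>2"
      using mult_right_mono[OF G(4), of "card (carrier G)"] G(3) by (simp add: d_def power2_eq_square)
    then have "p ^ n \<le> card (carrier G)" by (rule power2_le_imp_le) simp
    moreover have "p ^ 2 < p ^ n" using p1 assms(3) by (intro power_strict_increasing) simp_all
    ultimately have big: "p ^ 2 < card (carrier G)" by simp
    have card_nz: "of_nat (card (carrier G)) \<noteq> (0 :: 'k generic_fun alg_closure)"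
      using nz by (simp add: r)
    interpret c1: crossed_torus d p n h1 w1 G u v S
      by (intro crossed_torus.intro crossed_torus_axioms.intro t1 G(1) card_nz uv sep) (simp_all add: u v)
    interpret c2: crossed_torus d "p ^ n" 1 h2 w2 G u v S
      by (intro crossed_torus.intro crossed_torus_axioms.intro t2 G(1) card_nz uv sep) (simp_all add: u v)
    interpret comm_group G
      by (rule c1.group_comm_groupI) (rule c1.commutative)
    have "card (carrier G) \<le> p ^ 2"
    proof (rule planar_exponent_card[OF assms(1) c1.exponent G(2)])
      fix x y z assume xyz: "x \<in> carrier G" "y \<in> carrier G" "z \<in> carrier G"
      define e where "e i k = Poly_Mapping.lookup (c2.deg (if i = 0 then x else if i = 1 then y else z)) k" for i k :: nat
      have n0: "n > 0" using assms(3) by simp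
      show "\<exists>a b c :: nat. x [^]\<^bsub>G\<^esub> a \<otimes>\<^bsub>G\<^esub> y [^]\<^bsub>G\<^esub> b \<otimes>\<^bsub>G\<^esub> z [^]\<^bsub>G\<^esub> c = \<one>\<^bsub>G\<^esub>
          \<and> (\<not> p dvd a \<or> \<not> p dvd b \<or> \<not> p dvd c)"
      proof (rule planar_relation_mod[OF assms(1) n0, of e])
        fix c :: "nat \<Rightarrow> nat" assume c: "\<And>k. k < 2 \<Longrightarrow> (c 0 * e 0 k + c 1 * e 1 k + c 2 * e 2 k) mod p ^ n = 0"
          "\<not> p dvd c 0 \<or> \<not> p dvd c 1 \<or> \<not> p dvd c 2"
        \<comment> \<open>Both relevant exponents of this word are divisible by
          \<open>p ^ n\<close>, so it equals the empty word in the group.\<close>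
        have "c2.gprod (replicate (c 0) x @ replicate (c 1) y @ replicate (c 2) z) = c2.gprod []"
        proof (rule c2.word_eq)
          fix k :: nat assume "k < 2 * 1"
          then show "(\<Sum>g\<leftarrow>replicate (c 0) x @ replicate (c 1) y @ replicate (c 2) z. Poly_Mapping.lookup (c2.deg g) k) mod p ^ n
            = (\<Sum>g\<leftarrow>[]. Poly_Mapping.lookup (c2.deg g) k) mod p ^ n"
            using c(1)[of k] by (simp add: e_def sum_list_replicate add.assoc)
        qed (use xyz in auto)
        moreover have "c2.gprod (replicate (c 0) x @ replicate (c 1) y @ replicate (c 2) z)
            = x [^]\<^bsub>G\<^esub> c 0 \<otimes>\<^bsub>G\<^esub> y [^]\<^bsub>G\<^esub> c 1 \<otimes>\<^bsub>G\<^esub> z [^]\<^bsub>G\<^esub> c 2"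
        proof -
          have s: "set (replicate i g) \<subseteq> carrier G" if "g \<in> carrier G" for i g using that by auto
          have "set (replicate (c 1) y @ replicate (c 2) z) \<subseteq> carrier G" using xyz by auto
          then show ?thesis
            using xyz by (simp add: c2.gprod_append s c2.gprod_replicate c1.m_assoc del: set_replicate)
        qed
        ultimately show "\<exists>a b c :: nat. x [^]\<^bsub>G\<^esub> a \<otimes>\<^bsub>G\<^esub> y [^]\<^bsub>G\<^esub> b \<otimes>\<^bsub>G\<^esub> z [^]\<^bsub>G\<^esub> c = \<one>\<^bsub>G\<^esub>
            \<and> (\<not> p dvd a \<or> \<not> p dvd b \<or> \<not> p dvd c)"
          using c(2) by (intro exI[of _ "c 0"] exI[of _ "c 1"] exI[of _ "c 2"] conjI) (simp_all only: c2.gprod_simps)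
      qed
    qed
    then show False using big by simp
  qed
  ultimately show ?thesis unfolding UD noncrossed_product_def by blast
qed

end
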